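(* For $n\ge 2$ let $Z_n=B_2^n+B_2^{n-1}\subset\mathbb{R}^n$ be the Minkowski sum of the Euclidean unit ball $B_2^n$ of $\mathbb{R}^n$ and the Euclidean unit ball $B_2^{n-1}$ of the hyperplane $\{x_n=0\}$. Then $Z_n$ is an intersection body for $n=5$ and $n=6$, and $Z_n$ is not an intersection body for any $n\ge 8$.
   Context: For a star body $K\subset\mathbb{R}^n$ the radial function is $\rho_K(\xi)=\max\{a: a\xi\in K\}$, $\xi\in S^{n-1}$. The spherical Radon transform of a continuous function $g$ on $S^{n-1}$ is $Rg(\xi)=\int_{S^{n-1}\cap\xi^\perp} g(\theta)\,d\theta$. An origin-symmetric star body $K\subset\mathbb{R}^n$ is an intersection body if $\rho_K$ is the spherical Radon transform of an even non-negative finite Borel measure $\mu$ on $S^{n-1}$, i.e. $\int_{S^{n-1}}\rho_K(\xi)g(\xi)\,d\xi=\int_{S^{n-1}}Rg(\xi)\,d\mu(\xi)$ for every continuous function $g$ on $S^{n-1}$. As a function of the angle $\varphi\in[0,\pi/2]$ from the $x_n$-axis, the radial function of $Z_n$ is $\sec\varphi$ for $0\le\varphi\le\pi/4$ and $2\sin\varphi$ for $\pi/4\le\varphi\le\pi/2$. *)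

theory Defs
  imports "HOL-Analysis.Analysis"
begin

text \<open>
  Lebesgue measure on a linear subspace \<open>V\<close> of dimension \<open>d\<close> in a Euclidean space of
  dimension \<open>n\<close>. By Fubini, the cylinder of radius 1 over \<open>A \<subseteq> V\<close> has \<open>n\<close>-dimensional volume
  equal to the \<open>d\<close>-dimensional volume of \<open>A\<close> times the volume of the unit ball of the
  orthogonal complement of \<open>V\<close>; dividing by the latter gives the measure without choosing
  coordinates on \<open>V\<close>. The map \<open>closest_point V\<close> is the orthogonal projection onto \<open>V\<close>.
\<close>

definition subspace_lborel :: "'a::euclidean_space set \<Rightarrow> 'a measure" where
  "subspace_lborel V =
     scale_measure (ennreal (1 / unit_ball_vol (real (DIM('a) - dim V))))
       (distr (restrict_space lborel {x. norm (x - closest_point V x) \<le> 1})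
              (restrict_space borel V) (closest_point V))"

text \<open>
  Surface measure (of dimension \<open>d - 1\<close>, not normalised) on the unit sphere of a
  \<open>d\<close>-dimensional subspace \<open>V\<close>, given by polar coordinates: the measure of \<open>A\<close> is \<open>d\<close> times
  the volume of the cone \<open>{t x | x \<in> A, 0 < t \<le> 1}\<close>. In particular it is the counting
  measure on two points if \<open>d = 1\<close>.
\<close>

definition sphere_measure :: "'a::euclidean_space set \<Rightarrow> 'a measure" where
  "sphere_measure V =
     scale_measure (ennreal (real (dim V)))
       (distr (restrict_space (subspace_lborel V) (cball 0 1 - {0}))
              (restrict_space borel (sphere 0 1 \<inter> V)) (\<lambda>x. x /\<^sub>R norm x))"

definition spherical_radon :: "('a::euclidean_space \<Rightarrow> real) \<Rightarrow> 'a \<Rightarrow> real" where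
  "spherical_radon g \<xi> = (LINT \<theta>|sphere_measure ({\<xi>}\<^sup>\<bottom>). g \<theta>)"

definition radial_fun :: "'a::euclidean_space set \<Rightarrow> 'a \<Rightarrow> real" where
  "radial_fun K \<xi> = (GREATEST a. a *\<^sub>R \<xi> \<in> K)"

definition star_body :: "'a::euclidean_space set \<Rightarrow> bool" where
  "star_body K \<longleftrightarrow> compact K \<and> 0 \<in> interior K \<and> (\<forall>x\<in>K. closed_segment 0 x \<subseteq> K) \<and>
     continuous_on (sphere 0 1) (radial_fun K)"

definition origin_symmetric :: "'a::euclidean_space set \<Rightarrow> bool" where
  "origin_symmetric K \<longleftrightarrow> uminus ` K = K"

text \<open>
  Measures on the sphere live on \<open>sphere 0 1\<close> itself, not on the ambient space, because a test
  function is only constrained on the sphere.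
\<close>

definition even_finite_sphere_measure :: "'a::euclidean_space measure \<Rightarrow> bool" where
  "even_finite_sphere_measure \<mu> \<longleftrightarrow>
     space \<mu> = sphere 0 1 \<and> sets \<mu> = sets (restrict_space borel (sphere 0 1)) \<and>
     finite_measure \<mu> \<and> (\<forall>A\<in>sets \<mu>. emeasure \<mu> (uminus ` A) = emeasure \<mu> A)"

definition intersection_body :: "'a::euclidean_space set \<Rightarrow> bool" where
  "intersection_body K \<longleftrightarrow> star_body K \<and> origin_symmetric K \<and>
     (\<exists>\<mu>. even_finite_sphere_measure \<mu> \<and>
       (\<forall>g. continuous_on (sphere 0 1) g \<longrightarrow>
         (LINT \<xi>|sphere_measure UNIV. radial_fun K \<xi> * g \<xi>) = (LINT \<xi>|\<mu>. spherical_radon g \<xi>)))"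

text \<open>The coordinate \<open>k\<close> plays the role of \<open>x\<^sub>n\<close>.\<close>

definition ball_sum :: "'n::finite \<Rightarrow> (real^'n) set" where
  "ball_sum k = cball 0 1 + {y \<in> cball 0 1. y $ k = 0}"

end

(* Write e for the x_n-axis. The Radon transform is computed from a slicing formula: in the gnomonic
   coordinate x, the surface measure of the sphere is an integral over x of the measures on the subsphere
   orthogonal to a given direction, shifted by x. It follows from Fubini along the direction (translation
   invariance only) and from a change of gauge for homogeneous measures, so neither rotations nor coordinates
   are needed. The slicing formula gives the self-adjointness of the Radon transform, because the pairing of
   the two shifted transforms is symmetric and one lets x tend to 0, and the formula for zonal functions:
   with v = sin^2 of the angle between theta and e, and w = cos^2 of the angle between xi and e, the
   transform has kernel (v - w)_+^((n-4)/2). Put G(v) = v^((n-3)/2) times the radial function of Z_n.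

   For n = 6 the equation says that the density is essentially G'', which is computed explicitly and is
   positive; a density for n = 5 is obtained from it by averaging with a positive weight.
   For n >= 8 the kernel has nonnegative third differences in v, so the same would hold for G if Z_n were an
   intersection body; but G'' jumps down at v = 1/2, so G has a negative third difference there. A test
   function on the sphere that is a third difference of a tent function in v makes this precise. *)

theory Submission
  imports Defs
begin

section \<open>Homogeneous measures and the slicing formula\<close>

text \<open>The Radon transforms act on functions with values in [0,\<infinity>], so integrals may
  be exchanged freely. Signed test functions enter later, through equality of image measures or by
  adding a constant. The threshold 8 comes from the exponent p = (n - 4) / 2 of the kernel: the
  second derivative of x_+^p is nondecreasing for p \<ge> 2, but for p = 3/2, that is n = 7, it
  decreases on x > 0. As G is once but not twice differentiable at 1/2, differences replace
  derivatives. In the negative part the measure is arbitrary; it need be neither zonal nor given by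
  a density. This is harmless: it suffices to find one continuous zonal function whose Radon
  transform is nonnegative everywhere and whose pairing with the radial function is negative. In the
  positive part the density for n = 6 jumps on the cone over the edge where the flat and the round
  boundary meet. Self-adjointness is therefore needed for measurable, not only for continuous,
  densities.\<close>

lemma nn_integral_scaled_tail:
  fixes q :: real and m :: nat
  assumes "q > 0" "m \<ge> 1"
  shows "(\<integral>\<^sup>+t. ennreal ((q / t) ^ m / t) * indicator {q..} t \<partial>lborel) = ennreal (1 / m)"
proof -
  let ?F = "\<lambda>t::real. - ((q / t) ^ m / m)"
  have "(\<integral>\<^sup>+t. ennreal ((q / t) ^ m / t) * indicator {q..} t \<partial>lborel) = ennreal (0 - ?F q)"
  proof (rule nn_integral_FTC_atLeast[where F = ?F])
    fix t assume t: "q \<le> t"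
    then have "t > 0" using assms by simp
    obtain k where k: "m = Suc k" using assms(2) by (cases m) auto
    have "((\<lambda>t. - ((q / t) ^ m / m)) has_real_derivative
        - (real m * (q / t) ^ (m - 1) * (- q / t\<^sup>2) / m)) (at t)"
      using \<open>t > 0\<close> assms by (auto intro!: derivative_eq_intros simp: power2_eq_square)
    also have "- (real m * (q / t) ^ (m - 1) * (- q / t\<^sup>2) / m) = (q / t) ^ m / t"
      using \<open>t > 0\<close> by (simp add: k power2_eq_square field_simps del: of_nat_Suc)
    finally show "DERIV ?F t :> (q / t) ^ m / t" .
    show "0 \<le> (q / t) ^ m / t" using \<open>t > 0\<close> assms by simp
  next
    have "((\<lambda>t. - ((q * inverse t) ^ m / m)) \<longlongrightarrow> - ((q * 0) ^ m / m)) at_top"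
      by (intro tendsto_intros tendsto_inverse_0_at_top filterlim_ident) (use assms in auto)
    then show "(?F \<longlongrightarrow> 0) at_top" using assms by (simp add: divide_inverse power_0_left split: if_splits)
  qed simp
  then show ?thesis using assms by simp
qed

lemma nn_integral_power_below:
  fixes p :: real and d :: nat
  assumes "p > 0" "d \<ge> 1"
  shows "(\<integral>\<^sup>+t. ennreal (t ^ (d - 1)) * indicator {0..1/p} t \<partial>lborel) = ennreal (1 / (d * p ^ d))"
proof -
  obtain k where k: "d = Suc k" using assms(2) by (cases d) auto
  have "(\<integral>\<^sup>+t. ennreal (t ^ (d - 1)) * indicator {0..1/p} t \<partial>lborel)
      = ennreal ((1/p) ^ d / d - 0 ^ d / d)"
  proof (rule nn_integral_FTC_Icc[where F = "\<lambda>t. t ^ d / d"])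
    fix t :: real
    have "((\<lambda>t. t ^ d / d) has_real_derivative (real d * t ^ (d - 1)) / d) (at t)"
      by (auto intro!: derivative_eq_intros)
    then show "DERIV (\<lambda>t. t ^ d / d) t :> t ^ (d - 1)" using assms by simp
  qed (use assms in auto)
  then show ?thesis using assms by (simp add: field_simps power_divide power_0_left)
qed

text \<open>Stands for Lebesgue measure of a \<open>d\<close>-dimensional subspace, regarded as a
  measure on the ambient space. Only homogeneity and finiteness on the unit ball are recorded, so
  that a hyperplane section falls under the same lemmas; \<open>d\<close> need not be the dimension
  of the type.\<close>

locale homogeneous_measure =
  fixes M :: "'a::euclidean_space measure" and d :: nat
  assumes sets_M [measurable_cong]: "sets M = sets borel"
    and scaling: "\<And>f t. f \<in> borel_measurable borel \<Longrightarrow> t > 0 \<Longrightarrow>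
      (\<integral>\<^sup>+z. f z \<partial>M) = ennreal (t ^ d) * (\<integral>\<^sup>+z. f (t *\<^sub>R z) \<partial>M)"
    and finite_ball: "emeasure M (cball 0 1) < \<infinity>"
    and degree_pos: "d \<ge> 1"
begin

lemma space_M: "space M = UNIV"
  using sets_eq_imp_space_eq[OF sets_M] by simp

lemma emeasure_scaled_cball:
  assumes "t > 0"
  shows "emeasure M (cball 0 t) = ennreal (t ^ d) * emeasure M (cball 0 1)"
proof -
  have "emeasure M (cball 0 t) = (\<integral>\<^sup>+z. indicator (cball 0 t) z \<partial>M)"
    by (simp add: sets_M)
  also have "\<dots> = ennreal (t ^ d) * (\<integral>\<^sup>+z. indicator (cball 0 t) (t *\<^sub>R z) \<partial>M)"
    using assms by (intro scaling borel_measurable_indicator) auto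
  also have "(\<lambda>z::'a. indicator (cball 0 t) (t *\<^sub>R z) :: ennreal) = indicator (cball 0 1)"
    using assms by (auto simp: fun_eq_iff indicator_def)
  finally show ?thesis by (simp add: sets_M)
qed

sublocale sigma_finite_measure M
proof
  let ?A = "range (\<lambda>n::nat. cball (0::'a) (Suc n))"
  have "\<exists>n::nat. norm x \<le> real (Suc n)" for x :: 'a
    using real_arch_simple[of "norm x"] by (metis le_add2 of_nat_mono order_trans plus_1_eq_Suc)
  then have "\<Union>?A = UNIV" by auto
  moreover have "emeasure M (cball 0 (Suc n)) \<noteq> \<infinity>" for n :: nat
    using emeasure_scaled_cball[of "Suc n"] finite_ball by (simp add: ennreal_mult_eq_top_iff del: of_nat_Suc)
  ultimately show "\<exists>A. countable A \<and> A \<subseteq> sets M \<and> \<Union> A = space M \<and> (\<forall>a\<in>A. emeasure M a \<noteq> \<infinity>)"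
    by (intro exI[of _ ?A]) (auto simp: sets_M space_M)
qed

sublocale pair: pair_sigma_finite lborel M ..

text \<open>In polar coordinates both sides are the integral of \<phi> / p^d over directions. The
  radial integral is created artificially: the constant 1 / m is written as an integral over t of a
  kernel in \<open>q z\<close>, and z is rescaled by t inside.\<close>

lemma gauge_change:
  fixes \<phi> :: "'a \<Rightarrow> ennreal" and p q :: "'a \<Rightarrow> real" and m :: nat
  assumes [measurable]: "\<phi> \<in> borel_measurable borel" "p \<in> borel_measurable borel" "q \<in> borel_measurable borel"
    and \<phi>: "\<And>t z. t > 0 \<Longrightarrow> \<phi> (t *\<^sub>R z) = \<phi> z"
    and p: "\<And>t z. t > 0 \<Longrightarrow> p (t *\<^sub>R z) = t * p z"
    and q: "\<And>t z. t > 0 \<Longrightarrow> q (t *\<^sub>R z) = t * q z"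
    and pos: "\<And>z. \<phi> z \<noteq> 0 \<Longrightarrow> p z > 0 \<and> q z > 0"
    and m: "m \<ge> 1"
  shows "of_nat d * (\<integral>\<^sup>+z. \<phi> z * indicator {z. p z \<le> 1} z \<partial>M) =
    of_nat m * (\<integral>\<^sup>+z. \<phi> z * ennreal (q z ^ m / p z ^ d) * indicator {z. q z \<le> 1} z \<partial>M)"
proof -
  \<comment> \<open>For x > 0 this kernel has total mass 1 / m and is homogeneous of degree -1 in
    (x, t). The second indicator makes it vanish for t \<le> 0, where no rescaling is
    possible.\<close>
  define K where "K x t = ennreal ((x / t) ^ m / t) * indicator {x..} t * indicator {0<..} t" for x t :: real
  have K_meas [measurable]: "case_prod K \<in> borel_measurable (borel \<Otimes>\<^sub>M borel)"
  proof -
    have "case_prod K = (\<lambda>(x, t). ennreal ((x / t) ^ m / t) * indicator {z. fst z \<le> snd z \<and> 0 < snd z} (x, t))"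
      by (auto simp: K_def fun_eq_iff indicator_def)
    also have "\<dots> \<in> borel_measurable (borel \<Otimes>\<^sub>M borel)" by measurable
    finally show ?thesis .
  qed
  have K_int: "(\<integral>\<^sup>+t. K x t \<partial>lborel) = ennreal (1 / m)" if "x > 0" for x
  proof -
    have "K x t = ennreal ((x / t) ^ m / t) * indicator {x..} t" for t
      using that by (auto simp: K_def indicator_def)
    then show ?thesis using nn_integral_scaled_tail[OF that m] by simp
  qed
  let ?I = "\<integral>\<^sup>+z. \<phi> z * indicator {z. p z \<le> 1} z \<partial>M"
  let ?J = "\<integral>\<^sup>+z. \<phi> z * ennreal (q z ^ m / p z ^ d) * indicator {z. q z \<le> 1} z \<partial>M"
  have "?I * ennreal (1 / m) = (\<integral>\<^sup>+z. \<phi> z * indicator {z. p z \<le> 1} z * ennreal (1 / m) \<partial>M)"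
    by (simp add: nn_integral_multc)
  also have "\<dots> = (\<integral>\<^sup>+z. (\<integral>\<^sup>+t. \<phi> z * indicator {z. p z \<le> 1} z * K (q z) t \<partial>lborel) \<partial>M)"
  proof (rule nn_integral_cong)
    fix z
    show "\<phi> z * indicator {z. p z \<le> 1} z * ennreal (1 / m)
        = (\<integral>\<^sup>+t. \<phi> z * indicator {z. p z \<le> 1} z * K (q z) t \<partial>lborel)"
      using pos[of z] K_int[of "q z"] by (cases "\<phi> z = 0") (auto simp: nn_integral_cmult)
  qed
  also have "\<dots> = (\<integral>\<^sup>+t. (\<integral>\<^sup>+z. \<phi> z * indicator {z. p z \<le> 1} z * K (q z) t \<partial>M) \<partial>lborel)"
    by (rule pair.Fubini') measurable
  also have "\<dots> = (\<integral>\<^sup>+t. (\<integral>\<^sup>+z. \<phi> z * ennreal (q z ^ m) * indicator {z. q z \<le> 1} z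
      * (ennreal (t ^ (d - 1)) * indicator {0..1/p z} t) * indicator {0<..} t \<partial>M) \<partial>lborel)"
  proof (rule nn_integral_cong)
    fix t :: real
    show "(\<integral>\<^sup>+z. \<phi> z * indicator {z. p z \<le> 1} z * K (q z) t \<partial>M)
      = (\<integral>\<^sup>+z. \<phi> z * ennreal (q z ^ m) * indicator {z. q z \<le> 1} z
        * (ennreal (t ^ (d - 1)) * indicator {0..1/p z} t) * indicator {0<..} t \<partial>M)"
    proof (cases "t > 0")
      \<comment> \<open>For fixed t the substitution of t z for z turns q z \<le> t into q z \<le> 1
        and p z \<le> 1 into t \<le> 1 / p z. What remains is an integral of t^(d - 1).\<close>
      case True
      have "(\<integral>\<^sup>+z. \<phi> z * indicator {z. p z \<le> 1} z * K (q z) t \<partial>M)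
        = ennreal (t ^ d) * (\<integral>\<^sup>+z. \<phi> (t *\<^sub>R z) * indicator {z. p z \<le> 1} (t *\<^sub>R z) * K (q (t *\<^sub>R z)) t \<partial>M)"
        using True by (intro scaling) auto
      also have "\<dots> = (\<integral>\<^sup>+z. ennreal (t ^ d) * (\<phi> (t *\<^sub>R z) * indicator {z. p z \<le> 1} (t *\<^sub>R z) * K (q (t *\<^sub>R z)) t) \<partial>M)"
        by (subst nn_integral_cmult) auto
      also have "\<dots> = (\<integral>\<^sup>+z. \<phi> z * ennreal (q z ^ m) * indicator {z. q z \<le> 1} z
        * (ennreal (t ^ (d - 1)) * indicator {0..1/p z} t) * indicator {0<..} t \<partial>M)"
      proof (rule nn_integral_cong)
        fix z
        show "ennreal (t ^ d) * (\<phi> (t *\<^sub>R z) * indicator {z. p z \<le> 1} (t *\<^sub>R z) * K (q (t *\<^sub>R z)) t)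
          = \<phi> z * ennreal (q z ^ m) * indicator {z. q z \<le> 1} z
            * (ennreal (t ^ (d - 1)) * indicator {0..1/p z} t) * indicator {0<..} t"
        proof (cases "\<phi> z = 0")
          case False
          then have pq: "p z > 0" "q z > 0" using pos by auto
          have e: "t * p z \<le> 1 \<longleftrightarrow> t \<le> 1 / p z" "t * q z \<le> t \<longleftrightarrow> q z \<le> 1"
            using pq True by (auto simp: field_simps)
          have "t ^ d * (q z ^ m / t) = q z ^ m * t ^ (d - 1)"
            using True degree_pos by (cases d) auto
          then have "ennreal (t ^ d) * ennreal (q z ^ m / t) = ennreal (q z ^ m) * ennreal (t ^ (d - 1))"
            using pq True by (simp flip: ennreal_mult)
          then show ?thesis
            using True pq e by (auto simp: \<phi> p q K_def indicator_def mult_ac)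
        qed (use \<phi> True in auto)
      qed
      finally show ?thesis .
    qed (simp add: K_def)
  qed
  also have "\<dots> = (\<integral>\<^sup>+z. (\<integral>\<^sup>+t. \<phi> z * ennreal (q z ^ m) * indicator {z. q z \<le> 1} z
      * (ennreal (t ^ (d - 1)) * indicator {0..1/p z} t) * indicator {0<..} t \<partial>lborel) \<partial>M)"
  proof (rule pair.Fubini'[symmetric])
    have "(\<lambda>(t, z). \<phi> z * ennreal (q z ^ m) * indicator {z. q z \<le> 1} z
        * (ennreal (t ^ (d - 1)) * indicator {0..1/p z} t) * indicator {0<..} t)
      = (\<lambda>(t, z). \<phi> z * ennreal (q z ^ m) * indicator {z. q z \<le> 1} z
        * ennreal (t ^ (d - 1)) * indicator {x. 0 < fst x \<and> fst x \<le> 1 / p (snd x)} (t, z))"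
      by (auto simp: fun_eq_iff indicator_def mult_ac)
    also have "\<dots> \<in> borel_measurable (lborel \<Otimes>\<^sub>M M)" by measurable
    finally show "(\<lambda>(t, z). \<phi> z * ennreal (q z ^ m) * indicator {z. q z \<le> 1} z
        * (ennreal (t ^ (d - 1)) * indicator {0..1/p z} t) * indicator {0<..} t) \<in> borel_measurable (lborel \<Otimes>\<^sub>M M)" .
  qed
  also have "\<dots> = (\<integral>\<^sup>+z. \<phi> z * ennreal (q z ^ m / p z ^ d) * indicator {z. q z \<le> 1} z * ennreal (1 / d) \<partial>M)"
  proof (rule nn_integral_cong)
    fix z
    show "(\<integral>\<^sup>+t. \<phi> z * ennreal (q z ^ m) * indicator {z. q z \<le> 1} z
      * (ennreal (t ^ (d - 1)) * indicator {0..1/p z} t) * indicator {0<..} t \<partial>lborel)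
      = \<phi> z * ennreal (q z ^ m / p z ^ d) * indicator {z. q z \<le> 1} z * ennreal (1 / d)"
    proof (cases "\<phi> z = 0")
      case False
      then have pq: "p z > 0" "q z > 0" using pos by auto
      have "(\<integral>\<^sup>+t. \<phi> z * ennreal (q z ^ m) * indicator {z. q z \<le> 1} z
          * (ennreal (t ^ (d - 1)) * indicator {0..1/p z} t) * indicator {0<..} t \<partial>lborel)
        = (\<integral>\<^sup>+t. \<phi> z * ennreal (q z ^ m) * indicator {z. q z \<le> 1} z
          * (ennreal (t ^ (d - 1)) * indicator {0..1/p z} t) \<partial>lborel)"
        by (rule nn_integral_cong_AE, rule eventually_mono[OF AE_lborel_singleton[of 0]])
          (auto simp: indicator_def)
      also have "\<dots> = \<phi> z * ennreal (q z ^ m) * indicator {z. q z \<le> 1} z * ennreal (1 / (d * p z ^ d))"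
        using pq degree_pos by (simp add: nn_integral_cmult nn_integral_power_below[unfolded One_nat_def])
      also have "\<dots> = \<phi> z * indicator {z. q z \<le> 1} z * (ennreal (q z ^ m) * ennreal (1 / (d * p z ^ d)))"
        by (simp add: mult_ac)
      also have "ennreal (q z ^ m) * ennreal (1 / (d * p z ^ d)) = ennreal (q z ^ m / p z ^ d) * ennreal (1 / d)"
        using pq by (simp add: mult_ac flip: ennreal_mult)
      finally show ?thesis by (simp add: mult_ac)
    qed simp
  qed
  also have "\<dots> = ?J * ennreal (1 / d)" by (simp add: nn_integral_multc)
  finally have eq: "?I * ennreal (1 / m) = ?J * ennreal (1 / d)" .
  have m1: "of_nat m * ennreal (1 / m) = 1" "of_nat d * ennreal (1 / d) = 1"
    using m degree_pos by (simp_all add: ennreal_of_nat_eq_real_of_nat flip: ennreal_mult)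
  have "of_nat d * ?I = of_nat d * of_nat m * (?I * ennreal (1 / m))"
    using m1 by (metis (no_types, lifting) mult.assoc mult.commute mult.right_neutral)
  also have "\<dots> = of_nat m * ?J"
    unfolding eq using m1 by (metis (no_types, lifting) mult.assoc mult.commute mult.right_neutral)
  finally show ?thesis .
qed

end

section \<open>Slicing a measure along a line of invariance\<close>

definition hyperplane_proj :: "'a::euclidean_space \<Rightarrow> 'a \<Rightarrow> 'a" where
  "hyperplane_proj a y = y - (y \<bullet> a) *\<^sub>R a"

text \<open>For a unit vector a, a slab of width 2 weighted by 1/2 has total weight one on every
  line in direction a. Averaging over it replaces the choice of a base hyperplane.\<close>

abbreviation slab_weight :: "'a::euclidean_space \<Rightarrow> 'a \<Rightarrow> ennreal" where
  "slab_weight a y \<equiv> indicator {y. \<bar>y \<bullet> a\<bar> \<le> 1} y / 2"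

abbreviation gnomonic_weight :: "nat \<Rightarrow> real \<Rightarrow> ennreal" where
  "gnomonic_weight d x \<equiv> ennreal (1 / sqrt (1 + x\<^sup>2) ^ d)"

text \<open>For Lebesgue measure and a unit vector a this is the (n - 1)-dimensional Lebesgue
  measure of the hyperplane orthogonal to a, kept as a Borel measure on the ambient space. It is the
  cylinder construction of \<open>subspace_lborel\<close>, with [-1, 1] as the unit ball of the
  complement.\<close>

definition slab_section :: "'a::euclidean_space \<Rightarrow> 'a measure \<Rightarrow> 'a measure" where
  "slab_section a M =
     distr (density M (\<lambda>y. slab_weight a y)) borel (hyperplane_proj a)"

text \<open>The unnormalised surface integral over the unit sphere, read off from polar coordinates
  as in \<open>sphere_measure\<close>.\<close>

definition cone_integral :: "nat \<Rightarrow> 'a::euclidean_space measure \<Rightarrow> ('a \<Rightarrow> ennreal) \<Rightarrow> ennreal" where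
  "cone_integral d M f =
     of_nat d * (\<integral>\<^sup>+z. f (z /\<^sub>R norm z) * indicator (cball 0 1 - {0}) z \<partial>M)"

lemma measurable_hyperplane_proj [measurable (raw)]:
  assumes [measurable]: "f \<in> borel_measurable N" "g \<in> borel_measurable N"
  shows "(\<lambda>x. hyperplane_proj (f x) (g x)) \<in> borel_measurable N"
  unfolding hyperplane_proj_def by measurable

lemma hyperplane_proj_scaleR: "hyperplane_proj a (t *\<^sub>R z) = t *\<^sub>R hyperplane_proj a z"
  by (simp add: hyperplane_proj_def algebra_simps)

lemma hyperplane_proj_add: "hyperplane_proj a (y + z) = hyperplane_proj a y + hyperplane_proj a z"
  by (simp add: hyperplane_proj_def algebra_simps)

lemma hyperplane_proj_along: "norm a = 1 \<Longrightarrow> hyperplane_proj a (u *\<^sub>R a) = 0"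
  by (simp add: hyperplane_proj_def dot_square_norm)

lemma hyperplane_proj_idem: "norm a = 1 \<Longrightarrow> hyperplane_proj a (hyperplane_proj a y) = hyperplane_proj a y"
  by (simp add: hyperplane_proj_def dot_square_norm algebra_simps)

lemma hyperplane_proj_inner: "norm a = 1 \<Longrightarrow> hyperplane_proj a y \<bullet> a = 0"
  by (simp add: hyperplane_proj_def dot_square_norm algebra_simps)

lemma nn_integral_slab_section:
  assumes [measurable_cong]: "sets M = sets borel" and [measurable]: "f \<in> borel_measurable borel"
  shows "(\<integral>\<^sup>+z. f z \<partial>slab_section a M) =
    (\<integral>\<^sup>+y. slab_weight a y * f (hyperplane_proj a y) \<partial>M)"
  unfolding slab_section_def by (subst nn_integral_distr) (auto simp: nn_integral_density)

lemma sets_slab_section [measurable_cong]: "sets (slab_section a M) = sets borel"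
  by (simp add: slab_section_def)

text \<open>Invariance is demanded along one line only, because a hyperplane section keeps just the
  invariance along lines inside the hyperplane. This allows a second slicing, of a great
  subsphere.\<close>

locale line_invariant_measure = homogeneous_measure M d for M :: "'a::euclidean_space measure" and d +
  fixes a :: 'a
  assumes unit: "norm a = 1"
    and translate: "\<And>f t. f \<in> borel_measurable borel \<Longrightarrow> (\<integral>\<^sup>+z. f (z + t *\<^sub>R a) \<partial>M) = (\<integral>\<^sup>+z. f z \<partial>M)"
    and degree_ge_2: "d \<ge> 2"
begin

text \<open>Fubini along the direction a without coordinates. The inner integral depends only on the
  line through y, so y itself may be its base point; translating y by -u a moves the shift onto the
  slab weight, whose integral over u is 1.\<close>

lemma cylinder:
  assumes [measurable]: "F \<in> borel_measurable borel"
  shows "(\<integral>\<^sup>+z. F z \<partial>M) =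
    (\<integral>\<^sup>+y. slab_weight a y * (\<integral>\<^sup>+u. F (hyperplane_proj a y + u *\<^sub>R a) \<partial>lborel) \<partial>M)"
proof -
  let ?S = "\<lambda>y. slab_weight a y :: ennreal"
  have "(\<integral>\<^sup>+y. ?S y * (\<integral>\<^sup>+u. F (hyperplane_proj a y + u *\<^sub>R a) \<partial>lborel) \<partial>M)
      = (\<integral>\<^sup>+y. (\<integral>\<^sup>+u. ?S y * F (y + u *\<^sub>R a) \<partial>lborel) \<partial>M)"
  proof (rule nn_integral_cong)
    fix y
    have "(\<integral>\<^sup>+u. F (hyperplane_proj a y + u *\<^sub>R a) \<partial>lborel)
        = (\<integral>\<^sup>+u. F (hyperplane_proj a y + (y \<bullet> a + 1 * u) *\<^sub>R a) \<partial>lborel)"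
      by (subst nn_integral_real_affine[where c = 1 and t = "y \<bullet> a"]) auto
    also have "\<dots> = (\<integral>\<^sup>+u. F (y + u *\<^sub>R a) \<partial>lborel)"
      by (simp add: hyperplane_proj_def algebra_simps)
    finally show "?S y * (\<integral>\<^sup>+u. F (hyperplane_proj a y + u *\<^sub>R a) \<partial>lborel)
        = (\<integral>\<^sup>+u. ?S y * F (y + u *\<^sub>R a) \<partial>lborel)"
      by (simp add: nn_integral_cmult)
  qed
  also have "\<dots> = (\<integral>\<^sup>+u. (\<integral>\<^sup>+y. ?S y * F (y + u *\<^sub>R a) \<partial>M) \<partial>lborel)"
    by (rule pair.Fubini') measurable
  also have "\<dots> = (\<integral>\<^sup>+u. (\<integral>\<^sup>+y. ?S (y - u *\<^sub>R a) * F y \<partial>M) \<partial>lborel)"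
  proof (rule nn_integral_cong)
    fix u :: real
    show "(\<integral>\<^sup>+y. ?S y * F (y + u *\<^sub>R a) \<partial>M) = (\<integral>\<^sup>+y. ?S (y - u *\<^sub>R a) * F y \<partial>M)"
      by (subst translate[where t = u, symmetric]) auto
  qed
  also have "\<dots> = (\<integral>\<^sup>+y. (\<integral>\<^sup>+u. ?S (y - u *\<^sub>R a) * F y \<partial>lborel) \<partial>M)"
    by (rule pair.Fubini'[symmetric]) measurable
  also have "\<dots> = (\<integral>\<^sup>+y. F y \<partial>M)"
  proof (rule nn_integral_cong)
    fix y
    have "(\<integral>\<^sup>+u. ?S (y - u *\<^sub>R a) * F y \<partial>lborel)
        = (\<integral>\<^sup>+u. F y / 2 * indicator {y \<bullet> a - 1..y \<bullet> a + 1} u \<partial>lborel)"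
      using unit by (intro nn_integral_cong)
        (auto simp: indicator_def inner_diff_left dot_square_norm abs_le_iff divide_ennreal_def mult_ac)
    also have "\<dots> = F y / 2 * 2"
      by (simp add: nn_integral_cmult)
    also have "\<dots> = F y"
      by (simp add: ennreal_divide_times)
    finally show "(\<integral>\<^sup>+u. ?S (y - u *\<^sub>R a) * F y \<partial>lborel) = F y" .
  qed
  finally show ?thesis by simp
qed

text \<open>A segment of the axis has mass linear in its length by \<open>cylinder\<close>, but
  growing with the power d by scaling. As d \<ge> 2 and the mass is finite, comparing half-lengths 1
  and 2 forces it to vanish.\<close>

lemma axis_null: "emeasure M {z. hyperplane_proj a z = 0} = 0"
proof -
  define c where "c = (\<integral>\<^sup>+y. slab_weight a y * indicator {y. hyperplane_proj a y = 0} y \<partial>M)"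
  define m where "m R = (\<integral>\<^sup>+z. indicator {z. hyperplane_proj a z = 0} z * indicator {z. \<bar>z \<bullet> a\<bar> \<le> R} z \<partial>M)" for R :: real
  have ua: "(hyperplane_proj a y + u *\<^sub>R a) \<bullet> a = u" for y and u :: real
    using unit by (simp add: inner_add_left hyperplane_proj_inner dot_square_norm)
  have pa: "hyperplane_proj a (hyperplane_proj a y + u *\<^sub>R a) = hyperplane_proj a y" for y and u :: real
    using unit by (simp add: hyperplane_proj_add hyperplane_proj_along hyperplane_proj_idem)
  have m: "m R = ennreal (2 * R) * c" if "R \<ge> 0" for R
  proof -
    have "m R = (\<integral>\<^sup>+y. slab_weight a y * (\<integral>\<^sup>+u. indicator {y. hyperplane_proj a y = 0} y * indicator {-R..R} u \<partial>lborel) \<partial>M)"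
      unfolding m_def by (subst cylinder) (auto simp: ua pa indicator_def abs_le_iff minus_le_iff[of R] conj_commute intro!: nn_integral_cong)
    also have "\<dots> = (\<integral>\<^sup>+y. ennreal (2 * R) * (slab_weight a y * indicator {y. hyperplane_proj a y = 0} y) \<partial>M)"
    proof (rule nn_integral_cong)
      fix y
      have "(\<integral>\<^sup>+u. indicator {y. hyperplane_proj a y = 0} y * indicator {-R..R} u \<partial>lborel)
          = indicator {y. hyperplane_proj a y = 0} y * ennreal (2 * R)"
        using that by (subst nn_integral_cmult) auto
      then show "slab_weight a y * (\<integral>\<^sup>+u. indicator {y. hyperplane_proj a y = 0} y * indicator {-R..R} u \<partial>lborel)
        = ennreal (2 * R) * (slab_weight a y * indicator {y. hyperplane_proj a y = 0} y)"
        by (simp only: mult_ac)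
    qed
    finally show ?thesis by (simp add: nn_integral_cmult c_def)
  qed
  have "m 1 \<le> emeasure M (cball 0 1)"
  proof -
    have "norm z \<le> 1" if "hyperplane_proj a z = 0" "\<bar>z \<bullet> a\<bar> \<le> 1" for z
    proof -
      have "z = (z \<bullet> a) *\<^sub>R a" using that(1) by (simp add: hyperplane_proj_def)
      then have "norm z = \<bar>z \<bullet> a\<bar> * norm a" by (metis norm_scaleR)
      then show ?thesis using that unit by simp
    qed
    then have "m 1 \<le> (\<integral>\<^sup>+z. indicator (cball 0 1) z \<partial>M)"
      unfolding m_def by (intro nn_integral_mono) (auto simp: indicator_def)
    then show ?thesis by (simp add: sets_M)
  qed
  then have fin: "m 1 < \<infinity>" using finite_ball by (simp add: order_le_less_trans)
  have "m 2 = ennreal (2 ^ d) * m 1"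
    unfolding m_def
    by (subst scaling[where t = 2]) (auto simp: hyperplane_proj_scaleR indicator_def intro!: arg_cong2[where f = "(*)"] nn_integral_cong)
  moreover have "m 2 = 2 * m 1"
    using m[of 1] m[of 2] by (simp add: mult.assoc flip: ennreal_mult ennreal_numeral)
      (simp flip: mult.assoc ennreal_mult)
  ultimately have "ennreal (2 ^ d) * m 1 = ennreal 2 * m 1" by simp
  then have "m 1 = 0"
  proof -
    obtain r where r: "m 1 = ennreal r" "r \<ge> 0" using fin by (cases "m 1") auto
    have "(2::real) ^ 2 \<le> 2 ^ d" using degree_ge_2 by (intro power_increasing) auto
    moreover have "2 ^ d * r = 2 * r"
      using \<open>ennreal (2 ^ d) * m 1 = ennreal 2 * m 1\<close> r by (simp flip: ennreal_mult ennreal_numeral)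
    ultimately have "r = 0" by auto
    then show ?thesis using r by simp
  qed
  then have c0: "c = 0" using m[of 1] by simp
  \<comment> \<open>The whole axis is infinitely long; infinity times 0 is 0 in
    \<open>ennreal\<close>.\<close>
  have "emeasure M {z. hyperplane_proj a z = 0} = (\<integral>\<^sup>+z. indicator {z. hyperplane_proj a z = 0} z \<partial>M)"
    by (subst nn_integral_indicator) (auto simp: sets_M)
  also have "\<dots> = (\<integral>\<^sup>+y. slab_weight a y * (\<integral>\<^sup>+u. indicator {y. hyperplane_proj a y = 0} y \<partial>(lborel::real measure)) \<partial>M)"
    by (subst cylinder) (auto simp: pa indicator_def intro!: nn_integral_cong)
  also have "\<dots> = (\<integral>\<^sup>+y. \<infinity> * (slab_weight a y * indicator {y. hyperplane_proj a y = 0} y) \<partial>M)"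
    by (intro nn_integral_cong) (auto simp: mult_ac)
  also have "\<dots> = \<infinity> * c" unfolding c_def by (rule nn_integral_cmult) measurable
  finally show ?thesis using c0 by simp
qed

text \<open>Changing the gauge from the norm to the norm of the projection replaces the ball by a
  cylinder, to which \<open>cylinder\<close> applies. On the line over a base point at distance r
  from the axis, u = r x makes the direction depend only on x and on the direction of the base
  point, and all powers of r cancel.\<close>

lemma cone_integral_slice:
  assumes [measurable]: "G \<in> borel_measurable borel"
  shows "cone_integral d M G = (\<integral>\<^sup>+x. gnomonic_weight d x *
    cone_integral (d - 1) (slab_section a M) (\<lambda>\<eta>. G ((\<eta> + x *\<^sub>R a) /\<^sub>R sqrt (1 + x\<^sup>2))) \<partial>lborel)"
proof -
  let ?P = "hyperplane_proj a"
  let ?S = "\<lambda>y. slab_weight a y :: ennreal"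
  let ?T = "\<lambda>x y. gnomonic_weight d x * (G ((?P y /\<^sub>R norm (?P y) + x *\<^sub>R a) /\<^sub>R sqrt (1 + x\<^sup>2)) * indicator (cball 0 1 - {0}) (?P y))"
  \<comment> \<open>The axis, where the second gauge vanishes, is cut out of the integrand; it is a
    null set by \<open>axis_null\<close>.\<close>
  define \<phi> where "\<phi> z = G (z /\<^sub>R norm z) * indicator {z. ?P z \<noteq> 0} z" for z
  have [measurable]: "\<phi> \<in> borel_measurable borel" unfolding \<phi>_def by measurable
  have P0: "?P 0 = 0" by (simp add: hyperplane_proj_def)
  have [measurable]: "cball (0::'a) 1 \<in> sets borel" "{0::'a} \<in> sets borel" by auto
  have hom: "\<phi> (t *\<^sub>R z) = \<phi> z" if "t > 0" for t z
  proof -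
    have "(t *\<^sub>R z) /\<^sub>R norm (t *\<^sub>R z) = z /\<^sub>R norm z" using that by simp
    then show ?thesis using that unfolding \<phi>_def by (simp only: ) (simp add: hyperplane_proj_scaleR indicator_def)
  qed
  have "cone_integral d M G = of_nat d * (\<integral>\<^sup>+z. \<phi> z * indicator {z. norm z \<le> 1} z \<partial>M)"
    unfolding cone_integral_def
  proof (intro arg_cong2[where f = "(*)"] refl nn_integral_cong_AE)
    have "AE z in M. ?P z \<noteq> 0"
      using axis_null by (intro AE_I[where N = "{z. ?P z = 0}"]) (auto simp: sets_M)
    then show "AE z in M. G (z /\<^sub>R norm z) * indicator (cball 0 1 - {0}) z = \<phi> z * indicator {z. norm z \<le> 1} z"
      by eventually_elim (auto simp: \<phi>_def indicator_def P0)
  qed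
  also have "\<dots> = of_nat (d - 1) * (\<integral>\<^sup>+z. \<phi> z * ennreal (norm (?P z) ^ (d - 1) / norm z ^ d)
      * indicator {z. norm (?P z) \<le> 1} z \<partial>M)"
    by (rule gauge_change[OF _ _ _ hom]) (use degree_ge_2 in \<open>auto simp: \<phi>_def hyperplane_proj_scaleR P0 indicator_def split: if_splits\<close>)
  also have "(\<integral>\<^sup>+z. \<phi> z * ennreal (norm (?P z) ^ (d - 1) / norm z ^ d) * indicator {z. norm (?P z) \<le> 1} z \<partial>M)
     = (\<integral>\<^sup>+y. (\<integral>\<^sup>+x. ?S y * ?T x y \<partial>lborel) \<partial>M)"
  proof (subst cylinder, (measurable; fail), rule nn_integral_cong)
    fix y
    let ?z = "?P y"
    have pa: "?P (?z + u *\<^sub>R a) = ?z" for u :: real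
      using unit by (simp add: hyperplane_proj_add hyperplane_proj_along hyperplane_proj_idem)
    let ?F = "\<lambda>u. \<phi> (?z + u *\<^sub>R a) * ennreal (norm (?P (?z + u *\<^sub>R a)) ^ (d - 1) / norm (?z + u *\<^sub>R a) ^ d)
          * indicator {z. norm (?P z) \<le> 1} (?z + u *\<^sub>R a)"
    let ?H = "\<lambda>x. gnomonic_weight d x * (G ((?z /\<^sub>R norm ?z + x *\<^sub>R a) /\<^sub>R sqrt (1 + x\<^sup>2)) * indicator (cball 0 1 - {0}) ?z)"
    have "(\<integral>\<^sup>+u. ?F u \<partial>lborel) = (\<integral>\<^sup>+x. ?H x \<partial>lborel)"
    proof (cases "?z = 0")
      case True
      then show ?thesis using pa by (simp add: \<phi>_def)
    next
      case False
      \<comment> \<open>In the substitution u = \<open>?r\<close> x, the gnomonic coordinate x is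
        the tangent of the latitude above the hyperplane.\<close>
      let ?r = "norm ?z"
      have r: "?r > 0" using False by simp
      have "(\<integral>\<^sup>+u. ?F u \<partial>lborel) = ennreal ?r * (\<integral>\<^sup>+x. ?F (0 + ?r * x) \<partial>lborel)"
        using r by (subst nn_integral_real_affine[where c = ?r and t = 0]) auto
      also have "\<dots> = (\<integral>\<^sup>+x. ennreal ?r * ?F (?r * x) \<partial>lborel)"
        by (simp add: nn_integral_cmult)
      also have "\<dots> = (\<integral>\<^sup>+x. ?H x \<partial>lborel)"
      proof (rule nn_integral_cong)
        fix x :: real
        let ?s = "sqrt (1 + x\<^sup>2)"
        have s: "?s > 0" by (simp add: add_pos_nonneg)
        have n: "norm (?z + (?r * x) *\<^sub>R a) = ?r * ?s"
        proof -
          have "(norm (?z + (?r * x) *\<^sub>R a))\<^sup>2 = ?r\<^sup>2 + (?r * x)\<^sup>2"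
            using unit hyperplane_proj_inner[OF unit, of y]
            by (subst norm_add_Pythagorean) (auto simp: orthogonal_def power_mult_distrib)
          also have "\<dots> = (?r * ?s)\<^sup>2" by (simp add: power_mult_distrib algebra_simps)
          finally show ?thesis using r s by (simp add: power2_eq_iff_nonneg)
        qed
        have e: "(?z + (?r * x) *\<^sub>R a) /\<^sub>R (?r * ?s) = (?z /\<^sub>R ?r + x *\<^sub>R a) /\<^sub>R ?s"
          using r s by (simp add: algebra_simps)
        have "?r * (?r ^ (d - 1) / (?r * ?s) ^ d) = 1 / ?s ^ d"
          using r degree_pos by (cases d) (auto simp: power_mult_distrib field_simps)
        then have w: "ennreal ?r * ennreal (?r ^ (d - 1) / (?r * ?s) ^ d) = ennreal (1 / ?s ^ d)"
          using r s by (simp flip: ennreal_mult)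
        have F: "?F (?r * x) = G ((?z /\<^sub>R ?r + x *\<^sub>R a) /\<^sub>R ?s) * ennreal (?r ^ (d - 1) / (?r * ?s) ^ d)
            * indicator (cball 0 1 - {0}) ?z"
          using False unfolding \<phi>_def n e pa by (auto simp: indicator_def pa)
        have regroup: "r' * (g * c * i) = (r' * c) * (g * i)" for r' g c i :: ennreal
          by (simp only: mult_ac)
        show "ennreal ?r * ?F (?r * x) = ?H x"
          unfolding F regroup w ..
      qed
      finally show ?thesis .
    qed
    then show "?S y * (\<integral>\<^sup>+u. ?F u \<partial>lborel) = (\<integral>\<^sup>+x. ?S y * ?H x \<partial>lborel)"
      by (simp add: nn_integral_cmult)
  qed
  also have "\<dots> = (\<integral>\<^sup>+x. (\<integral>\<^sup>+y. ?S y * ?T x y \<partial>M) \<partial>lborel)"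
    by (rule pair.Fubini') measurable
  also have "of_nat (d - 1) * \<dots> = (\<integral>\<^sup>+x. of_nat (d - 1) * (\<integral>\<^sup>+y. ?S y * ?T x y \<partial>M) \<partial>lborel)"
    by (rule nn_integral_cmult[symmetric]) measurable
  also have "\<dots> = (\<integral>\<^sup>+x. gnomonic_weight d x *
    cone_integral (d - 1) (slab_section a M) (\<lambda>\<eta>. G ((\<eta> + x *\<^sub>R a) /\<^sub>R sqrt (1 + x\<^sup>2))) \<partial>lborel)"
    unfolding cone_integral_def
    by (intro nn_integral_cong, subst nn_integral_slab_section)
      (auto simp: sets_M nn_integral_cmult[symmetric] mult_ac intro!: nn_integral_cong)
  finally show ?thesis .
qed

end

section \<open>Zonal integrals\<close>

context line_invariant_measure
begin

text \<open>The integral over a slab of half-width t is computed twice: by \<open>cylinder\<close>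
  it is 2 t times the section, by scaling it is t^d times an integral over the slab of half-width 1.
  Dividing by 2 t lowers the degree by one.\<close>

lemma homogeneous_slab_section: "homogeneous_measure (slab_section a M) (d - 1)"
proof
  show "sets (slab_section a M) = sets borel" by (rule sets_slab_section)
  show "d - 1 \<ge> 1" using degree_ge_2 by simp
next
  fix f :: "'a \<Rightarrow> ennreal" and t :: real
  assume f [measurable]: "f \<in> borel_measurable borel" and t: "t > 0"
  let ?P = "hyperplane_proj a"
  let ?S = "\<lambda>y. slab_weight a y :: ennreal"
  let ?H = "\<lambda>y. f (?P y) * indicator {y. \<bar>y \<bullet> a\<bar> \<le> t} y"
  have ua: "(?P y + u *\<^sub>R a) \<bullet> a = u" for y and u :: real
    using unit by (simp add: inner_add_left hyperplane_proj_inner dot_square_norm)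
  have pa: "?P (?P y + u *\<^sub>R a) = ?P y" for y and u :: real
    using unit by (simp add: hyperplane_proj_add hyperplane_proj_along hyperplane_proj_idem)
  have "(\<integral>\<^sup>+y. ?H y \<partial>M) = (\<integral>\<^sup>+y. ?S y * (\<integral>\<^sup>+u. f (?P y) * indicator {-t..t} u \<partial>lborel) \<partial>M)"
    by (subst cylinder, measurable, intro nn_integral_cong arg_cong2[where f = "(*)"] refl)
      (auto simp: ua pa indicator_def)
  also have "\<dots> = (\<integral>\<^sup>+y. ennreal (2 * t) * (?S y * f (?P y)) \<partial>M)"
    using t by (intro nn_integral_cong) (simp add: nn_integral_cmult mult_ac)
  also have "\<dots> = ennreal (2 * t) * (\<integral>\<^sup>+z. f z \<partial>slab_section a M)"
    by (simp add: nn_integral_cmult nn_integral_slab_section[OF sets_M])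
  finally have 1: "(\<integral>\<^sup>+y. ?H y \<partial>M) = ennreal (2 * t) * (\<integral>\<^sup>+z. f z \<partial>slab_section a M)" .
  have "(\<integral>\<^sup>+y. ?H y \<partial>M) = ennreal (t ^ d) * (\<integral>\<^sup>+y. ?H (t *\<^sub>R y) \<partial>M)"
    using t by (intro scaling) auto
  also have "(\<integral>\<^sup>+y. ?H (t *\<^sub>R y) \<partial>M) = (\<integral>\<^sup>+y. 2 * (?S y * f (t *\<^sub>R ?P y)) \<partial>M)"
  proof (rule nn_integral_cong)
    fix y
    have "\<bar>(t *\<^sub>R y) \<bullet> a\<bar> \<le> t \<longleftrightarrow> \<bar>y \<bullet> a\<bar> \<le> 1" using t by (simp add: abs_mult)
    moreover have "2 * (1 / 2 * x) = x" for x :: ennreal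
      by (simp flip: mult.assoc add: ennreal_times_divide)
    ultimately show "?H (t *\<^sub>R y) = 2 * (?S y * f (t *\<^sub>R ?P y))"
      by (simp add: hyperplane_proj_scaleR indicator_def del: abs_scaleR)
  qed
  also have "\<dots> = 2 * (\<integral>\<^sup>+z. f (t *\<^sub>R z) \<partial>slab_section a M)"
    by (simp add: nn_integral_cmult nn_integral_slab_section[OF sets_M])
  finally have "ennreal (2 * t) * (\<integral>\<^sup>+z. f z \<partial>slab_section a M)
      = ennreal (t ^ d) * (2 * (\<integral>\<^sup>+z. f (t *\<^sub>R z) \<partial>slab_section a M))"
    using 1 by simp
  also have "\<dots> = ennreal (2 * t) * (ennreal (t ^ (d - 1)) * (\<integral>\<^sup>+z. f (t *\<^sub>R z) \<partial>slab_section a M))"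
  proof -
    have "t ^ d = t * t ^ (d - 1)" using degree_pos by (cases d) auto
    then show ?thesis using t by (simp add: ennreal_mult mult_ac)
  qed
  finally show "(\<integral>\<^sup>+z. f z \<partial>slab_section a M) = ennreal (t ^ (d - 1)) * (\<integral>\<^sup>+z. f (t *\<^sub>R z) \<partial>slab_section a M)"
    using t by (subst (asm) ennreal_mult_cancel_left) auto
next
  have "emeasure (slab_section a M) (cball 0 1) = (\<integral>\<^sup>+z. indicator (cball 0 1) z \<partial>slab_section a M)"
    by (simp add: sets_slab_section)
  also have "\<dots> = (\<integral>\<^sup>+y. slab_weight a y * indicator (cball 0 1) (hyperplane_proj a y) \<partial>M)"
    by (subst nn_integral_slab_section[OF sets_M]) (auto intro!: borel_measurable_indicator)
  also have "\<dots> \<le> (\<integral>\<^sup>+y. indicator (cball 0 2) y \<partial>M)"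
  proof (rule nn_integral_mono)
    fix y
    have "norm y \<le> 2" if "\<bar>y \<bullet> a\<bar> \<le> 1" "norm (hyperplane_proj a y) \<le> 1"
    proof -
      have "norm y \<le> norm (hyperplane_proj a y) + norm ((y \<bullet> a) *\<^sub>R a)"
        by (metis diff_add_cancel hyperplane_proj_def norm_triangle_ineq)
      then show ?thesis using that unit by simp
    qed
    moreover have "1 / 2 \<le> (1::ennreal)"
      by (metis divide_le_posI_ennreal mult.right_neutral one_le_numeral zero_less_numeral)
    ultimately show "slab_weight a y * indicator (cball 0 1) (hyperplane_proj a y)
       \<le> (indicator (cball 0 2) y :: ennreal)"
      by (auto simp: indicator_def)
  qed
  also have "\<dots> < \<infinity>"
    using emeasure_scaled_cball[of 2] finite_ball by (simp add: sets_M ennreal_mult_less_top)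
  finally show "emeasure (slab_section a M) (cball 0 1) < \<infinity>" .
qed

text \<open>Since b is orthogonal to a, moving by b commutes with the projection along a and leaves
  the slab weight unchanged.\<close>

lemma line_invariant_slab_section:
  assumes b: "line_invariant_measure M d b" and ab: "a \<bullet> b = 0" and d: "d \<ge> 3"
  shows "line_invariant_measure (slab_section a M) (d - 1) b"
proof -
  interpret B: line_invariant_measure M d b by (rule b)
  interpret S: homogeneous_measure "slab_section a M" "d - 1" by (rule homogeneous_slab_section)
  show ?thesis
  proof
    show "norm b = 1" by (rule B.unit)
    show "d - 1 \<ge> 2" using d by simp
    fix f :: "'a \<Rightarrow> ennreal" and t :: real
    assume [measurable]: "f \<in> borel_measurable borel"
    have pb: "hyperplane_proj a (y + t *\<^sub>R b) = hyperplane_proj a y + t *\<^sub>R b" for y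
      using ab by (simp add: hyperplane_proj_def inner_add_left inner_commute[of b])
    have "(\<integral>\<^sup>+z. f (z + t *\<^sub>R b) \<partial>slab_section a M)
        = (\<integral>\<^sup>+y. slab_weight a (y + t *\<^sub>R b) * f (hyperplane_proj a (y + t *\<^sub>R b)) \<partial>M)"
      using ab by (subst nn_integral_slab_section[OF sets_M])
        (auto simp: pb inner_add_left inner_commute[of b] indicator_def)
    also have "\<dots> = (\<integral>\<^sup>+z. f z \<partial>slab_section a M)"
      by (subst B.translate) (auto simp: nn_integral_slab_section[OF sets_M])
    finally show "(\<integral>\<^sup>+z. f (z + t *\<^sub>R b) \<partial>slab_section a M) = (\<integral>\<^sup>+z. f z \<partial>slab_section a M)" .
  qed
qed

end

section \<open>Lebesgue measure and the masses of great subspheres\<close>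

lemma nn_integral_lborel_scaleR:
  fixes f :: "'a::euclidean_space \<Rightarrow> ennreal"
  assumes [measurable]: "f \<in> borel_measurable borel" and "t > 0"
  shows "(\<integral>\<^sup>+z. f z \<partial>lborel) = ennreal (t ^ DIM('a)) * (\<integral>\<^sup>+z. f (t *\<^sub>R z) \<partial>lborel)"
  using assms(2) by (subst lborel_affine[of t 0])
    (auto simp: nn_integral_density nn_integral_distr nn_integral_cmult)

lemma homogeneous_lborel: "homogeneous_measure (lborel :: 'a::euclidean_space measure) DIM('a)"
proof
  show "emeasure lborel (cball (0::'a) 1) < \<infinity>" using emeasure_lborel_cball_finite by simp
qed (auto intro: nn_integral_lborel_scaleR simp: Suc_le_eq)

lemma line_invariant_lborel:
  assumes "norm (a::'a::euclidean_space) = 1" "DIM('a) \<ge> 2"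
  shows "line_invariant_measure lborel DIM('a) a"
proof -
  interpret homogeneous_measure "lborel :: 'a measure" "DIM('a)" by (rule homogeneous_lborel)
  show ?thesis
  proof
    fix f :: "'a \<Rightarrow> ennreal" and t
    assume [measurable]: "f \<in> borel_measurable borel"
    have "(\<integral>\<^sup>+z. f z \<partial>lborel) = (\<integral>\<^sup>+z. f z \<partial>distr lborel borel ((+) (t *\<^sub>R a)))"
      by (simp add: lborel_distr_plus)
    also have "\<dots> = (\<integral>\<^sup>+z. f (t *\<^sub>R a + z) \<partial>lborel)" by (subst nn_integral_distr) auto
    finally show "(\<integral>\<^sup>+z. f (z + t *\<^sub>R a) \<partial>lborel) = (\<integral>\<^sup>+z. f z \<partial>lborel)" by (simp add: add.commute)
  qed (use assms in auto)
qed

definition gnomonic_mass :: "nat \<Rightarrow> ennreal" where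
  "gnomonic_mass d = (\<integral>\<^sup>+x. gnomonic_weight d x \<partial>lborel)"

lemma (in line_invariant_measure) cone_integral_one:
  "cone_integral d M (\<lambda>_. 1) = gnomonic_mass d * cone_integral (d - 1) (slab_section a M) (\<lambda>_. 1)"
  by (subst cone_integral_slice) (auto simp: gnomonic_mass_def nn_integral_multc)

text \<open>Slicing a constant writes a finite positive surface area as a product of two masses. As
  0 times infinity is 0, both masses are then finite and positive, without being computed.\<close>

lemma ennreal_mult_finite_nonzeroD:
  fixes a b :: ennreal
  assumes "a * b \<noteq> 0" "a * b \<noteq> \<infinity>"
  shows "a \<noteq> 0" "a \<noteq> \<infinity>" "b \<noteq> 0" "b \<noteq> \<infinity>"
  using assms by (auto simp: ennreal_mult_eq_top_iff)

lemma cone_integral_lborel_one: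
  "cone_integral DIM('a) (lborel :: 'a::euclidean_space measure) (\<lambda>_. 1) \<noteq> 0"
  "cone_integral DIM('a) (lborel :: 'a::euclidean_space measure) (\<lambda>_. 1) \<noteq> \<infinity>"
proof -
  have "emeasure lborel (cball (0::'a) 1 - {0}) = emeasure lborel (cball (0::'a) 1)"
    by (intro emeasure_Diff_null_set) auto
  then have "cone_integral DIM('a) (lborel :: 'a measure) (\<lambda>_. 1) = of_nat DIM('a) * ennreal (unit_ball_vol DIM('a))"
    by (simp add: cone_integral_def emeasure_cball)
  then show "cone_integral DIM('a) (lborel :: 'a measure) (\<lambda>_. 1) \<noteq> 0"
    "cone_integral DIM('a) (lborel :: 'a measure) (\<lambda>_. 1) \<noteq> \<infinity>"
    using unit_ball_vol_pos[of "DIM('a)"] by (auto simp: ennreal_mult_eq_top_iff simp del: unit_ball_vol_pos)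
qed

text \<open>Comparing the slicing formula for different \<open>\<xi>\<close> shows that the mass of the great
  subspheres does not depend on \<open>\<xi>\<close>; no rotation is needed.\<close>

definition subsphere_mass :: "'a::euclidean_space itself \<Rightarrow> ennreal" where
  "subsphere_mass _ = cone_integral DIM('a) (lborel :: 'a measure) (\<lambda>_. 1) / gnomonic_mass DIM('a)"

lemma
  assumes "norm (\<xi>::'a::euclidean_space) = 1" "DIM('a) \<ge> 2"
  shows cone_integral_hyperplane_one:
      "cone_integral (DIM('a) - 1) (slab_section \<xi> lborel) (\<lambda>_. 1) = subsphere_mass TYPE('a)"
    and subsphere_mass_nonzero: "subsphere_mass TYPE('a) \<noteq> 0"
    and subsphere_mass_finite: "subsphere_mass TYPE('a) \<noteq> \<infinity>"
proof -
  interpret line_invariant_measure lborel "DIM('a)" \<xi> using assms by (rule line_invariant_lborel)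
  note nz = ennreal_mult_finite_nonzeroD[OF cone_integral_lborel_one[where 'a = 'a, unfolded cone_integral_one]]
  show *: "cone_integral (DIM('a) - 1) (slab_section \<xi> lborel) (\<lambda>_. 1) = subsphere_mass TYPE('a)"
    using nz unfolding subsphere_mass_def cone_integral_one
    by (simp add: mult.commute[of "gnomonic_mass _"] ennreal_mult_divide_eq)
  show "subsphere_mass TYPE('a) \<noteq> 0" "subsphere_mass TYPE('a) \<noteq> \<infinity>"
    using nz unfolding *[symmetric] by auto
qed

lemma cone_integral_slab_section:
  assumes "sets M = sets borel" and [measurable]: "f \<in> borel_measurable borel"
  shows "cone_integral d (slab_section a M) f = of_nat d *
    (\<integral>\<^sup>+y. slab_weight a y * (f (hyperplane_proj a y /\<^sub>R norm (hyperplane_proj a y)) *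
      indicator (cball 0 1 - {0}) (hyperplane_proj a y)) \<partial>M)"
proof -
  have [measurable]: "cball (0::'a) 1 \<in> sets borel" "{0::'a} \<in> sets borel" by auto
  show ?thesis unfolding cone_integral_def by (subst nn_integral_slab_section) (use assms in auto)
qed

text \<open>A zonal integrand becomes constant only on the slice, not on the ambient space. Hence
  agreement is asked only at normalised projections.\<close>

lemma cone_integral_slab_section_cong:
  assumes "sets M = sets borel" "f \<in> borel_measurable borel" "g \<in> borel_measurable borel"
    and "\<And>y. f (hyperplane_proj a y /\<^sub>R norm (hyperplane_proj a y)) = g (hyperplane_proj a y /\<^sub>R norm (hyperplane_proj a y))"
  shows "cone_integral d (slab_section a M) f = cone_integral d (slab_section a M) g"
  unfolding cone_integral_slab_section[OF assms(1,2)] cone_integral_slab_section[OF assms(1,3)] assms(4) ..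

lemma cone_integral_slab_section_twice_cong:
  assumes M: "sets M = sets borel" and [measurable]: "f \<in> borel_measurable borel" "g \<in> borel_measurable borel"
    and eq: "\<And>y. let z = hyperplane_proj a (hyperplane_proj b y) in f (z /\<^sub>R norm z) = g (z /\<^sub>R norm z)"
  shows "cone_integral d (slab_section a (slab_section b M)) f = cone_integral d (slab_section a (slab_section b M)) g"
proof -
  have [measurable]: "cball (0::'a) 1 \<in> sets borel" "{0::'a} \<in> sets borel" by auto
  have *: "cone_integral d (slab_section a (slab_section b M)) h = of_nat d *
    (\<integral>\<^sup>+y. slab_weight b y * (slab_weight a (hyperplane_proj b y) *
      (h (hyperplane_proj a (hyperplane_proj b y) /\<^sub>R norm (hyperplane_proj a (hyperplane_proj b y))) *
      indicator (cball 0 1 - {0}) (hyperplane_proj a (hyperplane_proj b y)))) \<partial>M)"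
    if [measurable]: "h \<in> borel_measurable borel" for h
    unfolding cone_integral_slab_section[OF sets_slab_section that]
    by (subst nn_integral_slab_section[OF M]) measurable
  show ?thesis using eq unfolding Let_def by (simp only: * assms(2,3))
qed

lemma cone_integral_cmult:
  assumes [measurable_cong]: "sets M = sets borel"
  shows "cone_integral d M (\<lambda>_. c) = c * cone_integral d M (\<lambda>_. 1)"
proof -
  have [measurable]: "cball (0::'a) 1 \<in> sets borel" "{0::'a} \<in> sets borel" by auto
  show ?thesis unfolding cone_integral_def by (subst nn_integral_cmult) (auto simp: mult_ac)
qed

lemma cone_integral_zonal_lborel:
  assumes e: "norm (e::'a::euclidean_space) = 1" and n: "DIM('a) \<ge> 2"
    and [measurable]: "f \<in> borel_measurable borel"
  shows "cone_integral DIM('a) lborel (\<lambda>\<theta>. f (\<theta> \<bullet> e)) = subsphere_mass TYPE('a) *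
    (\<integral>\<^sup>+x. gnomonic_weight DIM('a) x * f (x / sqrt (1 + x\<^sup>2)) \<partial>lborel)"
proof -
  interpret line_invariant_measure lborel "DIM('a)" e using e n by (rule line_invariant_lborel)
  have "cone_integral (DIM('a) - 1) (slab_section e lborel) (\<lambda>\<eta>. f (((\<eta> + x *\<^sub>R e) /\<^sub>R sqrt (1 + x\<^sup>2)) \<bullet> e))
      = f (x / sqrt (1 + x\<^sup>2)) * subsphere_mass TYPE('a)" (is "?L = _") for x :: real
  proof -
    have ua: "((hyperplane_proj e y /\<^sub>R s + x *\<^sub>R e) /\<^sub>R sqrt (1 + x\<^sup>2)) \<bullet> e = x / sqrt (1 + x\<^sup>2)" for y s
      using e by (simp add: inner_add_left hyperplane_proj_inner dot_square_norm divide_inverse mult.commute)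
    have "?L = cone_integral (DIM('a) - 1) (slab_section e lborel) (\<lambda>_. f (x / sqrt (1 + x\<^sup>2)))"
      by (rule cone_integral_slab_section_cong) (auto simp only: ua sets_lborel, measurable)
    also have "\<dots> = f (x / sqrt (1 + x\<^sup>2)) * cone_integral (DIM('a) - 1) (slab_section e lborel) (\<lambda>_. 1)"
      by (rule cone_integral_cmult) (rule sets_slab_section)
    finally show ?thesis unfolding cone_integral_hyperplane_one[OF e n] .
  qed
  then show ?thesis
    by (subst cone_integral_slice) (auto simp: nn_integral_cmult[symmetric] mult_ac)
qed

text \<open>The subsphere orthogonal to \<xi> is sliced along the direction a of the projection of
  e. Apart from its multiple of a, a point of a slice is orthogonal to a and \<xi>, hence to e; its
  inner product with e is thus the length of the projection times x / sqrt (1 + x^2).\<close>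

lemma cone_integral_zonal_hyperplane:
  fixes \<xi> e :: "'a::euclidean_space"
  assumes \<xi>: "norm \<xi> = 1" and e: "norm e = 1" and n: "DIM('a) \<ge> 3"
    and [measurable]: "f \<in> borel_measurable borel"
  shows "cone_integral (DIM('a) - 1) (slab_section \<xi> lborel) (\<lambda>\<theta>. f (\<theta> \<bullet> e)) =
    subsphere_mass TYPE('a) / gnomonic_mass (DIM('a) - 1) *
    (\<integral>\<^sup>+x. gnomonic_weight (DIM('a) - 1) x * f (sqrt (1 - (\<xi> \<bullet> e)\<^sup>2) * (x / sqrt (1 + x\<^sup>2))) \<partial>lborel)"
proof -
  let ?r = "sqrt (1 - (\<xi> \<bullet> e)\<^sup>2)"
  obtain a where a: "norm a = 1" "a \<bullet> \<xi> = 0" "e = (e \<bullet> \<xi>) *\<^sub>R \<xi> + ?r *\<^sub>R a"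
  \<comment> \<open>If e = \<xi> or e = -\<xi>, the projection has no direction and
    \<open>?r\<close> is 0. Any unit vector orthogonal to \<xi> then serves as a.\<close>
  proof (cases "hyperplane_proj \<xi> e = 0")
    case True
    obtain b :: 'a where b: "b \<noteq> 0" "orthogonal \<xi> b" using n orthogonal_to_vector_exists[of \<xi>] by auto
    have e1: "e = (e \<bullet> \<xi>) *\<^sub>R \<xi>" using True by (simp add: hyperplane_proj_def)
    then have "norm e = \<bar>e \<bullet> \<xi>\<bar> * norm \<xi>" by (metis norm_scaleR)
    then have "\<bar>e \<bullet> \<xi>\<bar> = 1" using e \<xi> by simp
    then have "?r = 0" by (simp add: inner_commute abs_square_eq_1)
    then show ?thesis using that[of "b /\<^sub>R norm b"] b e1 by (simp add: orthogonal_def inner_commute)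
  next
    case False
    have "(norm (hyperplane_proj \<xi> e))\<^sup>2 = 1 - (\<xi> \<bullet> e)\<^sup>2"
    proof -
      have "hyperplane_proj \<xi> e \<bullet> hyperplane_proj \<xi> e = hyperplane_proj \<xi> e \<bullet> e"
        using hyperplane_proj_inner[OF \<xi>, of e]
        by (subst (2) hyperplane_proj_def) (simp add: inner_diff_right)
      then show ?thesis
        using e unfolding power2_norm_eq_inner
        by (simp add: hyperplane_proj_def inner_diff_left dot_square_norm power2_eq_square inner_commute[of e \<xi>])
    qed
    then have "?r = norm (hyperplane_proj \<xi> e)" by (metis norm_ge_zero real_sqrt_unique)
    then show ?thesis using False that[of "hyperplane_proj \<xi> e /\<^sub>R norm (hyperplane_proj \<xi> e)"] hyperplane_proj_inner[OF \<xi>, of e]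
      by (simp add: hyperplane_proj_def)
  qed
  have ae: "a \<bullet> e = ?r"
    using arg_cong[OF a(3), of "inner a"] a(1,2) by (simp add: inner_add_right dot_square_norm)
  interpret M: line_invariant_measure lborel "DIM('a)" \<xi> using \<xi> n by (intro line_invariant_lborel) auto
  interpret V: line_invariant_measure "slab_section \<xi> lborel" "DIM('a) - 1" a
    using a(1,2) n by (intro M.line_invariant_slab_section line_invariant_lborel) (auto simp: inner_commute)
  \<comment> \<open>The mass left after two slicings. Slicing the constant function shows that it
    depends neither on a nor on \<xi>.\<close>
  let ?c = "cone_integral (DIM('a) - 1 - 1) (slab_section a (slab_section \<xi> lborel)) (\<lambda>_. 1)"
  have "cone_integral (DIM('a) - 1) (slab_section \<xi> lborel) (\<lambda>_. 1) = gnomonic_mass (DIM('a) - 1) * ?c"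
    by (rule V.cone_integral_one)
  then have eq: "subsphere_mass TYPE('a) = gnomonic_mass (DIM('a) - 1) * ?c"
    using cone_integral_hyperplane_one[OF \<xi>] n by simp
  have nz: "gnomonic_mass (DIM('a) - 1) * ?c \<noteq> 0" "gnomonic_mass (DIM('a) - 1) * ?c \<noteq> \<infinity>"
    using subsphere_mass_nonzero[OF \<xi>] subsphere_mass_finite[OF \<xi>] n unfolding eq[symmetric] by auto
  have c: "?c = subsphere_mass TYPE('a) / gnomonic_mass (DIM('a) - 1)"
    using ennreal_mult_finite_nonzeroD[OF nz] unfolding eq
    by (simp add: mult.commute[of "gnomonic_mass _"] ennreal_mult_divide_eq)
  have "cone_integral (DIM('a) - 1 - 1) (slab_section a (slab_section \<xi> lborel)) (\<lambda>\<eta>. f (((\<eta> + x *\<^sub>R a) /\<^sub>R sqrt (1 + x\<^sup>2)) \<bullet> e))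
      = f (?r * (x / sqrt (1 + x\<^sup>2))) * ?c" (is "?L = _") for x :: real
  proof -
    let ?y = "\<lambda>y. hyperplane_proj a (hyperplane_proj \<xi> y)"
    have ye: "?y y \<bullet> e = 0" for y
    proof -
      have "?y y \<bullet> a = 0" using a(1) by (simp add: hyperplane_proj_inner)
      moreover have "?y y \<bullet> \<xi> = 0"
        using a(2) \<xi> by (simp add: hyperplane_proj_def[of a] inner_diff_left hyperplane_proj_inner)
      ultimately show ?thesis using arg_cong[OF a(3), of "inner (?y y)"] by (simp add: inner_add_right)
    qed
    have ua: "((?y y /\<^sub>R s + x *\<^sub>R a) /\<^sub>R sqrt (1 + x\<^sup>2)) \<bullet> e = ?r * (x / sqrt (1 + x\<^sup>2))" for y s
      by (simp add: inner_add_left ye ae divide_inverse mult_ac)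
    have "?L = cone_integral (DIM('a) - 1 - 1) (slab_section a (slab_section \<xi> lborel)) (\<lambda>_. f (?r * (x / sqrt (1 + x\<^sup>2))))"
      by (rule cone_integral_slab_section_twice_cong) (auto simp only: ua Let_def sets_lborel, measurable)
    also have "\<dots> = f (?r * (x / sqrt (1 + x\<^sup>2))) * ?c"
      by (rule cone_integral_cmult) (rule sets_slab_section)
    finally show ?thesis .
  qed
  then show ?thesis unfolding c
    by (subst V.cone_integral_slice) (auto simp: nn_integral_cmult[symmetric] mult_ac)
qed

section \<open>Self-adjointness of the Radon transform\<close>

text \<open>The measure behind \<open>cone_integral\<close>, living on the Borel sets of the ambient
  space and not on the sphere, as \<open>sphere_measure\<close> does. Borel functions are measurable
  for it as they stand; that its points lie on the sphere becomes an almost-everywhere fact.\<close>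

definition cone_measure :: "nat \<Rightarrow> 'a::euclidean_space measure \<Rightarrow> 'a measure" where
  "cone_measure d M = scale_measure (of_nat d)
     (distr (density M (indicator (cball 0 1 - {0}))) borel (\<lambda>z. z /\<^sub>R norm z))"

lemma sets_cone_measure [measurable_cong]: "sets (cone_measure d M) = sets borel"
  by (simp add: cone_measure_def)

lemma space_cone_measure [simp]: "space (cone_measure d M) = UNIV"
  by (simp add: cone_measure_def space_scale_measure)

lemma borel_punctured_ball [measurable]: "cball (0::'a::euclidean_space) 1 - {0} \<in> sets borel"
  by auto

lemma nn_integral_cone_measure:
  assumes [measurable_cong]: "sets M = sets borel" and [measurable]: "f \<in> borel_measurable borel"
  shows "(\<integral>\<^sup>+z. f z \<partial>cone_measure d M) = cone_integral d M f"
proof -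
  have [measurable]: "indicator (cball 0 1 - {0::'a}) \<in> borel_measurable M"
    by (intro borel_measurable_indicator) (auto simp: assms(1))
  show ?thesis
    unfolding cone_measure_def cone_integral_def
    by (subst nn_integral_scale_measure, measurable, subst nn_integral_distr, measurable,
        subst nn_integral_density, measurable) (simp add: mult.commute)
qed

lemma AE_cone_measure_norm:
  assumes [measurable_cong]: "sets M = sets borel"
  shows "AE z in cone_measure d M. norm z = 1"
proof -
  have "cone_integral d M (indicator {z. norm z \<noteq> 1}) = 0"
  proof -
    have "(\<lambda>z::'a. indicator {z. norm z \<noteq> 1} (z /\<^sub>R norm z) * indicator (cball 0 1 - {0}) z :: ennreal) = (\<lambda>_. 0)"
      by (auto simp: fun_eq_iff indicator_def)
    then show ?thesis by (simp only: cone_integral_def) simp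
  qed
  then have "emeasure (cone_measure d M) {z. norm z \<noteq> 1} = 0"
    using nn_integral_cone_measure[OF assms, of "indicator {z. norm z \<noteq> 1}" d]
    by (simp add: sets_cone_measure)
  then show ?thesis
    by (intro AE_I[where N = "{z. norm z \<noteq> 1}"]) (auto simp: sets_cone_measure)
qed

lemma AE_cone_measure_slab_section:
  assumes a: "norm a = 1" and [measurable_cong]: "sets M = sets borel"
  shows "AE z in cone_measure d (slab_section a M). norm z = 1 \<and> z \<bullet> a = 0"
proof -
  have "cone_integral d (slab_section a M) (indicator {z. z \<bullet> a \<noteq> 0}) = 0"
  proof -
    have "indicator {z. z \<bullet> a \<noteq> 0} (hyperplane_proj a y /\<^sub>R norm (hyperplane_proj a y)) = (0 :: ennreal)" for y
      using hyperplane_proj_inner[OF a] by (simp add: indicator_def)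
    then show ?thesis by (subst cone_integral_slab_section[OF assms(2)]) simp_all
  qed
  then have "emeasure (cone_measure d (slab_section a M)) {z. z \<bullet> a \<noteq> 0} = 0"
    using nn_integral_cone_measure[OF sets_slab_section, of "indicator {z. z \<bullet> a \<noteq> 0}" d a M]
    by (simp add: sets_cone_measure)
  then have "AE z in cone_measure d (slab_section a M). z \<bullet> a = 0"
    by (intro AE_I[where N = "{z. z \<bullet> a \<noteq> 0}"]) (auto simp: sets_cone_measure)
  with AE_cone_measure_norm[OF sets_slab_section] show ?thesis by (rule AE_conjI)
qed

abbreviation surface_measure :: "'a::euclidean_space measure" where
  "surface_measure \<equiv> cone_measure DIM('a) lborel"

definition subsphere_measure :: "'a::euclidean_space \<Rightarrow> 'a measure" where
  "subsphere_measure \<xi> = cone_measure (DIM('a) - 1) (slab_section \<xi> lborel)"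

lemma sets_subsphere_measure [measurable_cong]: "sets (subsphere_measure \<xi>) = sets borel"
  by (simp add: subsphere_measure_def sets_cone_measure)

lemma space_subsphere_measure [simp]: "space (subsphere_measure \<xi>) = UNIV"
  by (simp add: subsphere_measure_def)

lemma nn_integral_subsphere_measure:
  fixes \<xi> :: "'a::euclidean_space"
  assumes "f \<in> borel_measurable borel"
  shows "(\<integral>\<^sup>+z. f z \<partial>subsphere_measure \<xi>) = cone_integral (DIM('a) - 1) (slab_section \<xi> lborel) f"
  unfolding subsphere_measure_def by (rule nn_integral_cone_measure[OF sets_slab_section assms])

lemma AE_subsphere_measure:
  assumes "norm \<xi> = 1"
  shows "AE \<eta> in subsphere_measure \<xi>. norm \<eta> = 1 \<and> \<eta> \<bullet> \<xi> = 0"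
  unfolding subsphere_measure_def by (rule AE_cone_measure_slab_section) (use assms in auto)

lemma emeasure_surface_measure:
  "emeasure (surface_measure :: 'a::euclidean_space measure) UNIV = cone_integral DIM('a) lborel (\<lambda>_::'a. 1)"
  by (subst nn_integral_cone_measure[symmetric]) auto

lemma finite_surface_measure: "finite_measure (surface_measure :: 'a::euclidean_space measure)"
  by (rule finite_measureI) (use cone_integral_lborel_one(2)[where 'a = 'a] in \<open>simp add: emeasure_surface_measure\<close>)

lemma emeasure_subsphere_measure:
  assumes "norm (\<xi>::'a::euclidean_space) = 1" "DIM('a) \<ge> 2"
  shows "emeasure (subsphere_measure \<xi>) UNIV = subsphere_mass TYPE('a)"
  using nn_integral_subsphere_measure[of "\<lambda>_. 1" \<xi>] cone_integral_hyperplane_one[OF assms] by simp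

lemma finite_subsphere_measure:
  assumes "norm (\<xi>::'a::euclidean_space) = 1" "DIM('a) \<ge> 2"
  shows "finite_measure (subsphere_measure \<xi>)"
  by (rule finite_measureI)
    (use subsphere_mass_finite[OF assms] in \<open>simp add: emeasure_subsphere_measure[OF assms]\<close>)

text \<open>For a unit vector \<xi>, an integral over the small sphere parallel to the great
  subsphere orthogonal to \<xi>, at height x / sqrt (1 + x^2), but with the mass of the great one.
  Slicing the surface measure produces these transforms.\<close>

definition shifted_radon :: "real \<Rightarrow> ('a::euclidean_space \<Rightarrow> ennreal) \<Rightarrow> 'a \<Rightarrow> ennreal" where
  "shifted_radon x f \<xi> = (\<integral>\<^sup>+\<eta>. f ((\<eta> + x *\<^sub>R \<xi>) /\<^sub>R sqrt (1 + x\<^sup>2)) \<partial>subsphere_measure \<xi>)"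

definition radon :: "('a::euclidean_space \<Rightarrow> ennreal) \<Rightarrow> 'a \<Rightarrow> ennreal" where
  "radon f \<xi> = (\<integral>\<^sup>+\<eta>. f \<eta> \<partial>subsphere_measure \<xi>)"

lemma shifted_radon_0: "shifted_radon 0 f \<xi> = radon f \<xi>"
  by (simp add: shifted_radon_def radon_def)

text \<open>The measure of integration varies with \<xi>. Written as a Lebesgue integral over the
  ambient space, the transform carries that dependence in its integrand, where joint measurability
  is visible.\<close>

lemma measurable_shifted_radon [measurable (raw)]:
  fixes \<xi> :: "_ \<Rightarrow> 'a::euclidean_space"
  assumes [measurable]: "f \<in> borel_measurable borel" "x \<in> borel_measurable N" "\<xi> \<in> borel_measurable N"
  shows "(\<lambda>z. shifted_radon (x z) f (\<xi> z)) \<in> borel_measurable N"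
proof -
  have [measurable]: "cball (0::'a) 1 \<in> sets borel" "{0::'a} \<in> sets borel" by auto
  have "shifted_radon (x z) f (\<xi> z) = of_nat (DIM('a) - 1) *
    (\<integral>\<^sup>+y. indicator {w. \<bar>snd w \<bullet> fst w\<bar> \<le> 1} (\<xi> z, y) / 2 * (f ((hyperplane_proj (\<xi> z) y /\<^sub>R norm (hyperplane_proj (\<xi> z) y) + x z *\<^sub>R \<xi> z) /\<^sub>R sqrt (1 + (x z)\<^sup>2)) *
      indicator (cball 0 1 - {0}) (hyperplane_proj (\<xi> z) y)) \<partial>lborel)" for z
    unfolding shifted_radon_def
    by (subst nn_integral_subsphere_measure, measurable, subst cone_integral_slab_section)
      (auto simp: indicator_def)
  then show ?thesis by simp
qed

lemma measurable_radon [measurable (raw)]: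
  assumes "f \<in> borel_measurable borel" "\<xi> \<in> borel_measurable N"
  shows "(\<lambda>z. radon f (\<xi> z)) \<in> borel_measurable N"
  using measurable_shifted_radon[OF assms(1) _ assms(2), of "\<lambda>_. 0"] by (simp add: shifted_radon_0)

text \<open>K depends on the height only, so it is constant on each slice. The left side is
  symmetric in \<theta> and \<xi> apart from g, and this is what makes the formula useful for
  duality.\<close>

lemma surface_measure_slice:
  assumes \<xi>: "norm (\<xi>::'a::euclidean_space) = 1" and n: "DIM('a) \<ge> 2"
    and [measurable]: "g \<in> borel_measurable borel" "K \<in> borel_measurable borel"
  shows "(\<integral>\<^sup>+\<theta>. g \<theta> * K (\<theta> \<bullet> \<xi>) \<partial>surface_measure) =
    (\<integral>\<^sup>+x. gnomonic_weight DIM('a) x * K (x / sqrt (1 + x\<^sup>2)) * shifted_radon x g \<xi> \<partial>lborel)"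
proof -
  interpret line_invariant_measure lborel "DIM('a)" \<xi> using \<xi> n by (rule line_invariant_lborel)
  have "(\<integral>\<^sup>+\<eta>. g ((\<eta> + x *\<^sub>R \<xi>) /\<^sub>R sqrt (1 + x\<^sup>2)) * K (((\<eta> + x *\<^sub>R \<xi>) /\<^sub>R sqrt (1 + x\<^sup>2)) \<bullet> \<xi>) \<partial>subsphere_measure \<xi>)
      = shifted_radon x g \<xi> * K (x / sqrt (1 + x\<^sup>2))" for x :: real
  proof -
    have "(\<integral>\<^sup>+\<eta>. g ((\<eta> + x *\<^sub>R \<xi>) /\<^sub>R sqrt (1 + x\<^sup>2)) * K (((\<eta> + x *\<^sub>R \<xi>) /\<^sub>R sqrt (1 + x\<^sup>2)) \<bullet> \<xi>) \<partial>subsphere_measure \<xi>)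
      = (\<integral>\<^sup>+\<eta>. g ((\<eta> + x *\<^sub>R \<xi>) /\<^sub>R sqrt (1 + x\<^sup>2)) * K (x / sqrt (1 + x\<^sup>2)) \<partial>subsphere_measure \<xi>)"
    proof (rule nn_integral_cong_AE)
      show "AE \<eta> in subsphere_measure \<xi>. g ((\<eta> + x *\<^sub>R \<xi>) /\<^sub>R sqrt (1 + x\<^sup>2)) * K (((\<eta> + x *\<^sub>R \<xi>) /\<^sub>R sqrt (1 + x\<^sup>2)) \<bullet> \<xi>)
        = g ((\<eta> + x *\<^sub>R \<xi>) /\<^sub>R sqrt (1 + x\<^sup>2)) * K (x / sqrt (1 + x\<^sup>2))"
        using AE_subsphere_measure[OF \<xi>]
        by eventually_elim (use \<xi> in \<open>simp add: inner_add_left dot_square_norm divide_inverse mult.commute\<close>)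
    qed
    then show ?thesis by (simp add: nn_integral_multc shifted_radon_def)
  qed
  note eq = this
  have "(\<integral>\<^sup>+\<theta>. g \<theta> * K (\<theta> \<bullet> \<xi>) \<partial>surface_measure) = cone_integral DIM('a) lborel (\<lambda>\<theta>. g \<theta> * K (\<theta> \<bullet> \<xi>))"
    by (rule nn_integral_cone_measure) auto
  also have "\<dots> = (\<integral>\<^sup>+x. gnomonic_weight DIM('a) x *
      cone_integral (DIM('a) - 1) (slab_section \<xi> lborel) (\<lambda>\<eta>. g ((\<eta> + x *\<^sub>R \<xi>) /\<^sub>R sqrt (1 + x\<^sup>2)) *
        K (((\<eta> + x *\<^sub>R \<xi>) /\<^sub>R sqrt (1 + x\<^sup>2)) \<bullet> \<xi>)) \<partial>lborel)"
    by (rule cone_integral_slice) measurable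
  also have "\<dots> = (\<integral>\<^sup>+x. gnomonic_weight DIM('a) x * (shifted_radon x g \<xi> * K (x / sqrt (1 + x\<^sup>2))) \<partial>lborel)"
    unfolding eq[symmetric]
    by (subst nn_integral_subsphere_measure) auto
  finally show ?thesis by (simp only: mult_ac)
qed

lemma gnomonic_mass_bounds:
  assumes "DIM('a::euclidean_space) \<ge> 2"
  shows "gnomonic_mass DIM('a) \<noteq> 0" "gnomonic_mass DIM('a) \<noteq> \<infinity>"
proof -
  obtain \<xi> :: 'a where \<xi>: "norm \<xi> = 1" using norm_Basis nonempty_Basis by blast
  interpret line_invariant_measure lborel "DIM('a)" \<xi> using \<xi> assms by (rule line_invariant_lborel)
  show "gnomonic_mass DIM('a) \<noteq> 0" "gnomonic_mass DIM('a) \<noteq> \<infinity>"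
    using ennreal_mult_finite_nonzeroD[OF cone_integral_lborel_one[where 'a = 'a, unfolded cone_integral_one]] by auto
qed

lemma dist_unit_vectors:
  assumes "norm v = 1" "norm w = 1"
  shows "(dist v w)\<^sup>2 = 2 - 2 * (v \<bullet> w)"
  using assms by (simp add: dist_norm power2_norm_eq_inner inner_diff_left inner_diff_right inner_commute norm_eq_1)

lemma mult_le_mult_add:
  fixes a b c x :: ennreal
  assumes "a \<le> b + c"
  shows "x * a \<le> x * b + c * x"
  using mult_left_mono[OF assms, of x] by (simp add: distrib_left mult.commute)

text \<open>The product of b at \<xi> and g at \<theta> is integrated over the band where \<theta>
  \<bullet> \<xi> is small, a condition symmetric in the two vectors. Slicing around either vector
  gives an average of shifted transforms of the other function, close to its Radon transform by
  uniform continuity. One inequality is enough, as b and g may be exchanged.\<close>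

lemma radon_selfadjoint_le:
  fixes b g :: "'a::euclidean_space \<Rightarrow> real"
  assumes n: "DIM('a) \<ge> 2"
    and [measurable]: "b \<in> borel_measurable borel" "g \<in> borel_measurable borel"
    and b0: "\<And>x. b x \<ge> 0" and g0: "\<And>x. g x \<ge> 0"
    and bc: "continuous_on (sphere 0 1) b" and gc: "continuous_on (sphere 0 1) g"
  shows "(\<integral>\<^sup>+\<xi>. b \<xi> * radon g \<xi> \<partial>surface_measure) \<le> (\<integral>\<^sup>+\<xi>. g \<xi> * radon b \<xi> \<partial>surface_measure)"
proof -
  let ?\<sigma> = "surface_measure :: 'a measure"
  let ?m = "subsphere_mass TYPE('a)"
  interpret \<sigma>: finite_measure ?\<sigma> by (rule finite_surface_measure)
  interpret P: pair_sigma_finite ?\<sigma> ?\<sigma> ..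
  interpret L: pair_sigma_finite lborel ?\<sigma> ..
  have AE1: "AE \<xi> in ?\<sigma>. norm \<xi> = 1" by (rule AE_cone_measure_norm) simp
  have fin: "(\<integral>\<^sup>+\<xi>. f \<xi> \<partial>?\<sigma>) < \<infinity>" if f [measurable]: "f \<in> borel_measurable borel" and "continuous_on (sphere 0 1) f" "\<And>x. f x \<ge> 0" for f :: "'a \<Rightarrow> real"
  proof -
    have "bounded (f ` sphere 0 1)" using that by (intro compact_imp_bounded compact_continuous_image) auto
    then obtain C where "\<forall>y\<in>f ` sphere 0 1. norm y \<le> C" unfolding bounded_iff by blast
    then have C: "f x \<le> C" if "norm x = 1" for x using that by (metis abs_le_D1 image_eqI mem_sphere_0 real_norm_def)
    have "(\<integral>\<^sup>+\<xi>. f \<xi> \<partial>?\<sigma>) \<le> (\<integral>\<^sup>+\<xi>. ennreal C \<partial>?\<sigma>)"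
      by (rule nn_integral_mono_AE) (use AE1 in eventually_elim, use C in \<open>auto intro: ennreal_leI\<close>)
    also have "\<dots> < \<infinity>" using \<sigma>.emeasure_finite[of UNIV] by (simp add: ennreal_mult_eq_top_iff less_top[symmetric])
    finally show ?thesis .
  qed
  define C where "C = ?m * (\<integral>\<^sup>+\<xi>. b \<xi> \<partial>?\<sigma>) + ?m * (\<integral>\<^sup>+\<xi>. g \<xi> \<partial>?\<sigma>)"
  obtain \<xi>0 :: 'a where \<xi>0: "norm \<xi>0 = 1" using norm_Basis nonempty_Basis by blast
  have C: "C < \<infinity>"
    unfolding C_def using fin[of b] fin[of g] subsphere_mass_finite[OF \<xi>0 n] b0 g0 bc gc
    by (auto simp: ennreal_mult_eq_top_iff less_top[symmetric])
  have main: "(\<integral>\<^sup>+\<xi>. b \<xi> * radon g \<xi> \<partial>?\<sigma>) \<le> (\<integral>\<^sup>+\<xi>. g \<xi> * radon b \<xi> \<partial>?\<sigma>) + ennreal \<epsilon> * C" if \<epsilon>: "\<epsilon> > 0" for \<epsilon> :: real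
  proof -
    have "uniformly_continuous_on (sphere 0 1) g" "uniformly_continuous_on (sphere 0 1) b"
      using gc bc by (auto intro!: compact_uniformly_continuous)
    then obtain \<delta>1 \<delta>2 where \<delta>12: "\<delta>1 > 0" "\<delta>2 > 0"
      "\<And>x y. norm x = 1 \<Longrightarrow> norm y = 1 \<Longrightarrow> dist x y < \<delta>1 \<Longrightarrow> dist (g x) (g y) < \<epsilon>"
      "\<And>x y. norm x = 1 \<Longrightarrow> norm y = 1 \<Longrightarrow> dist x y < \<delta>2 \<Longrightarrow> dist (b x) (b y) < \<epsilon>"
      using \<epsilon> unfolding uniformly_continuous_on_def by (metis mem_sphere_0)
    define \<delta> where "\<delta> = min \<delta>1 \<delta>2"
    have \<delta>: "\<delta> > 0"
      "\<And>x y. norm x = 1 \<Longrightarrow> norm y = 1 \<Longrightarrow> dist x y < \<delta> \<Longrightarrow> g x \<le> g y + \<epsilon>"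
      "\<And>x y. norm x = 1 \<Longrightarrow> norm y = 1 \<Longrightarrow> dist x y < \<delta> \<Longrightarrow> b x \<le> b y + \<epsilon>"
      using \<delta>12 unfolding \<delta>_def by (force simp: dist_real_def)+
    \<comment> \<open>For t = x / sqrt (1 + x^2), the number 2 - 2 sqrt (1 - t^2) is the squared
      distance by which the shift moves a point of the great subsphere. The band consists of the
      heights that move it by less than \<delta>.\<close>
    define K :: "real \<Rightarrow> ennreal" where "K t = indicator {t. 2 - 2 * sqrt (1 - t\<^sup>2) < \<delta>\<^sup>2} t" for t
    have [measurable]: "K \<in> borel_measurable borel" unfolding K_def by measurable
    define w where "w x = gnomonic_weight DIM('a) x * K (x / sqrt (1 + x\<^sup>2))" for x
    have [measurable]: "w \<in> borel_measurable borel" unfolding w_def by measurable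
    have sq: "sqrt (1 - (x / sqrt (1 + x\<^sup>2))\<^sup>2) = 1 / sqrt (1 + x\<^sup>2)" for x :: real
    proof -
      have "1 + x\<^sup>2 > 0" by (simp add: add_pos_nonneg)
      then have "1 - (x / sqrt (1 + x\<^sup>2))\<^sup>2 = 1 / (1 + x\<^sup>2)" by (simp add: power_divide field_simps)
      then show ?thesis by (simp add: real_sqrt_divide)
    qed
    have near: "norm ((\<eta> + x *\<^sub>R \<xi>) /\<^sub>R sqrt (1 + x\<^sup>2)) = 1 \<and> dist ((\<eta> + x *\<^sub>R \<xi>) /\<^sub>R sqrt (1 + x\<^sup>2)) \<eta> < \<delta>"
      if x: "w x \<noteq> 0" and \<xi>: "norm \<xi> = 1" and \<eta>: "norm \<eta> = 1" "\<eta> \<bullet> \<xi> = 0" for x and \<xi> \<eta> :: 'a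
    proof -
      let ?s = "sqrt (1 + x\<^sup>2)"
      let ?v = "(\<eta> + x *\<^sub>R \<xi>) /\<^sub>R ?s"
      have s: "?s > 0" by (simp add: add_pos_nonneg)
      have "(norm (\<eta> + x *\<^sub>R \<xi>))\<^sup>2 = ?s\<^sup>2"
        using \<xi> \<eta> by (subst norm_add_Pythagorean) (auto simp: orthogonal_def)
      then have "norm (\<eta> + x *\<^sub>R \<xi>) = ?s" by (rule power2_eq_imp_eq) (use s in auto)
      then have v1: "norm ?v = 1" using s by simp
      have "?v \<bullet> \<eta> = 1 / ?s" using \<xi> \<eta> by (simp add: inner_add_left dot_square_norm inner_commute[of \<xi>] divide_inverse)
      then have "(dist ?v \<eta>)\<^sup>2 = 2 - 2 / ?s"
        using dist_unit_vectors[OF v1 \<eta>(1)] by simp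
      also have "\<dots> < \<delta>\<^sup>2" using x by (auto simp: w_def K_def sq indicator_def split: if_splits)
      finally show ?thesis using v1 \<delta>(1) by (simp add: power_less_imp_less_base)
    qed
    define W where "W = (\<integral>\<^sup>+x. w x \<partial>lborel)"
    have "W \<le> gnomonic_mass DIM('a)"
      unfolding W_def gnomonic_mass_def by (intro nn_integral_mono) (auto simp: w_def K_def indicator_def)
    then have W1: "W \<noteq> \<infinity>" using gnomonic_mass_bounds[OF n] by (auto simp: top_unique)
    \<comment> \<open>The band contains a neighbourhood of x = 0, so it has positive weight and W
      can be cancelled at the end.\<close>
    have W0: "W \<noteq> 0"
    proof
      assume "W = 0"
      then have "AE x in lborel. w x = 0" unfolding W_def by (subst (asm) nn_integral_0_iff_AE) auto
      moreover have "w x = 0 \<longleftrightarrow> x \<notin> {x. 2 - 2 * (1 / sqrt (1 + x\<^sup>2)) < \<delta>\<^sup>2}" for x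
      proof -
        have "1 + x\<^sup>2 > 0" by (simp add: add_pos_nonneg)
        then show ?thesis by (auto simp: w_def K_def indicator_def sq)
      qed
      ultimately have "AE x in lborel. x \<notin> {x::real. 2 - 2 * (1 / sqrt (1 + x\<^sup>2)) < \<delta>\<^sup>2}" by simp
      then have "{x::real. 2 - 2 * (1 / sqrt (1 + x\<^sup>2)) < \<delta>\<^sup>2} \<in> null_sets lborel"
        by (subst AE_iff_null_sets) auto
      then have "negligible {x::real. 2 - 2 * (1 / sqrt (1 + x\<^sup>2)) < \<delta>\<^sup>2}"
        by (simp add: negligible_iff_null_sets null_sets_completionI)
      moreover have "open {x::real. 2 - 2 * (1 / sqrt (1 + x\<^sup>2)) < \<delta>\<^sup>2}"
        by (intro open_Collect_less continuous_intros) (auto simp: add_nonneg_eq_0_iff)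
      moreover have "0 \<in> {x::real. 2 - 2 * (1 / sqrt (1 + x\<^sup>2)) < \<delta>\<^sup>2}" using \<delta>(1) by simp
      ultimately show False using open_not_negligible by blast
    qed
    \<comment> \<open>The band integral with f at the pole of the slicing. It is used once with b at
      the pole and once with g there; exchanging the two vectors connects the cases.\<close>
    have sym: "(\<integral>\<^sup>+x. w x * (\<integral>\<^sup>+\<xi>. f \<xi> * shifted_radon x h \<xi> \<partial>?\<sigma>) \<partial>lborel)
        = (\<integral>\<^sup>+\<xi>. (\<integral>\<^sup>+\<theta>. f \<xi> * (h \<theta> * K (\<theta> \<bullet> \<xi>)) \<partial>?\<sigma>) \<partial>?\<sigma>)"
      if [measurable]: "f \<in> borel_measurable borel" "h \<in> borel_measurable borel" for f h :: "'a \<Rightarrow> ennreal"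
    proof -
      have "(\<integral>\<^sup>+x. w x * (\<integral>\<^sup>+\<xi>. f \<xi> * shifted_radon x h \<xi> \<partial>?\<sigma>) \<partial>lborel)
          = (\<integral>\<^sup>+x. (\<integral>\<^sup>+\<xi>. f \<xi> * (w x * shifted_radon x h \<xi>) \<partial>?\<sigma>) \<partial>lborel)"
        by (simp add: nn_integral_cmult[symmetric] mult_ac)
      also have "\<dots> = (\<integral>\<^sup>+\<xi>. (\<integral>\<^sup>+x. f \<xi> * (w x * shifted_radon x h \<xi>) \<partial>lborel) \<partial>?\<sigma>)"
        by (rule L.Fubini'[symmetric]) measurable
      also have "\<dots> = (\<integral>\<^sup>+\<xi>. (\<integral>\<^sup>+\<theta>. f \<xi> * (h \<theta> * K (\<theta> \<bullet> \<xi>)) \<partial>?\<sigma>) \<partial>?\<sigma>)"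
      proof (rule nn_integral_cong_AE)
        show "AE \<xi> in ?\<sigma>. (\<integral>\<^sup>+x. f \<xi> * (w x * shifted_radon x h \<xi>) \<partial>lborel) = (\<integral>\<^sup>+\<theta>. f \<xi> * (h \<theta> * K (\<theta> \<bullet> \<xi>)) \<partial>?\<sigma>)"
          using AE1
        proof eventually_elim
          case (elim \<xi>)
          show ?case
            by (subst (1 2) nn_integral_cmult) (auto simp: surface_measure_slice[OF elim n] w_def)
        qed
      qed
      finally show ?thesis .
    qed
    \<comment> \<open>An error \<epsilon> at each point of a subsphere costs \<epsilon> times its
      mass. The estimate for g is used at the start of the chain of inequalities, the one for b at
      its end.\<close>
    have R: "radon g \<xi> \<le> shifted_radon x g \<xi> + ennreal \<epsilon> * ?m" "shifted_radon x b \<xi> \<le> radon b \<xi> + ennreal \<epsilon> * ?m"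
      if x: "w x \<noteq> 0" and \<xi>: "norm \<xi> = 1" for x and \<xi> :: 'a
    proof -
      note AE2 = AE_subsphere_measure[OF \<xi>]
      have m: "ennreal \<epsilon> * ?m = (\<integral>\<^sup>+\<eta>. ennreal \<epsilon> \<partial>subsphere_measure \<xi>)"
        using \<xi> n by (simp add: emeasure_subsphere_measure)
      have "radon g \<xi> \<le> (\<integral>\<^sup>+\<eta>. g ((\<eta> + x *\<^sub>R \<xi>) /\<^sub>R sqrt (1 + x\<^sup>2)) + ennreal \<epsilon> \<partial>subsphere_measure \<xi>)"
        unfolding radon_def
        by (rule nn_integral_mono_AE, use AE2 in eventually_elim)
          (use near[OF x \<xi>] \<delta>(2) \<epsilon> g0 in \<open>simp add: dist_commute ennreal_leI flip: ennreal_plus\<close>)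
      then show "radon g \<xi> \<le> shifted_radon x g \<xi> + ennreal \<epsilon> * ?m"
        unfolding m shifted_radon_def by (subst (asm) nn_integral_add) auto
      have "shifted_radon x b \<xi> \<le> (\<integral>\<^sup>+\<eta>. b \<eta> + ennreal \<epsilon> \<partial>subsphere_measure \<xi>)"
        unfolding shifted_radon_def
        by (rule nn_integral_mono_AE, use AE2 in eventually_elim)
          (use near[OF x \<xi>] \<delta>(3) \<epsilon> b0 in \<open>simp add: ennreal_leI flip: ennreal_plus\<close>)
      then show "shifted_radon x b \<xi> \<le> radon b \<xi> + ennreal \<epsilon> * ?m"
        unfolding m radon_def by (subst (asm) nn_integral_add) auto
    qed
    let ?B = "\<integral>\<^sup>+\<xi>. b \<xi> * radon g \<xi> \<partial>?\<sigma>" and ?B' = "\<integral>\<^sup>+\<xi>. g \<xi> * radon b \<xi> \<partial>?\<sigma>"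
    let ?c1 = "ennreal \<epsilon> * (?m * (\<integral>\<^sup>+\<xi>. b \<xi> \<partial>?\<sigma>))" and ?c2 = "ennreal \<epsilon> * (?m * (\<integral>\<^sup>+\<xi>. g \<xi> \<partial>?\<sigma>))"
    have B1: "w x * ?B \<le> w x * ((\<integral>\<^sup>+\<xi>. b \<xi> * shifted_radon x g \<xi> \<partial>?\<sigma>) + ?c1)" for x
    proof (cases "w x = 0")
      case False
      have "?B \<le> (\<integral>\<^sup>+\<xi>. b \<xi> * shifted_radon x g \<xi> + ennreal \<epsilon> * ?m * b \<xi> \<partial>?\<sigma>)"
        by (rule nn_integral_mono_AE, use AE1 in eventually_elim)
          (rule mult_le_mult_add[OF R(1)[OF False]])
      then show ?thesis by (subst (asm) nn_integral_add) (auto simp: nn_integral_cmult mult.assoc intro!: mult_left_mono)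
    qed simp
    have B2: "w x * (\<integral>\<^sup>+\<xi>. g \<xi> * shifted_radon x b \<xi> \<partial>?\<sigma>) \<le> w x * (?B' + ?c2)" for x
    proof (cases "w x = 0")
      case False
      have "(\<integral>\<^sup>+\<xi>. g \<xi> * shifted_radon x b \<xi> \<partial>?\<sigma>) \<le> (\<integral>\<^sup>+\<xi>. g \<xi> * radon b \<xi> + ennreal \<epsilon> * ?m * g \<xi> \<partial>?\<sigma>)"
        by (rule nn_integral_mono_AE, use AE1 in eventually_elim)
          (rule mult_le_mult_add[OF R(2)[OF False]])
      then show ?thesis by (subst (asm) nn_integral_add) (auto simp: nn_integral_cmult mult.assoc intro!: mult_left_mono)
    qed simp
    have "W * ?B = (\<integral>\<^sup>+x. w x * ?B \<partial>lborel)" by (simp add: W_def nn_integral_multc)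
    also have "\<dots> \<le> (\<integral>\<^sup>+x. w x * ((\<integral>\<^sup>+\<xi>. b \<xi> * shifted_radon x g \<xi> \<partial>?\<sigma>) + ?c1) \<partial>lborel)"
      by (intro nn_integral_mono B1)
    also have "\<dots> = (\<integral>\<^sup>+x. w x * (\<integral>\<^sup>+\<xi>. b \<xi> * shifted_radon x g \<xi> \<partial>?\<sigma>) \<partial>lborel) + W * ?c1"
      by (simp add: distrib_left nn_integral_add nn_integral_multc W_def)
    also have "(\<integral>\<^sup>+x. w x * (\<integral>\<^sup>+\<xi>. b \<xi> * shifted_radon x g \<xi> \<partial>?\<sigma>) \<partial>lborel)
        = (\<integral>\<^sup>+\<xi>. (\<integral>\<^sup>+\<theta>. b \<xi> * (g \<theta> * K (\<theta> \<bullet> \<xi>)) \<partial>?\<sigma>) \<partial>?\<sigma>)"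
      by (rule sym) auto
    also have "\<dots> = (\<integral>\<^sup>+\<theta>. (\<integral>\<^sup>+\<xi>. b \<xi> * (g \<theta> * K (\<theta> \<bullet> \<xi>)) \<partial>?\<sigma>) \<partial>?\<sigma>)"
      by (rule P.Fubini') measurable
    also have "\<dots> = (\<integral>\<^sup>+\<xi>. (\<integral>\<^sup>+\<theta>. g \<xi> * (b \<theta> * K (\<theta> \<bullet> \<xi>)) \<partial>?\<sigma>) \<partial>?\<sigma>)"
      by (simp add: mult_ac inner_commute)
    also have "\<dots> = (\<integral>\<^sup>+x. w x * (\<integral>\<^sup>+\<xi>. g \<xi> * shifted_radon x b \<xi> \<partial>?\<sigma>) \<partial>lborel)"
      by (rule sym[symmetric]) auto
    also have "\<dots> \<le> (\<integral>\<^sup>+x. w x * (?B' + ?c2) \<partial>lborel)"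
      by (intro nn_integral_mono B2)
    also have "\<dots> = W * (?B' + ?c2)" by (simp add: W_def nn_integral_multc)
    finally have "W * ?B \<le> W * (?B' + ?c2 + ?c1)" by (simp add: distrib_left)
    then have "?B \<le> ?B' + ?c2 + ?c1"
      using W0 W1 by (subst (asm) ennreal_mult_le_mult_iff) (auto simp: zero_less_iff_neq_zero)
    then show ?thesis by (simp add: C_def distrib_left add_ac)
  qed
  show ?thesis
  proof (rule ennreal_le_epsilon)
    fix e :: real assume e: "0 < e"
    obtain c where c: "C = ennreal c" "c \<ge> 0" using C by (cases C) auto
    have "ennreal (e / (c + 1)) * C \<le> ennreal e"
      using c e by (simp add: field_simps flip: ennreal_mult) 
    moreover have "e / (c + 1) > 0" using c e by simp
    ultimately show "(\<integral>\<^sup>+\<xi>. b \<xi> * radon g \<xi> \<partial>?\<sigma>) \<le> (\<integral>\<^sup>+\<xi>. g \<xi> * radon b \<xi> \<partial>?\<sigma>) + ennreal e"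
      by (intro order_trans[OF main add_left_mono])
  qed
qed

section \<open>From continuous to measurable densities\<close>

lemma continuous_indicator_seq:
  fixes U :: "'a::euclidean_space set"
  assumes U: "open U"
  obtains f :: "nat \<Rightarrow> 'a \<Rightarrow> real" where "\<And>k. continuous_on UNIV (f k)" "\<And>k x. f k x \<ge> 0"
    "\<And>x. incseq (\<lambda>k. f k x)" "\<And>x. (\<lambda>k. f k x) \<longlonglongrightarrow> indicator U x"
proof (cases "U = UNIV")
  \<comment> \<open>The distance to the empty set is 0 by convention, so the formula used below
    would give 0 for the whole space.\<close>
  case True
  then show ?thesis by (intro that[of "\<lambda>_ _. 1"]) auto
next
  case False
  define f where "f k x = min 1 (real k * infdist x (-U))" for k x
  show ?thesis
  proof (rule that[of f])
    show "continuous_on UNIV (f k)" for k unfolding f_def by (intro continuous_intros)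
    show "f k x \<ge> 0" for k x by (simp add: f_def infdist_nonneg)
    show "incseq (\<lambda>k. f k x)" for x
      unfolding f_def incseq_def by (intro allI impI min.mono order_refl mult_right_mono infdist_nonneg) simp
    show "(\<lambda>k. f k x) \<longlonglongrightarrow> indicator U x" for x
    proof (cases "x \<in> U")
      case True
      then have "infdist x (-U) > 0"
        using False U in_closed_iff_infdist_zero[of "-U" x] infdist_nonneg[of x "-U"] by force
      then obtain N where N: "real N * infdist x (-U) > 1"
        using reals_Archimedean3 by metis
      have "f k x = 1" if "k \<ge> N" for k
      proof -
        have "real N * infdist x (-U) \<le> real k * infdist x (-U)"
          using that by (intro mult_right_mono infdist_nonneg) auto
        then show ?thesis using N by (simp add: f_def)
      qed
      then have "eventually (\<lambda>k. f k x = 1) sequentially" by (auto simp: eventually_sequentially)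
      then show ?thesis using True by (simp add: tendsto_eventually)
    next
      case False
      then show ?thesis by (simp add: f_def)
    qed
  qed
qed

lemma radon_add:
  assumes "f \<in> borel_measurable borel" "g \<in> borel_measurable borel"
  shows "radon (\<lambda>x. f x + g x) \<xi> = radon f \<xi> + radon g \<xi>"
  unfolding radon_def by (rule nn_integral_add) (use assms in measurable)

lemma radon_cmult:
  assumes [measurable]: "f \<in> borel_measurable borel"
  shows "radon (\<lambda>x. c * f x) \<xi> = c * radon f \<xi>"
  unfolding radon_def by (rule nn_integral_cmult) measurable

text \<open>The class of b for which the identity holds grows from continuous functions to open sets
  by monotone limits, to Borel sets by a Dynkin argument, and to measurable functions by monotone
  limits of simple ones. g stays continuous throughout.\<close>

lemma radon_selfadjoint:
  fixes g :: "'a::euclidean_space \<Rightarrow> real" and b :: "'a \<Rightarrow> ennreal"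
  assumes n: "DIM('a) \<ge> 2"
    and b: "b \<in> borel_measurable borel" and g [measurable]: "g \<in> borel_measurable borel"
    and g0: "\<And>x. g x \<ge> 0" and gc: "continuous_on (sphere 0 1) g"
  shows "(\<integral>\<^sup>+\<xi>. b \<xi> * radon g \<xi> \<partial>surface_measure) = (\<integral>\<^sup>+\<xi>. g \<xi> * radon b \<xi> \<partial>surface_measure)"
proof -
  let ?\<sigma> = "surface_measure :: 'a measure"
  define P where "P b \<longleftrightarrow> (\<integral>\<^sup>+\<xi>. b \<xi> * radon g \<xi> \<partial>?\<sigma>) = (\<integral>\<^sup>+\<xi>. g \<xi> * radon b \<xi> \<partial>?\<sigma>)"
    for b :: "'a \<Rightarrow> ennreal"
  interpret \<sigma>: finite_measure ?\<sigma> by (rule finite_surface_measure)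
  have AE1: "AE \<xi> in ?\<sigma>. norm \<xi> = 1" by (rule AE_cone_measure_norm) simp
  have cont: "P (\<lambda>x. ennreal (b x))" if "continuous_on UNIV b" "\<And>x. b x \<ge> 0" for b :: "'a \<Rightarrow> real"
  proof -
    have "b \<in> borel_measurable borel" using that by (intro borel_measurable_continuous_onI)
    moreover have "continuous_on (sphere 0 1) b" using that continuous_on_subset by blast
    ultimately show ?thesis unfolding P_def
      using that gc g0 n g by (intro antisym radon_selfadjoint_le) auto
  qed
  have sup: "P (\<lambda>x. SUP k. f k x)" if [measurable]: "\<And>k::nat. f k \<in> borel_measurable borel" and inc: "incseq f" and P: "\<And>k. P (f k)" for f
  proof -
    have m: "(\<lambda>\<xi>. f k \<xi> * radon g \<xi>) \<in> borel_measurable ?\<sigma>"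
      "(\<lambda>\<xi>. ennreal (g \<xi>) * radon (f k) \<xi>) \<in> borel_measurable ?\<sigma>" for k
      by measurable
    have "radon (\<lambda>x. SUP k. f k x) \<xi> = (SUP k. radon (f k) \<xi>)" for \<xi>
      unfolding radon_def using inc by (intro nn_integral_monotone_convergence_SUP) auto
    moreover have "incseq (\<lambda>k \<xi>. f k \<xi> * radon g \<xi>)" "incseq (\<lambda>k \<xi>. ennreal (g \<xi>) * radon (f k) \<xi>)"
      using inc by (auto simp: incseq_def le_fun_def radon_def intro!: mult_right_mono mult_left_mono nn_integral_mono)
    moreover have "(SUP k. f k \<xi>) * radon g \<xi> = (SUP k. f k \<xi> * radon g \<xi>)" for \<xi>
      by (rule SUP_mult_right_ennreal)
    moreover have "ennreal (g \<xi>) * (SUP k. radon (f k) \<xi>) = (SUP k. ennreal (g \<xi>) * radon (f k) \<xi>)" for \<xi>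
      by (rule SUP_mult_left_ennreal)
    ultimately show ?thesis
      using P unfolding P_def
      by (simp only: nn_integral_monotone_convergence_SUP m)
  qed
  have add: "P (\<lambda>x. f x + h x)" if [measurable]: "f \<in> borel_measurable borel" "h \<in> borel_measurable borel" and "P f" "P h" for f h
    using that(3,4) unfolding P_def
    by (simp add: distrib_left distrib_right nn_integral_add radon_add)
  have cmult: "P (\<lambda>x. c * f x)" if [measurable]: "f \<in> borel_measurable borel" and "P f" for f c
    using that(2) unfolding P_def
    by (simp add: radon_cmult nn_integral_cmult mult.assoc mult.left_commute[of _ c])
  have op: "P (indicator U)" if U: "open U" for U
  proof -
    obtain f :: "nat \<Rightarrow> 'a \<Rightarrow> real" where f: "\<And>k. continuous_on UNIV (f k)" "\<And>k x. f k x \<ge> 0"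
      "\<And>x. incseq (\<lambda>k. f k x)" "\<And>x. (\<lambda>k. f k x) \<longlonglongrightarrow> indicator U x"
      using continuous_indicator_seq[OF U] by blast
    have "P (\<lambda>x. SUP k. ennreal (f k x))"
    proof (rule sup)
      show "(\<lambda>x. ennreal (f k x)) \<in> borel_measurable borel" for k
        using f(1)[of k] by (intro measurable_compose[OF borel_measurable_continuous_onI measurable_ennreal])
      show "incseq (\<lambda>k x. ennreal (f k x))" using f(3) by (auto simp: incseq_def le_fun_def intro: ennreal_leI)
    qed (use f in \<open>auto intro: cont\<close>)
    also have "(\<lambda>x. SUP k. ennreal (f k x)) = indicator U"
    proof
      fix x
      have "(\<lambda>k. ennreal (f k x)) \<longlonglongrightarrow> ennreal (indicator U x)" using f(4) by (intro tendsto_ennrealI)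
      moreover have "(\<lambda>k. ennreal (f k x)) \<longlonglongrightarrow> (SUP k. ennreal (f k x))"
        using f(3)[of x] by (intro LIMSEQ_SUP) (auto simp: incseq_def intro: ennreal_leI)
      ultimately show "(SUP k. ennreal (f k x)) = indicator U x"
        by (simp add: LIMSEQ_unique ennreal_indicator)
    qed
    finally show ?thesis .
  qed
  have set: "P (indicator A)" if A: "A \<in> sets borel" for A
  proof -
    have "Int_stable {S::'a set. open S}" "{S::'a set. open S} \<subseteq> Pow UNIV"
      by (auto simp: Int_stable_def)
    moreover have "A \<in> sigma_sets UNIV {S. open S}" using A by (simp add: borel_def)
    ultimately show ?thesis
    proof (induction rule: sigma_sets_induct_disjoint)
      case (basic U) then show ?case by (auto intro: op)
    next
      case empty then show ?case by (auto simp: P_def radon_def)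
    next
      case (compl A)
      then have [measurable]: "A \<in> sets borel" by (simp add: borel_def)
      let ?x = "\<integral>\<^sup>+\<xi>. indicator A \<xi> * radon g \<xi> \<partial>?\<sigma>"
      have "indicator A x + indicator (UNIV - A) x = (1::ennreal)" for x by (auto simp: indicator_def)
      then have split: "(\<lambda>x. indicator A x + indicator (UNIV - A) x) = (\<lambda>_. 1::ennreal)" by auto
      have "P (\<lambda>_. 1)" using op[of UNIV] by (simp add: indicator_def)
      then have eq: "?x + (\<integral>\<^sup>+\<xi>. indicator (UNIV - A) \<xi> * radon g \<xi> \<partial>?\<sigma>)
          = (\<integral>\<^sup>+\<xi>. g \<xi> * radon (indicator A) \<xi> \<partial>?\<sigma>) + (\<integral>\<^sup>+\<xi>. g \<xi> * radon (indicator (UNIV - A)) \<xi> \<partial>?\<sigma>)"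
        unfolding P_def split[symmetric]
        by (subst (asm) radon_add, measurable) (simp add: distrib_left distrib_right nn_integral_add)
      \<comment> \<open>Passing to complements means cancelling in [0,\<infinity>], hence
        finiteness; it comes from the bound on g over the sphere.\<close>
      have "?x < \<infinity>"
      proof -
        have "bounded (g ` sphere 0 1)" using gc by (intro compact_imp_bounded compact_continuous_image) auto
        then obtain C where "\<forall>y\<in>g ` sphere 0 1. norm y \<le> C" unfolding bounded_iff by blast
        then have C: "g x \<le> C" if "norm x = 1" for x using that by (metis abs_le_D1 image_eqI mem_sphere_0 real_norm_def)
        have "?x \<le> (\<integral>\<^sup>+\<xi>. ennreal C * subsphere_mass TYPE('a) \<partial>?\<sigma>)"
        proof (rule nn_integral_mono_AE, use AE1 in eventually_elim)
          fix \<xi> :: 'a assume \<xi>: "norm \<xi> = 1"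
          have "radon g \<xi> \<le> (\<integral>\<^sup>+\<eta>. ennreal C \<partial>subsphere_measure \<xi>)"
            unfolding radon_def
            by (rule nn_integral_mono_AE, use AE_subsphere_measure[OF \<xi>] in eventually_elim)
              (use C in \<open>auto intro: ennreal_leI\<close>)
          also have "\<dots> = ennreal C * subsphere_mass TYPE('a)"
            using emeasure_subsphere_measure[OF \<xi> n] by simp
          finally show "indicator A \<xi> * radon g \<xi> \<le> ennreal C * subsphere_mass TYPE('a)"
            by (auto simp: indicator_def)
        qed
        also have "\<dots> < \<infinity>"
        proof -
          obtain \<xi>0 :: 'a where \<xi>0: "norm \<xi>0 = 1" using norm_Basis nonempty_Basis by blast
          show ?thesis using subsphere_mass_finite[OF \<xi>0 n] \<sigma>.emeasure_finite[of UNIV]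
            by (simp add: ennreal_mult_eq_top_iff less_top[symmetric])
        qed
        finally show ?thesis .
      qed
      with eq compl show ?case unfolding P_def by (simp add: less_top[symmetric] ennreal_add_left_cancel)
    next
      case (union A)
      then have [measurable]: "A i \<in> sets borel" for i by (auto simp: borel_def)
      define f where "f k x = (\<Sum>i<k. indicator (A i) x :: ennreal)" for k x
      have [measurable]: "f k \<in> borel_measurable borel" for k unfolding f_def by measurable
      have Pf: "P (f k)" for k
      proof (induction k)
        case (Suc k)
        have "f (Suc k) = (\<lambda>x. f k x + indicator (A k) x)" by (simp add: f_def fun_eq_iff)
        then show ?case using Suc union by (auto intro!: add simp: f_def)
      qed (simp add: P_def f_def radon_def)
      then have "P (\<lambda>x. SUP k. f k x)"
        by (intro sup[OF _ _ Pf]) (auto simp: f_def incseq_def le_fun_def intro!: sum_mono2)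
      also have "(\<lambda>x. SUP k. f k x) = indicator (\<Union>i. A i)"
        using suminf_indicator[OF union(1)] by (simp add: f_def fun_eq_iff suminf_eq_SUP[symmetric])
      finally show ?case by simp
    qed
  qed
  have "P b"
    using b
  proof (induction rule: borel_measurable_induct)
    case (cong f g)
    then have "f = g" by (auto simp: fun_eq_iff)
    then show ?case using cong by simp
  next
    case (seq U)
    have "P (\<lambda>x. SUP k. U k x)" using seq by (intro sup) auto
    moreover have "(SUP k. U k) = (\<lambda>x. SUP k. U k x)" by (rule ext) (rule SUP_apply)
    ultimately show ?case by simp
  qed (auto intro: set cmult add)
  then show ?thesis by (simp add: P_def)
qed

section \<open>Surface measures on spheres of subspaces\<close>

text \<open>Collapses the nested restrictions, images and scalings of the definition into one
  Lebesgue integral over the ambient space. The hypotheses are what the measurability of the layers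
  asks of V, and they cover both the full space and hyperplanes.\<close>

lemma nn_integral_sphere_measure:
  fixes f :: "'a::euclidean_space \<Rightarrow> ennreal"
  assumes V [measurable]: "V \<in> sets borel" and cp [measurable]: "closest_point V \<in> borel_measurable borel"
    and cpV: "\<And>y. closest_point V y \<in> V" and scV: "\<And>t z. z \<in> V \<Longrightarrow> t *\<^sub>R z \<in> V"
    and f [measurable]: "f \<in> borel_measurable borel"
  shows "(\<integral>\<^sup>+z. f z \<partial>sphere_measure V) = ennreal (dim V) * (ennreal (1 / unit_ball_vol (real (DIM('a) - dim V))) *
    (\<integral>\<^sup>+y. f (closest_point V y /\<^sub>R norm (closest_point V y)) * indicator (cball 0 1 - {0}) (closest_point V y)
      * indicator {y. norm (y - closest_point V y) \<le> 1} y \<partial>lborel))"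
proof -
  let ?P = "closest_point V"
  let ?L = "restrict_space lborel {x. norm (x - ?P x) \<le> 1} :: 'a measure"
  have sL: "sets (subspace_lborel V) = sets (restrict_space borel V)"
    by (simp add: subspace_lborel_def)
  have spL: "space (subspace_lborel V) = V"
    using sets_eq_imp_space_eq[OF sL] by (simp add: space_restrict_space)
  have P: "?P \<in> measurable ?L (restrict_space borel V)"
    by (rule measurable_restrict_space2) (auto simp: cpV intro!: measurable_restrict_space1)
  have f1: "f1 \<in> borel_measurable (subspace_lborel V)" if "f1 \<in> borel_measurable borel" for f1 :: "'a \<Rightarrow> ennreal"
    using that by (subst measurable_cong_sets[OF sL refl]) (rule measurable_restrict_space1)
  have N: "(\<lambda>x. x /\<^sub>R norm x) \<in> measurable (restrict_space (subspace_lborel V) (cball 0 1 - {0})) (restrict_space borel (sphere 0 1 \<inter> V))"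
  proof (rule measurable_restrict_space2)
    show "(\<lambda>x. x /\<^sub>R norm x) \<in> space (restrict_space (subspace_lborel V) (cball 0 1 - {0})) \<rightarrow> sphere 0 1 \<inter> V"
      by (auto simp: space_restrict_space spL scV)
    have "(\<lambda>x. x /\<^sub>R norm x) \<in> borel_measurable (subspace_lborel V)"
      by (subst measurable_cong_sets[OF sL refl]) (auto intro!: measurable_restrict_space1)
    then show "(\<lambda>x. x /\<^sub>R norm x) \<in> borel_measurable (restrict_space (subspace_lborel V) (cball 0 1 - {0}))"
      by (rule measurable_restrict_space1)
  qed
  have B: "(cball 0 1 - {0}) \<inter> space (subspace_lborel V) \<in> sets (subspace_lborel V)"
    unfolding spL sL by (subst sets_restrict_space_iff) auto
  have D: "{x. norm (x - ?P x) \<le> 1} \<in> sets borel" by measurable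
  have "(\<integral>\<^sup>+z. f z \<partial>sphere_measure V) = ennreal (dim V) *
      (\<integral>\<^sup>+z. f z \<partial>distr (restrict_space (subspace_lborel V) (cball 0 1 - {0})) (restrict_space borel (sphere 0 1 \<inter> V)) (\<lambda>x. x /\<^sub>R norm x))"
    unfolding sphere_measure_def
    by (rule nn_integral_scale_measure) (auto intro: measurable_restrict_space1)
  also have "(\<integral>\<^sup>+z. f z \<partial>distr (restrict_space (subspace_lborel V) (cball 0 1 - {0})) (restrict_space borel (sphere 0 1 \<inter> V)) (\<lambda>x. x /\<^sub>R norm x))
    = (\<integral>\<^sup>+z. f (z /\<^sub>R norm z) \<partial>restrict_space (subspace_lborel V) (cball 0 1 - {0}))"
    by (rule nn_integral_distr[OF N]) (auto intro: measurable_restrict_space1)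
  also have "\<dots> = (\<integral>\<^sup>+z. f (z /\<^sub>R norm z) * indicator (cball 0 1 - {0}) z \<partial>subspace_lborel V)"
    by (rule nn_integral_restrict_space[OF B])
  also have "\<dots> = ennreal (1 / unit_ball_vol (real (DIM('a) - dim V))) *
    (\<integral>\<^sup>+z. f (z /\<^sub>R norm z) * indicator (cball 0 1 - {0}) z \<partial>distr ?L (restrict_space borel V) ?P)"
    unfolding subspace_lborel_def
    by (rule nn_integral_scale_measure) (auto intro!: measurable_restrict_space1)
  also have "(\<integral>\<^sup>+z. f (z /\<^sub>R norm z) * indicator (cball 0 1 - {0}) z \<partial>distr ?L (restrict_space borel V) ?P)
    = (\<integral>\<^sup>+y. f (?P y /\<^sub>R norm (?P y)) * indicator (cball 0 1 - {0}) (?P y) \<partial>?L)"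
    by (rule nn_integral_distr[OF P]) (auto intro!: measurable_restrict_space1)
  also have "\<dots> = (\<integral>\<^sup>+y. f (?P y /\<^sub>R norm (?P y)) * indicator (cball 0 1 - {0}) (?P y)
      * indicator {y. norm (y - closest_point V y) \<le> 1} y \<partial>lborel)"
    by (rule nn_integral_restrict_space) (use D in auto)
  finally show ?thesis .
qed

lemma nn_integral_sphere_measure_UNIV:
  fixes f :: "'a::euclidean_space \<Rightarrow> ennreal"
  assumes [measurable]: "f \<in> borel_measurable borel"
  shows "(\<integral>\<^sup>+z. f z \<partial>sphere_measure UNIV) = (\<integral>\<^sup>+z. f z \<partial>surface_measure)"
proof -
  have cp: "closest_point UNIV = (\<lambda>y::'a. y)" by (auto simp: closest_point_self)
  show ?thesis
    by (subst nn_integral_sphere_measure)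
      (auto simp: cp nn_integral_cone_measure cone_integral_def unit_ball_vol_0 ennreal_of_nat_eq_real_of_nat)
qed

lemma orthogonal_comp_singleton: "{\<xi>}\<^sup>\<bottom> = {x. \<xi> \<bullet> x = 0}"
  by (auto simp: orthogonal_comp_def orthogonal_def)

lemma closest_point_hyperplane:
  fixes \<xi> :: "'a::euclidean_space"
  assumes "norm \<xi> = 1"
  shows "closest_point {x. \<xi> \<bullet> x = 0} y = hyperplane_proj \<xi> y"
proof (rule closest_point_unique[symmetric])
  show "convex {x. \<xi> \<bullet> x = 0}" "closed {x. \<xi> \<bullet> x = 0}"
    by (auto intro: convex_hyperplane closed_hyperplane)
  show "hyperplane_proj \<xi> y \<in> {x. \<xi> \<bullet> x = 0}"
    using hyperplane_proj_inner[OF assms] by (simp add: inner_commute)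
  show "\<forall>z\<in>{x. \<xi> \<bullet> x = 0}. dist y (hyperplane_proj \<xi> y) \<le> dist y z"
  proof
    fix z assume z: "z \<in> {x. \<xi> \<bullet> x = 0}"
    have "dist y (hyperplane_proj \<xi> y) = \<bar>y \<bullet> \<xi>\<bar>"
      using assms by (simp add: dist_norm hyperplane_proj_def)
    also have "\<dots> = \<bar>(y - z) \<bullet> \<xi>\<bar>" using z by (simp add: inner_diff_right inner_commute)
    also have "\<dots> \<le> norm (y - z) * norm \<xi>" by (rule Cauchy_Schwarz_ineq2)
    finally show "dist y (hyperplane_proj \<xi> y) \<le> dist y z" using assms by (simp add: dist_norm)
  qed
qed

text \<open>The orthogonal complement is a line, whose unit ball has length 2. This is the 1/2 in
  \<open>slab_weight\<close>, and the points at distance at most 1 from the hyperplane form its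
  slab.\<close>

lemma nn_integral_sphere_measure_hyperplane:
  fixes f :: "'a::euclidean_space \<Rightarrow> ennreal"
  assumes \<xi>: "norm \<xi> = 1" and [measurable]: "f \<in> borel_measurable borel"
  shows "(\<integral>\<^sup>+z. f z \<partial>sphere_measure ({\<xi>}\<^sup>\<bottom>)) = (\<integral>\<^sup>+z. f z \<partial>subsphere_measure \<xi>)"
proof -
  have cp: "closest_point ({\<xi>}\<^sup>\<bottom>) = hyperplane_proj \<xi>"
    using closest_point_hyperplane[OF \<xi>] by (auto simp: orthogonal_comp_singleton)
  have V: "{\<xi>}\<^sup>\<bottom> \<in> sets borel"
    unfolding orthogonal_comp_singleton by (auto intro: borel_closed closed_hyperplane)
  have dim: "dim ({\<xi>}\<^sup>\<bottom>) = DIM('a) - 1"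
    using dim_hyperplane[of \<xi>] norm_zero \<xi> by (metis orthogonal_comp_singleton zero_neq_one)
  have n: "norm (y - hyperplane_proj \<xi> y) = \<bar>y \<bullet> \<xi>\<bar>" for y
    using \<xi> by (simp add: hyperplane_proj_def)
  have "DIM('a) - (DIM('a) - 1) = 1" using DIM_positive[where 'a = 'a] by linarith
  then have c: "ennreal (1 / unit_ball_vol (real (DIM('a) - (DIM('a) - 1)))) = 1 / 2"
    by (simp add: unit_ball_vol_1 divide_ennreal_def flip: divide_ennreal)
  have P_meas: "hyperplane_proj \<xi> \<in> borel_measurable borel"
    by (rule measurable_hyperplane_proj[of "\<lambda>_. \<xi>" borel "\<lambda>x. x"]) auto
  have "(\<integral>\<^sup>+z. f z \<partial>sphere_measure ({\<xi>}\<^sup>\<bottom>)) = of_nat (DIM('a) - 1) * (1 / 2 *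
    (\<integral>\<^sup>+y. f (hyperplane_proj \<xi> y /\<^sub>R norm (hyperplane_proj \<xi> y)) * indicator (cball 0 1 - {0}) (hyperplane_proj \<xi> y)
      * indicator {y. \<bar>y \<bullet> \<xi>\<bar> \<le> 1} y \<partial>lborel))"
  proof -
    have cp_meas: "closest_point ({\<xi>}\<^sup>\<bottom>) \<in> borel_measurable borel" unfolding cp by (rule P_meas)
    have cp_V: "closest_point ({\<xi>}\<^sup>\<bottom>) y \<in> {\<xi>}\<^sup>\<bottom>" for y
      unfolding cp using hyperplane_proj_inner[OF \<xi>] by (simp add: orthogonal_comp_singleton inner_commute)
    have sc: "t *\<^sub>R z \<in> {\<xi>}\<^sup>\<bottom>" if "z \<in> {\<xi>}\<^sup>\<bottom>" for t z
      using that by (simp add: orthogonal_comp_singleton)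
    show ?thesis
      using nn_integral_sphere_measure[OF V cp_meas cp_V sc assms(2)]
      unfolding cp dim n c ennreal_of_nat_eq_real_of_nat .
  qed
  also have "1 / 2 * (\<integral>\<^sup>+y. f (hyperplane_proj \<xi> y /\<^sub>R norm (hyperplane_proj \<xi> y)) * indicator (cball 0 1 - {0}) (hyperplane_proj \<xi> y)
      * indicator {y. \<bar>y \<bullet> \<xi>\<bar> \<le> 1} y \<partial>lborel)
    = (\<integral>\<^sup>+y. 1 / 2 * (f (hyperplane_proj \<xi> y /\<^sub>R norm (hyperplane_proj \<xi> y)) * indicator (cball 0 1 - {0}) (hyperplane_proj \<xi> y)
      * indicator {y. \<bar>y \<bullet> \<xi>\<bar> \<le> 1} y) \<partial>lborel)"
    by (rule nn_integral_cmult[symmetric]) measurable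
  also have "\<dots> = (\<integral>\<^sup>+y. slab_weight \<xi> y * (f (hyperplane_proj \<xi> y /\<^sub>R norm (hyperplane_proj \<xi> y)) *
      indicator (cball 0 1 - {0}) (hyperplane_proj \<xi> y)) \<partial>lborel)"
    by (simp add: divide_ennreal_def mult_ac)
  also have "of_nat (DIM('a) - 1) * \<dots> = cone_integral (DIM('a) - 1) (slab_section \<xi> lborel) f"
    by (rule cone_integral_slab_section[symmetric]) auto
  finally show ?thesis by (simp add: nn_integral_subsphere_measure)
qed

lemma sets_sphere_measure: "sets (sphere_measure V) = sets (restrict_space borel (sphere 0 1 \<inter> V))"
  by (simp add: sphere_measure_def)

lemma space_sphere_measure: "space (sphere_measure V) = sphere 0 1 \<inter> V"
  using sets_eq_imp_space_eq[OF sets_sphere_measure[of V]] by (simp add: space_restrict_space)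

lemma measurable_sphere_measure:
  "f \<in> measurable borel N \<Longrightarrow> f \<in> measurable (sphere_measure V) N"
  by (subst measurable_cong_sets[OF sets_sphere_measure refl]) (rule measurable_restrict_space1)

text \<open>The image under the inclusion makes the measure on the sphere comparable with N. From
  equality of measures, integrals of signed functions transfer as well, without any check of
  integrability.\<close>

lemma distr_sphere_measureI:
  assumes N: "sets N = sets borel"
    and eq: "\<And>f. f \<in> borel_measurable borel \<Longrightarrow> (\<integral>\<^sup>+z. f z \<partial>sphere_measure V) = (\<integral>\<^sup>+z. f z \<partial>N)"
  shows "distr (sphere_measure V) borel (\<lambda>x. x) = N"
proof (rule measure_eqI)
  fix A assume "A \<in> sets (distr (sphere_measure V) borel (\<lambda>x. x))"
  then have [measurable]: "A \<in> sets borel" by simp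
  have "emeasure (distr (sphere_measure V) borel (\<lambda>x. x)) A = (\<integral>\<^sup>+z. indicator A z \<partial>distr (sphere_measure V) borel (\<lambda>x. x))"
    by simp
  also have "\<dots> = (\<integral>\<^sup>+z. indicator A z \<partial>sphere_measure V)"
    by (rule nn_integral_distr) (auto intro: measurable_sphere_measure)
  also have "\<dots> = (\<integral>\<^sup>+z. indicator A z \<partial>N)" by (rule eq) auto
  finally show "emeasure (distr (sphere_measure V) borel (\<lambda>x. x)) A = emeasure N A"
    by (simp add: N)
qed (simp add: N)

lemma distr_sphere_measure_UNIV: "distr (sphere_measure UNIV) borel (\<lambda>x. x) = surface_measure"
  by (rule distr_sphere_measureI) (auto simp: sets_cone_measure nn_integral_sphere_measure_UNIV)

lemma distr_sphere_measure_hyperplane: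
  "norm \<xi> = 1 \<Longrightarrow> distr (sphere_measure ({\<xi>}\<^sup>\<bottom>)) borel (\<lambda>x. x) = subsphere_measure \<xi>"
  by (rule distr_sphere_measureI) (auto simp: sets_subsphere_measure nn_integral_sphere_measure_hyperplane)

lemma integral_sphere_measure_UNIV:
  fixes f :: "'a::euclidean_space \<Rightarrow> real"
  assumes "f \<in> borel_measurable borel"
  shows "(LINT z|sphere_measure UNIV. f z) = (LINT z|surface_measure. f z)"
  unfolding distr_sphere_measure_UNIV[symmetric]
  by (rule integral_distr[symmetric]) (auto intro: measurable_sphere_measure assms)

lemma spherical_radon_eq:
  fixes f :: "'a::euclidean_space \<Rightarrow> real"
  assumes "f \<in> borel_measurable borel" "norm \<xi> = 1"
  shows "spherical_radon f \<xi> = (LINT \<eta>|subsphere_measure \<xi>. f \<eta>)"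
  unfolding distr_sphere_measure_hyperplane[OF assms(2), symmetric] spherical_radon_def
  by (rule integral_distr[symmetric]) (auto intro: measurable_sphere_measure assms)

text \<open>t = x / sqrt (1 + x^2) is the sine of the latitude. As dt = (1 + x^2)^(-3/2) dx and 1 -
  t^2 = 1 / (1 + x^2), three powers of the weight go into dt, and d \<ge> 3 leaves a natural
  exponent.\<close>

lemma gnomonic_substitution:
  fixes f :: "real \<Rightarrow> ennreal"
  assumes [measurable]: "f \<in> borel_measurable borel" and d: "d \<ge> 3"
  shows "(\<integral>\<^sup>+x. gnomonic_weight d x * f (x / sqrt (1 + x\<^sup>2)) \<partial>lborel)
    = (\<integral>\<^sup>+t. ennreal (sqrt (1 - t\<^sup>2) ^ (d - 3)) * indicator {-1<..<1} t * f t \<partial>lborel)"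
proof -
  define g where "g x = x / sqrt (1 + x\<^sup>2)" for x :: real
  have s: "sqrt (1 + x\<^sup>2) > 0" for x :: real by (simp add: add_pos_nonneg)
  have s2: "1 + x\<^sup>2 > 0" for x :: real by (simp add: add_pos_nonneg)
  let ?H = "\<lambda>x. gnomonic_weight d x * f (g x)"
  let ?F = "\<lambda>t. ennreal (sqrt (1 - t\<^sup>2) ^ (d - 3)) * f t"
  have g': "(g has_real_derivative 1 / sqrt (1 + x\<^sup>2) ^ 3) (at x)" for x
  proof -
    have "(g has_real_derivative (sqrt (1 + x\<^sup>2) - x * (x / sqrt (1 + x\<^sup>2))) / (sqrt (1 + x\<^sup>2) * sqrt (1 + x\<^sup>2))) (at x)"
      unfolding g_def using s[of x] s2[of x]
      by (auto intro!: derivative_eq_intros simp: field_simps)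
    also have "sqrt (1 + x\<^sup>2) - x * (x / sqrt (1 + x\<^sup>2)) = 1 / sqrt (1 + x\<^sup>2)"
      using s[of x] s2[of x] by (simp add: field_simps power2_eq_square)
    finally show ?thesis by (simp add: power3_eq_cube mult_ac)
  qed
  \<comment> \<open>The substitution is made on -N \<le> x \<le> N, and both sides converge
    monotonically.\<close>
  have "(\<lambda>N::nat. \<integral>\<^sup>+t. ?F t * indicator {g (-real N)..g (real N)} t \<partial>lborel) \<longlonglongrightarrow> (\<integral>\<^sup>+t. ?F t * indicator {-1<..<1} t \<partial>lborel)"
  proof (rule nn_integral_LIMSEQ)
    have g_mono: "g x \<le> g y" if "x \<le> y" for x y
      using that by (rule DERIV_nonneg_imp_nondecreasing) (use g' s in \<open>fastforce intro: less_imp_le\<close>)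
    show "incseq (\<lambda>N t. ?F t * indicator {g (-real N)..g (real N)} t)"
    proof (intro incseq_SucI le_funI mult_left_mono)
      fix N t
      have "{g (-real N)..g (real N)} \<subseteq> {g (-real (Suc N))..g (real (Suc N))}"
        using g_mono[of "-real (Suc N)" "-real N"] g_mono[of "real N" "real (Suc N)"] by auto
      then show "indicator {g (-real N)..g (real N)} t \<le> (indicator {g (-real (Suc N))..g (real (Suc N))} t :: ennreal)"
        by (auto simp: indicator_def)
    qed simp
    fix t
    show "(\<lambda>N. ?F t * indicator {g (-real N)..g (real N)} t) \<longlonglongrightarrow> ?F t * indicator {-1<..<1} t"
    proof (cases "t \<in> {-1<..<1}")
      case True
      then have t2: "t\<^sup>2 < 1" by (auto simp: abs_square_less_1)
      \<comment> \<open>|t| \<le> g N amounts to t^2 / (1 - t^2) \<le> N^2. A bound by N0 suffices,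
        since N \<le> N^2 for N \<ge> 1.\<close>
      obtain N0 :: nat where N0: "t\<^sup>2 / (1 - t\<^sup>2) \<le> real N0" using real_arch_simple by blast
      have "t \<in> {g (-real N)..g (real N)}" if N: "N \<ge> max 1 N0" for N
      proof -
        have "real N0 \<le> real N * real N"
        proof -
          have "real N0 \<le> real N * 1" "real N * 1 \<le> real N * real N" using N by (auto intro!: mult_left_mono)
          then show ?thesis by linarith
        qed
        then have "t\<^sup>2 \<le> (real N)\<^sup>2 * (1 - t\<^sup>2)"
          using N0 t2 by (simp add: pos_divide_le_eq power2_eq_square)
            (smt (verit, best) mult_right_mono)
        then have "t\<^sup>2 * (1 + (real N)\<^sup>2) \<le> (real N)\<^sup>2" by (simp add: algebra_simps)
        then have "t\<^sup>2 \<le> (g (real N))\<^sup>2"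
          using s2[of "real N"] by (simp add: g_def power_divide pos_le_divide_eq)
        then have "\<bar>t\<bar> \<le> g (real N)" by (rule power2_le_imp_le[of "\<bar>t\<bar>", simplified]) (simp add: g_def)
        moreover have "g (-real N) = - g (real N)" by (simp add: g_def)
        ultimately show ?thesis by auto
      qed
      then have "eventually (\<lambda>N. ?F t * indicator {g (-real N)..g (real N)} t = ?F t * indicator {-1<..<1} t) sequentially"
        using True unfolding eventually_sequentially by (intro exI[of _ "max 1 N0"]) auto
      then show ?thesis by (rule tendsto_eventually)
    next
      case False
      have "\<bar>g x\<bar> < 1" for x
      proof -
        have "(g x)\<^sup>2 < 1" using s2[of x] by (simp add: g_def power_divide)
        then show ?thesis by (simp add: abs_square_less_1)
      qed
      then have "g (real N) < 1" "- 1 < g (- real N)" for N :: nat by (auto simp: abs_less_iff minus_less_iff)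
      then have "t \<notin> {g (-real N)..g (real N)}" for N :: nat using False
        by (smt (verit, best) atLeastAtMost_iff greaterThanLessThan_iff)
      then show ?thesis using False by simp
    qed
  qed measurable
  moreover have "(\<integral>\<^sup>+t. ?F t * indicator {g (-real N)..g (real N)} t \<partial>lborel)
      = (\<integral>\<^sup>+x. ?H x * indicator {-real N..real N} x \<partial>lborel)" for N
  proof (cases "N = 0")
    case True
    then show ?thesis
      using nn_integral_null_set[of "{0}" lborel] by (simp add: g_def finite_imp_null_set_lborel)
  next
    case False
    have "(\<integral>\<^sup>+t. ?F t * indicator {g (-real N)..g (real N)} t \<partial>lborel)
        = (\<integral>\<^sup>+x. ?F (g x) * gnomonic_weight 3 x * indicator {-real N..real N} x \<partial>lborel)"
      by (rule nn_integral_substitution_aux)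
        (use False s in \<open>auto intro!: g' continuous_intros simp: less_imp_neq[OF s, symmetric] less_imp_neq[OF s2, symmetric] less_imp_le\<close>)
    also have "\<dots> = (\<integral>\<^sup>+x. ?H x * indicator {-real N..real N} x \<partial>lborel)"
    proof (rule nn_integral_cong)
      fix x
      have "1 - (g x)\<^sup>2 = 1 / (1 + x\<^sup>2)" using s2[of x] by (simp add: g_def power_divide field_simps)
      then have "sqrt (1 - (g x)\<^sup>2) = 1 / sqrt (1 + x\<^sup>2)" by (simp add: real_sqrt_divide)
      moreover have "d = (d - 3) + 3" using d by simp
      ultimately have "sqrt (1 - (g x)\<^sup>2) ^ (d - 3) * (1 / sqrt (1 + x\<^sup>2) ^ 3) = 1 / sqrt (1 + x\<^sup>2) ^ d"
        by (metis (no_types, lifting) mult.right_neutral power_add power_one_over times_divide_times_eq mult_1)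
      then have "ennreal (sqrt (1 - (g x)\<^sup>2) ^ (d - 3)) * gnomonic_weight 3 x = gnomonic_weight d x"
        using s[of x] by (metis ennreal_mult'' less_imp_le zero_le_divide_1_iff zero_le_power)
      then show "?F (g x) * gnomonic_weight 3 x * indicator {-real N..real N} x
        = ?H x * indicator {-real N..real N} x"
        by (simp add: mult_ac flip: mult.assoc)
    qed
    finally show ?thesis .
  qed
  moreover have "(\<lambda>N::nat. \<integral>\<^sup>+x. ?H x * indicator {-real N..real N} x \<partial>lborel)
      \<longlonglongrightarrow> (\<integral>\<^sup>+x. ?H x \<partial>lborel)"
  proof (rule nn_integral_LIMSEQ)
    show "incseq (\<lambda>N x. ?H x * indicator {-real N..real N} x)"
      by (intro incseq_SucI le_funI mult_left_mono) (auto simp: indicator_def)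
    fix x :: real
    obtain N0 :: nat where N0: "\<bar>x\<bar> \<le> real N0" using real_arch_simple by blast
    have "eventually (\<lambda>N. ?H x * indicator {-real N..real N} x = ?H x) sequentially"
    proof (rule eventually_sequentiallyI)
      fix N assume "N0 \<le> N"
      then have "\<bar>x\<bar> \<le> real N" using N0 by linarith
      then show "?H x * indicator {-real N..real N} x = ?H x"
        by (simp add: abs_le_iff minus_le_iff)
    qed
    then show "(\<lambda>N. ?H x * indicator {-real N..real N} x)
        \<longlonglongrightarrow> ?H x"
      by (rule tendsto_eventually)
  qed (simp add: g_def)
  ultimately have "(\<integral>\<^sup>+x. ?H x \<partial>lborel) = (\<integral>\<^sup>+t. ?F t * indicator {-1<..<1} t \<partial>lborel)"
    by (simp add: LIMSEQ_unique)
  then show ?thesis by (simp add: g_def mult_ac)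
qed

section \<open>A criterion for intersection bodies\<close>

lemma gnomonic_mass_nonzero: "gnomonic_mass d \<noteq> 0"
proof
  assume "gnomonic_mass d = 0"
  then have "AE x in lborel. gnomonic_weight d x = 0"
    unfolding gnomonic_mass_def by (subst (asm) nn_integral_0_iff_AE) auto
  moreover have "gnomonic_weight d x \<noteq> 0" for x :: real
    by (auto simp: ennreal_eq_0_iff not_le add_pos_nonneg)
  ultimately have "AE x in (lborel::real measure). False" by simp
  then show False by (simp add: eventually_False ae_filter_eq_bot_iff)
qed

lemma gnomonic_mass_finite:
  assumes "d \<ge> 3"
  shows "gnomonic_mass d \<noteq> \<infinity>"
proof -
  have "gnomonic_mass d = (\<integral>\<^sup>+t. ennreal (sqrt (1 - t\<^sup>2) ^ (d - 3)) * indicator {-1<..<1} t * 1 \<partial>lborel)"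
    unfolding gnomonic_mass_def using gnomonic_substitution[of "\<lambda>_. 1" d] assms by simp
  also have "\<dots> \<le> (\<integral>\<^sup>+t. indicator {-1<..<1::real} t \<partial>lborel)"
    by (intro nn_integral_mono) (auto simp: indicator_def power_le_one abs_square_le_1)
  also have "\<dots> = 2" by simp
  finally show ?thesis by (auto simp: top_unique)
qed

text \<open>The surface area of the unit sphere of an (n - 2)-dimensional space, that is, of a great
  subsphere sliced once more. Its positivity is what matters, as it can be absorbed into a
  density.\<close>

definition zonal_const :: "'a::euclidean_space itself \<Rightarrow> real" where
  "zonal_const _ = enn2real (subsphere_mass TYPE('a) / gnomonic_mass (DIM('a) - 1))"

lemma zonal_const:
  assumes "DIM('a::euclidean_space) \<ge> 4"
  shows "ennreal (zonal_const TYPE('a)) = subsphere_mass TYPE('a) / gnomonic_mass (DIM('a) - 1)"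
    and "zonal_const TYPE('a) > 0"
proof -
  obtain \<xi> :: 'a where \<xi>: "norm \<xi> = 1" using norm_Basis nonempty_Basis by blast
  have m: "subsphere_mass TYPE('a) \<noteq> 0" "subsphere_mass TYPE('a) \<noteq> \<infinity>"
    using subsphere_mass_nonzero[OF \<xi>] subsphere_mass_finite[OF \<xi>] assms by auto
  have g: "gnomonic_mass (DIM('a) - 1) \<noteq> 0" "gnomonic_mass (DIM('a) - 1) \<noteq> \<infinity>"
    using gnomonic_mass_nonzero gnomonic_mass_finite[of "DIM('a) - 1"] assms by auto
  have f: "subsphere_mass TYPE('a) / gnomonic_mass (DIM('a) - 1) \<noteq> \<infinity>"
    "subsphere_mass TYPE('a) / gnomonic_mass (DIM('a) - 1) \<noteq> 0"
    using m g by (auto simp: ennreal_divide_eq_top_iff)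
  show "ennreal (zonal_const TYPE('a)) = subsphere_mass TYPE('a) / gnomonic_mass (DIM('a) - 1)"
    using f by (simp add: zonal_const_def less_top)
  show "zonal_const TYPE('a) > 0"
    using f by (simp add: zonal_const_def enn2real_positive_iff less_top zero_less_iff_neq_zero)
qed

text \<open>The great subsphere spans n - 1 dimensions, so the exponent d - 3 of
  \<open>gnomonic_substitution\<close> becomes n - 4.\<close>

lemma radon_zonal:
  fixes \<xi> e :: "'a::euclidean_space"
  assumes "norm \<xi> = 1" "norm e = 1" "DIM('a) \<ge> 4" and [measurable]: "f \<in> borel_measurable borel"
  shows "radon (\<lambda>\<theta>. f (\<theta> \<bullet> e)) \<xi> = ennreal (zonal_const TYPE('a)) *
    (\<integral>\<^sup>+t. ennreal (sqrt (1 - t\<^sup>2) ^ (DIM('a) - 4)) * indicator {-1<..<1} t * f (sqrt (1 - (\<xi> \<bullet> e)\<^sup>2) * t) \<partial>lborel)"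
proof -
  have "radon (\<lambda>\<theta>. f (\<theta> \<bullet> e)) \<xi> = cone_integral (DIM('a) - 1) (slab_section \<xi> lborel) (\<lambda>\<theta>. f (\<theta> \<bullet> e))"
    unfolding radon_def by (rule nn_integral_subsphere_measure) auto
  also have "\<dots> = ennreal (zonal_const TYPE('a)) *
    (\<integral>\<^sup>+x. gnomonic_weight (DIM('a) - 1) x * f (sqrt (1 - (\<xi> \<bullet> e)\<^sup>2) * (x / sqrt (1 + x\<^sup>2))) \<partial>lborel)"
    unfolding zonal_const(1)[OF assms(3)] using assms by (intro cone_integral_zonal_hyperplane) auto
  also have "(\<integral>\<^sup>+x. gnomonic_weight (DIM('a) - 1) x * f (sqrt (1 - (\<xi> \<bullet> e)\<^sup>2) * (x / sqrt (1 + x\<^sup>2))) \<partial>lborel)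
    = (\<integral>\<^sup>+t. ennreal (sqrt (1 - t\<^sup>2) ^ (DIM('a) - 1 - 3)) * indicator {-1<..<1} t * f (sqrt (1 - (\<xi> \<bullet> e)\<^sup>2) * t) \<partial>lborel)"
    using assms by (intro gnomonic_substitution) auto
  finally show ?thesis using assms(3) by (simp add: numeral_eq_Suc)
qed

lemma surface_measure_zonal:
  fixes e :: "'a::euclidean_space"
  assumes "norm e = 1" "DIM('a) \<ge> 3" and [measurable]: "f \<in> borel_measurable borel"
  shows "(\<integral>\<^sup>+\<theta>. f (\<theta> \<bullet> e) \<partial>surface_measure) = subsphere_mass TYPE('a) *
    (\<integral>\<^sup>+t. ennreal (sqrt (1 - t\<^sup>2) ^ (DIM('a) - 3)) * indicator {-1<..<1} t * f t \<partial>lborel)"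
  by (subst nn_integral_cone_measure)
    (use assms gnomonic_substitution[of f "DIM('a)"] cone_integral_zonal_lborel[of e f] in auto)

text \<open>Tested on indicators, the hypothesis says that the image of N under the inner product
  with e is the image of a weighted Lebesgue measure under multiplication by r. Integrals of signed
  f then agree too.\<close>

lemma integral_zonalI:
  fixes f w :: "real \<Rightarrow> real" and e :: "'a::euclidean_space"
  assumes eq: "\<And>h. h \<in> borel_measurable borel \<Longrightarrow>
      (\<integral>\<^sup>+\<theta>. h (\<theta> \<bullet> e) \<partial>N) = ennreal c * (\<integral>\<^sup>+t. ennreal (w t) * h (r * t) \<partial>lborel)"
    and sets_N [measurable_cong]: "sets N = sets borel"
    and [measurable]: "w \<in> borel_measurable borel" "f \<in> borel_measurable borel"
    and w: "\<And>t. w t \<ge> 0" and c: "c \<ge> 0"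
  shows "(LINT \<theta>|N. f (\<theta> \<bullet> e)) = c * (LINT t|lborel. w t * f (r * t))"
proof -
  have [measurable]: "(\<lambda>\<theta>. \<theta> \<bullet> e) \<in> borel_measurable N"
    by (subst measurable_cong_sets[OF sets_N refl]) simp
  let ?D = "density lborel (\<lambda>t. ennreal (c * w t))"
  have "distr N borel (\<lambda>\<theta>. \<theta> \<bullet> e) = distr ?D borel (\<lambda>t. r * t)"
  proof (rule measure_eqI)
    fix A assume "A \<in> sets (distr N borel (\<lambda>\<theta>. \<theta> \<bullet> e))"
    then have [measurable]: "A \<in> sets borel" by simp
    have "emeasure (distr N borel (\<lambda>\<theta>. \<theta> \<bullet> e)) A = (\<integral>\<^sup>+z. indicator A z \<partial>distr N borel (\<lambda>\<theta>. \<theta> \<bullet> e))"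
      by simp
    also have "\<dots> = (\<integral>\<^sup>+\<theta>. indicator A (\<theta> \<bullet> e) \<partial>N)" by (rule nn_integral_distr) auto
    also have "\<dots> = ennreal c * (\<integral>\<^sup>+t. ennreal (w t) * indicator A (r * t) \<partial>lborel)"
      by (rule eq) auto
    also have "\<dots> = (\<integral>\<^sup>+t. indicator A (r * t) \<partial>?D)"
      using w c by (subst nn_integral_density) (auto simp: nn_integral_cmult[symmetric] ennreal_mult mult_ac)
    also have "\<dots> = (\<integral>\<^sup>+t. indicator A t \<partial>distr ?D borel (\<lambda>t. r * t))"
      by (rule nn_integral_distr[symmetric]) auto
    also have "\<dots> = emeasure (distr ?D borel (\<lambda>t. r * t)) A" by simp
    finally show "emeasure (distr N borel (\<lambda>\<theta>. \<theta> \<bullet> e)) A = emeasure (distr ?D borel (\<lambda>t. r * t)) A" .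
  qed simp
  then have "(LINT t|distr N borel (\<lambda>\<theta>. \<theta> \<bullet> e). f t) = (LINT t|distr ?D borel (\<lambda>t. r * t). f t)" by simp
  moreover have "(LINT t|distr N borel (\<lambda>\<theta>. \<theta> \<bullet> e). f t) = (LINT \<theta>|N. f (\<theta> \<bullet> e))"
    by (rule integral_distr) auto
  moreover have "(LINT t|distr ?D borel (\<lambda>t. r * t). f t) = (LINT t|?D. f (r * t))"
    by (rule integral_distr) auto
  moreover have "\<dots> = c * (LINT t|lborel. w t * f (r * t))"
    using w c by (subst integral_density) (auto simp: mult.assoc)
  ultimately show ?thesis by simp
qed

lemma spherical_radon_zonal:
  fixes \<xi> e :: "'a::euclidean_space"
  assumes "norm \<xi> = 1" "norm e = 1" "DIM('a) \<ge> 4" and [measurable]: "f \<in> borel_measurable borel"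
  shows "spherical_radon (\<lambda>\<theta>. f (\<theta> \<bullet> e)) \<xi> = zonal_const TYPE('a) *
    (LINT t|lborel. sqrt (1 - t\<^sup>2) ^ (DIM('a) - 4) * indicator {-1<..<1} t * f (sqrt (1 - (\<xi> \<bullet> e)\<^sup>2) * t))"
proof -
  have e: "ennreal (sqrt (1 - t\<^sup>2) ^ k * indicator {-1<..<1} t) = ennreal (sqrt (1 - t\<^sup>2) ^ k) * indicator {-1<..<1} t" for t :: real and k
    by (auto simp: indicator_def)
  have "(LINT \<theta>|subsphere_measure \<xi>. f (\<theta> \<bullet> e)) = zonal_const TYPE('a) *
    (LINT t|lborel. (sqrt (1 - t\<^sup>2) ^ (DIM('a) - 4) * indicator {-1<..<1} t) * f (sqrt (1 - (\<xi> \<bullet> e)\<^sup>2) * t))"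
  proof (rule integral_zonalI[where f = f and e = e and r = "sqrt (1 - (\<xi> \<bullet> e)\<^sup>2)"
        and w = "\<lambda>t. sqrt (1 - t\<^sup>2) ^ (DIM('a) - 4) * indicator {-1<..<1} t"])
    fix h :: "real \<Rightarrow> ennreal" assume h: "h \<in> borel_measurable borel"
    show "(\<integral>\<^sup>+\<theta>. h (\<theta> \<bullet> e) \<partial>subsphere_measure \<xi>) = ennreal (zonal_const TYPE('a)) *
      (\<integral>\<^sup>+t. ennreal (sqrt (1 - t\<^sup>2) ^ (DIM('a) - 4) * indicator {-1<..<1} t) * h (sqrt (1 - (\<xi> \<bullet> e)\<^sup>2) * t) \<partial>lborel)"
      using radon_zonal[OF assms(1-3) h] by (simp only: radon_def e)
  next
    show "sqrt (1 - t\<^sup>2) ^ (DIM('a) - 4) * indicator {-1<..<1} t \<ge> 0" for t :: real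
      by (auto simp: indicator_def abs_square_le_1)
  qed (use zonal_const(2)[OF assms(3)] in \<open>auto simp: sets_subsphere_measure\<close>)
  then show ?thesis using assms by (subst spherical_radon_eq) auto
qed

lemma integral_surface_zonal:
  fixes e :: "'a::euclidean_space"
  assumes "norm e = 1" "DIM('a) \<ge> 3"
  obtains c where "c > 0" "\<And>f. f \<in> borel_measurable borel \<Longrightarrow> (LINT \<theta>|sphere_measure UNIV. f (\<theta> \<bullet> e))
    = c * (LINT t|lborel. sqrt (1 - t\<^sup>2) ^ (DIM('a) - 3) * indicator {-1<..<1} t * f t)"
proof -
  have m: "subsphere_mass TYPE('a) \<noteq> 0" "subsphere_mass TYPE('a) \<noteq> \<infinity>"
    using subsphere_mass_nonzero[OF assms(1)] subsphere_mass_finite[OF assms(1)] assms by auto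
  then obtain c where c: "subsphere_mass TYPE('a) = ennreal c" "c \<ge> 0"
    by (cases "subsphere_mass TYPE('a)") auto
  then have "c > 0" using m by (cases "c = 0") auto
  have e: "ennreal (sqrt (1 - t\<^sup>2) ^ k * indicator {-1<..<1} t) = ennreal (sqrt (1 - t\<^sup>2) ^ k) * indicator {-1<..<1} t" for t :: real and k
    by (auto simp: indicator_def)
  have "(LINT \<theta>|sphere_measure UNIV. f (\<theta> \<bullet> e))
    = c * (LINT t|lborel. sqrt (1 - t\<^sup>2) ^ (DIM('a) - 3) * indicator {-1<..<1} t * f t)"
    if [measurable]: "f \<in> borel_measurable borel" for f :: "real \<Rightarrow> real"
  proof -
    have "(LINT \<theta>|surface_measure. f (\<theta> \<bullet> e)) = c *
      (LINT t|lborel. (sqrt (1 - t\<^sup>2) ^ (DIM('a) - 3) * indicator {-1<..<1} t) * f (1 * t))"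
    proof (rule integral_zonalI[where f = f and e = e and r = 1
        and w = "\<lambda>t. sqrt (1 - t\<^sup>2) ^ (DIM('a) - 3) * indicator {-1<..<1} t"])
      fix h :: "real \<Rightarrow> ennreal" assume "h \<in> borel_measurable borel"
      then show "(\<integral>\<^sup>+\<theta>. h (\<theta> \<bullet> e) \<partial>surface_measure) = ennreal c *
        (\<integral>\<^sup>+t. ennreal (sqrt (1 - t\<^sup>2) ^ (DIM('a) - 3) * indicator {-1<..<1} t) * h (1 * t) \<partial>lborel)"
        using surface_measure_zonal[OF assms, of h] unfolding e c by simp
    next
      show "sqrt (1 - t\<^sup>2) ^ (DIM('a) - 3) * indicator {-1<..<1} t \<ge> 0" for t :: real
        by (auto simp: indicator_def abs_square_le_1)
    qed (use \<open>c > 0\<close> in \<open>auto simp: sets_cone_measure\<close>)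
    then show ?thesis by (subst integral_sphere_measure_UNIV) auto
  qed
  with \<open>c > 0\<close> show ?thesis by (rule that)
qed

lemma surface_measure_uminus:
  fixes f :: "'a::euclidean_space \<Rightarrow> ennreal"
  assumes [measurable]: "f \<in> borel_measurable borel"
  shows "(\<integral>\<^sup>+z. f (- z) \<partial>surface_measure) = (\<integral>\<^sup>+z. f z \<partial>surface_measure)"
proof -
  let ?h = "\<lambda>z::'a. f (z /\<^sub>R norm z) * indicator (cball 0 1 - {0}) z"
  have "(\<integral>\<^sup>+z. ?h z \<partial>lborel) = (\<integral>\<^sup>+z. ?h (- z) \<partial>lborel)"
    by (subst lborel_affine[of "-1" 0]) (simp_all add: nn_integral_density nn_integral_distr)
  also have "\<dots> = (\<integral>\<^sup>+z. f (- (z /\<^sub>R norm z)) * indicator (cball 0 1 - {0}) z \<partial>lborel)"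
    by (intro nn_integral_cong) (auto simp: indicator_def)
  finally show ?thesis by (simp add: nn_integral_cone_measure cone_integral_def)
qed

lemma AE_surface_measure: "AE \<xi> in surface_measure. norm \<xi> = 1"
  by (rule AE_cone_measure_norm) simp

lemma bounded_on_sphere:
  fixes g :: "'a::euclidean_space \<Rightarrow> real"
  assumes "continuous_on (sphere 0 1) g"
  obtains C where "C \<ge> 0" "\<And>x. norm x = 1 \<Longrightarrow> \<bar>g x\<bar> \<le> C"
proof -
  have "bounded (g ` sphere 0 1)" using assms by (intro compact_imp_bounded compact_continuous_image) auto
  then obtain C where C: "\<forall>y\<in>g ` sphere 0 1. norm y \<le> C" unfolding bounded_iff by blast
  show ?thesis
  proof (rule that[of "max 0 C"])
    show "\<bar>g x\<bar> \<le> max 0 C" if "norm x = 1" for x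
      using C that by (force simp: image_iff)
  qed simp
qed

lemma borel_measurable_sphere_extension:
  fixes g :: "'a::euclidean_space \<Rightarrow> real"
  assumes "continuous_on (sphere 0 1) g"
  shows "(\<lambda>x. if x \<in> sphere 0 1 then g x else 0) \<in> borel_measurable borel"
  by (rule borel_measurable_continuous_on_if) (use assms in auto)

text \<open>The measure is b times surface measure. Self-adjointness moves the Radon transform from
  g to b, which turns one side of the definition into the other.\<close>

proposition intersection_body_if_radon_density:
  fixes K :: "'a::euclidean_space set" and b :: "'a \<Rightarrow> ennreal"
  assumes n: "DIM('a) \<ge> 2" and K: "star_body K" "origin_symmetric K"
    and b [measurable]: "b \<in> borel_measurable borel" and even: "\<And>x. b (- x) = b x"
    and \<rho>: "\<And>\<xi>. norm \<xi> = 1 \<Longrightarrow> 0 \<le> radial_fun K \<xi> \<and> radon b \<xi> = ennreal (radial_fun K \<xi>)"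
  shows "intersection_body K"
proof -
  let ?\<sigma> = "surface_measure :: 'a measure"
  let ?S = "sphere_measure UNIV :: 'a measure"
  define \<mu> where "\<mu> = density ?S b"
  have bS: "b \<in> borel_measurable ?S" by (rule measurable_sphere_measure) simp
  have sets_\<mu>: "sets \<mu> = sets (restrict_space borel (sphere 0 1))" by (simp add: \<mu>_def sets_sphere_measure)
  have space_\<mu>: "space \<mu> = sphere 0 1" by (simp add: \<mu>_def space_sphere_measure)
  have nn_\<mu>: "(\<integral>\<^sup>+\<xi>. f \<xi> \<partial>\<mu>) = (\<integral>\<^sup>+\<xi>. b \<xi> * f \<xi> \<partial>?\<sigma>)" if [measurable]: "f \<in> borel_measurable borel" for f
  proof -
    have "(\<integral>\<^sup>+\<xi>. f \<xi> \<partial>\<mu>) = (\<integral>\<^sup>+\<xi>. b \<xi> * f \<xi> \<partial>?S)"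
      unfolding \<mu>_def by (rule nn_integral_density[OF bS]) (rule measurable_sphere_measure, simp)
    also have "\<dots> = (\<integral>\<^sup>+\<xi>. b \<xi> * f \<xi> \<partial>?\<sigma>)" by (rule nn_integral_sphere_measure_UNIV) auto
    finally show ?thesis .
  qed
  have em: "emeasure \<mu> A = (\<integral>\<^sup>+\<xi>. b \<xi> * indicator A \<xi> \<partial>?\<sigma>)" if A: "A \<in> sets \<mu>" for A
  proof -
    have "A \<in> sets borel" using A unfolding sets_\<mu> by (subst (asm) sets_restrict_space_iff) auto
    moreover have "emeasure \<mu> A = (\<integral>\<^sup>+\<xi>. indicator A \<xi> \<partial>\<mu>)" using A by simp
    ultimately show ?thesis by (simp add: nn_\<mu>)
  qed
  define r where "r \<xi> = enn2real (radon b \<xi>)" for \<xi>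
  have [measurable]: "r \<in> borel_measurable borel" unfolding r_def by measurable
  have r: "radial_fun K \<xi> = r \<xi>" "radon b \<xi> = ennreal (r \<xi>)" if "norm \<xi> = 1" for \<xi>
    using \<rho>[OF that] by (auto simp: r_def)
  have r0: "r \<xi> \<ge> 0" for \<xi> by (simp add: r_def)
  obtain Cr where Cr: "Cr \<ge> 0" "\<And>x. norm x = 1 \<Longrightarrow> \<bar>radial_fun K x\<bar> \<le> Cr"
    using bounded_on_sphere[of "radial_fun K"] K(1) unfolding star_body_def by blast
  interpret \<sigma>: finite_measure ?\<sigma> by (rule finite_surface_measure)
  obtain \<xi>0 :: 'a where \<xi>0: "norm \<xi>0 = 1" using norm_Basis nonempty_Basis by blast
  have fin_r: "(\<integral>\<^sup>+\<xi>. ennreal C * radon b \<xi> \<partial>?\<sigma>) < \<infinity>" for C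
  proof -
    have "(\<integral>\<^sup>+\<xi>. ennreal C * radon b \<xi> \<partial>?\<sigma>) \<le> (\<integral>\<^sup>+\<xi>. ennreal C * ennreal Cr \<partial>?\<sigma>)"
      by (rule nn_integral_mono_AE, use AE_surface_measure in eventually_elim)
        (use r Cr in \<open>force intro!: mult_left_mono ennreal_leI\<close>)
    also have "\<dots> < \<infinity>" using \<sigma>.emeasure_finite[of UNIV]
      by (simp add: ennreal_mult_eq_top_iff less_top[symmetric])
    finally show ?thesis .
  qed
  have dual: "(\<integral>\<^sup>+\<xi>. b \<xi> * radon h \<xi> \<partial>?\<sigma>) = (\<integral>\<^sup>+\<xi>. h \<xi> * radon b \<xi> \<partial>?\<sigma>)"
    if "h \<in> borel_measurable borel" "\<And>x. h x \<ge> 0" "continuous_on (sphere 0 1) h" for h :: "'a \<Rightarrow> real"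
    by (rule radon_selfadjoint) (use n that in auto)
  have radon1: "radon (\<lambda>_. 1) \<xi> = subsphere_mass TYPE('a)" if "norm \<xi> = 1" for \<xi> :: 'a
    unfolding radon_def using emeasure_subsphere_measure[OF that n] by simp
  \<comment> \<open>Duality with the constant 1: the mass of \<mu> times that of a subsphere is the
    integral of the bounded radial function.\<close>
  have fin_\<mu>: "emeasure \<mu> (space \<mu>) \<noteq> \<infinity>"
  proof -
    have "(\<integral>\<^sup>+\<xi>. b \<xi> * subsphere_mass TYPE('a) \<partial>?\<sigma>) = (\<integral>\<^sup>+\<xi>. b \<xi> * radon (\<lambda>_. ennreal 1) \<xi> \<partial>?\<sigma>)"
      by (rule nn_integral_cong_AE, use AE_surface_measure in eventually_elim) (simp add: radon1)
    also have "\<dots> = (\<integral>\<^sup>+\<xi>. ennreal 1 * radon b \<xi> \<partial>?\<sigma>)" by (rule dual) auto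
    also have "\<dots> < \<infinity>" by (rule fin_r)
    finally have "(\<integral>\<^sup>+\<xi>. b \<xi> \<partial>?\<sigma>) * subsphere_mass TYPE('a) < \<infinity>" by (simp add: nn_integral_multc)
    then have f: "(\<integral>\<^sup>+\<xi>. b \<xi> \<partial>?\<sigma>) \<noteq> \<infinity>"
      using subsphere_mass_nonzero[OF \<xi>0 n] by (auto simp: ennreal_top_mult)
    have "emeasure \<mu> (space \<mu>) = (\<integral>\<^sup>+\<xi>. b \<xi> * indicator (sphere 0 1) \<xi> \<partial>?\<sigma>)"
      using em[OF sets.top] space_\<mu> by simp
    also have "\<dots> \<le> (\<integral>\<^sup>+\<xi>. b \<xi> \<partial>?\<sigma>)" by (intro nn_integral_mono) (auto simp: indicator_def)
    finally show ?thesis using f by (auto simp: top_unique)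
  qed
  interpret \<mu>: finite_measure \<mu> by (rule finite_measureI[OF fin_\<mu>])
  have "even_finite_sphere_measure \<mu>"
    unfolding even_finite_sphere_measure_def
  proof (intro conjI ballI)
    fix A assume A: "A \<in> sets \<mu>"
    then have A1: "A \<in> sets borel" "A \<subseteq> sphere 0 1" unfolding sets_\<mu> by (auto simp: sets_restrict_space_iff)
    have "uminus ` A = uminus -` A \<inter> space borel" by (auto intro: image_eqI[of _ _ "- x" for x])
    also have "\<dots> \<in> sets borel" by (rule measurable_sets[OF _ A1(1)]) auto
    finally have mA: "uminus ` A \<in> sets \<mu>" using A1(2) unfolding sets_\<mu> by (subst sets_restrict_space_iff) auto
    have "emeasure \<mu> (uminus ` A) = (\<integral>\<^sup>+\<xi>. b (- \<xi>) * indicator A (- \<xi>) \<partial>?\<sigma>)"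
    proof -
      have "indicator (uminus ` A) \<xi> = (indicator A (- \<xi>) :: ennreal)" for \<xi>
        by (auto simp: indicator_def image_iff) (metis minus_minus)
      then show ?thesis by (simp add: em[OF mA] even)
    qed
    also have "\<dots> = (\<integral>\<^sup>+\<xi>. b \<xi> * indicator A \<xi> \<partial>?\<sigma>)"
      using A1(1) by (intro surface_measure_uminus) auto
    finally show "emeasure \<mu> (uminus ` A) = emeasure \<mu> A" by (simp add: em[OF A])
  qed (use sets_\<mu> space_\<mu> \<mu>.finite_measure_axioms in auto)
  moreover have "(LINT \<xi>|?S. radial_fun K \<xi> * g \<xi>) = (LINT \<xi>|\<mu>. spherical_radon g \<xi>)"
    if g: "continuous_on (sphere 0 1) g" for g
  proof -
    \<comment> \<open>For nonnegative h both integrals exist and have the same value x. Existence is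
      part of the claim so that two such identities can be subtracted.\<close>
    have main: "\<exists>x. has_bochner_integral ?S (\<lambda>\<xi>. radial_fun K \<xi> * h \<xi>) x \<and> has_bochner_integral \<mu> (spherical_radon h) x"
      if h [measurable]: "h \<in> borel_measurable borel" and h0: "\<And>x. h x \<ge> 0" and hc: "continuous_on (sphere 0 1) h"
      for h :: "'a \<Rightarrow> real"
    proof -
      obtain C where C: "C \<ge> 0" "\<And>x. norm x = 1 \<Longrightarrow> \<bar>h x\<bar> \<le> C" using bounded_on_sphere[OF hc] by blast
      have "(\<integral>\<^sup>+\<xi>. h \<xi> * radon b \<xi> \<partial>?\<sigma>) \<le> (\<integral>\<^sup>+\<xi>. ennreal C * radon b \<xi> \<partial>?\<sigma>)"
        by (rule nn_integral_mono_AE, use AE_surface_measure in eventually_elim)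
          (use C in \<open>force intro!: mult_right_mono ennreal_leI\<close>)
      then have "(\<integral>\<^sup>+\<xi>. h \<xi> * radon b \<xi> \<partial>?\<sigma>) < \<infinity>" using fin_r[of C] by (rule order_le_less_trans)
      then obtain x where x: "(\<integral>\<^sup>+\<xi>. h \<xi> * radon b \<xi> \<partial>?\<sigma>) = ennreal x" "x \<ge> 0"
        by (cases "\<integral>\<^sup>+\<xi>. h \<xi> * radon b \<xi> \<partial>?\<sigma>") auto
      have "has_bochner_integral ?S (\<lambda>\<xi>. r \<xi> * h \<xi>) x"
      proof (rule has_bochner_integral_nn_integral)
        have "(\<integral>\<^sup>+\<xi>. ennreal (r \<xi> * h \<xi>) \<partial>?S) = (\<integral>\<^sup>+\<xi>. ennreal (r \<xi> * h \<xi>) \<partial>?\<sigma>)"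
          by (rule nn_integral_sphere_measure_UNIV) auto
        also have "\<dots> = (\<integral>\<^sup>+\<xi>. h \<xi> * radon b \<xi> \<partial>?\<sigma>)"
          by (rule nn_integral_cong_AE, use AE_surface_measure in eventually_elim)
            (simp add: r h0 r0 ennreal_mult mult.commute)
        finally show "(\<integral>\<^sup>+\<xi>. ennreal (r \<xi> * h \<xi>) \<partial>?S) = ennreal x" using x by simp
      qed (use x h0 r0 in \<open>auto intro: measurable_sphere_measure\<close>)
      then have 1: "has_bochner_integral ?S (\<lambda>\<xi>. radial_fun K \<xi> * h \<xi>) x"
        by (rule has_bochner_integral_cong[THEN iffD1, rotated -1]) (auto simp: space_sphere_measure r)
      have sr: "spherical_radon h \<xi> = enn2real (radon h \<xi>)" "radon h \<xi> = ennreal (enn2real (radon h \<xi>))"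
        if \<xi>: "norm \<xi> = 1" for \<xi>
      proof -
        show "spherical_radon h \<xi> = enn2real (radon h \<xi>)"
          unfolding radon_def spherical_radon_eq[OF h \<xi>] using h0
          by (intro integral_eq_nn_integral) (auto cong: measurable_cong_sets[OF sets_subsphere_measure refl])
        have "radon h \<xi> \<le> (\<integral>\<^sup>+\<eta>. ennreal C \<partial>subsphere_measure \<xi>)"
          unfolding radon_def
          by (rule nn_integral_mono_AE, use AE_subsphere_measure[OF \<xi>] in eventually_elim)
            (use C in \<open>force intro: ennreal_leI\<close>)
        also have "\<dots> < \<infinity>" using emeasure_subsphere_measure[OF \<xi> n] subsphere_mass_finite[OF \<xi> n]
          by (simp add: ennreal_mult_eq_top_iff less_top[symmetric])
        finally show "radon h \<xi> = ennreal (enn2real (radon h \<xi>))" by simp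
      qed
      have "has_bochner_integral \<mu> (\<lambda>\<xi>. enn2real (radon h \<xi>)) x"
      proof (rule has_bochner_integral_nn_integral)
        have "(\<integral>\<^sup>+\<xi>. ennreal (enn2real (radon h \<xi>)) \<partial>\<mu>) = (\<integral>\<^sup>+\<xi>. b \<xi> * ennreal (enn2real (radon h \<xi>)) \<partial>?\<sigma>)"
          by (rule nn_\<mu>) auto
        also have "\<dots> = (\<integral>\<^sup>+\<xi>. b \<xi> * radon h \<xi> \<partial>?\<sigma>)"
          by (rule nn_integral_cong_AE, use AE_surface_measure in eventually_elim) (simp flip: sr(2))
        also have "\<dots> = (\<integral>\<^sup>+\<xi>. h \<xi> * radon b \<xi> \<partial>?\<sigma>)" by (rule dual[OF h h0 hc])
        finally show "(\<integral>\<^sup>+\<xi>. ennreal (enn2real (radon h \<xi>)) \<partial>\<mu>) = ennreal x" using x by simp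
        have "(\<lambda>\<xi>. enn2real (radon h \<xi>)) \<in> borel_measurable borel" by measurable
        then show "(\<lambda>\<xi>. enn2real (radon h \<xi>)) \<in> borel_measurable \<mu>"
          unfolding \<mu>_def by (simp add: measurable_sphere_measure)
      qed (use x in auto)
      then have "has_bochner_integral \<mu> (spherical_radon h) x"
        by (rule has_bochner_integral_cong[THEN iffD1, rotated -1]) (auto simp: space_\<mu> sr(1))
      with 1 show ?thesis by blast
    qed
    obtain C where C: "C \<ge> 0" "\<And>x. norm x = 1 \<Longrightarrow> \<bar>g x\<bar> \<le> C" using bounded_on_sphere[OF g] by blast
    \<comment> \<open>Adding C makes g nonnegative on the sphere. Off the sphere g is unconstrained
      and perhaps not measurable, so h is 0 there.\<close>
    define h where "h x = (if x \<in> sphere 0 1 then g x + C else 0)" for x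
    have gC: "continuous_on (sphere 0 1) (\<lambda>x. g x + C)" using g by (intro continuous_intros)
    have h_meas [measurable]: "h \<in> borel_measurable borel"
      using borel_measurable_sphere_extension[OF gC] unfolding h_def .
    have h0: "h x \<ge> 0" for x using C(2)[of x] by (auto simp: h_def abs_le_iff)
    have hc: "continuous_on (sphere 0 1) h"
      using gC by (rule continuous_on_cong[THEN iffD1, rotated -1]) (auto simp: h_def)
    obtain x where x: "has_bochner_integral ?S (\<lambda>\<xi>. radial_fun K \<xi> * h \<xi>) x" "has_bochner_integral \<mu> (spherical_radon h) x"
      using main[OF h_meas h0 hc] by blast
    obtain y where y: "has_bochner_integral ?S (\<lambda>\<xi>. radial_fun K \<xi> * C) y" "has_bochner_integral \<mu> (spherical_radon (\<lambda>_. C)) y"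
      using main[of "\<lambda>_. C"] C(1) by auto
    have "(LINT \<xi>|?S. radial_fun K \<xi> * g \<xi>) = (LINT \<xi>|?S. radial_fun K \<xi> * h \<xi> - radial_fun K \<xi> * C)"
      by (rule Bochner_Integration.integral_cong) (auto simp: space_sphere_measure h_def algebra_simps)
    also have "\<dots> = x - y" by (rule has_bochner_integral_integral_eq[OF has_bochner_integral_diff[OF x(1) y(1)]])
    also have "\<dots> = (LINT \<xi>|\<mu>. spherical_radon h \<xi> - spherical_radon (\<lambda>_. C) \<xi>)"
      by (rule has_bochner_integral_integral_eq[OF has_bochner_integral_diff[OF x(2) y(2)], symmetric])
    also have "\<dots> = (LINT \<xi>|\<mu>. spherical_radon g \<xi>)"
    proof (rule Bochner_Integration.integral_cong[OF refl])
      fix \<xi> assume "\<xi> \<in> space \<mu>"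
      then have \<xi>: "norm \<xi> = 1" by (simp add: space_\<mu>)
      interpret V: finite_measure "subsphere_measure \<xi>" by (rule finite_subsphere_measure[OF \<xi> n])
      have int: "integrable (subsphere_measure \<xi>) f" if f: "f \<in> borel_measurable borel" and "\<And>x. norm x = 1 \<Longrightarrow> \<bar>f x\<bar> \<le> D" for f :: "'a \<Rightarrow> real" and D :: real
        by (rule V.integrable_const_bound[of _ D])
          (use AE_subsphere_measure[OF \<xi>] that in \<open>auto elim: eventually_mono cong: measurable_cong_sets[OF sets_subsphere_measure refl]\<close>)
      have "spherical_radon h \<xi> - spherical_radon (\<lambda>_. C) \<xi> = (LINT \<eta>|subsphere_measure \<xi>. h \<eta> - C)"
      proof -
        have "\<bar>h x\<bar> \<le> 2 * C" if "norm x = 1" for x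
          using C(2)[OF that] h0[of x] that by (simp add: h_def abs_le_iff)
        then have "integrable (subsphere_measure \<xi>) h" by (rule int[OF h_meas])
        moreover have "integrable (subsphere_measure \<xi>) (\<lambda>_. C)" by (rule int[of _ C]) (use C in auto)
        ultimately show ?thesis
          unfolding spherical_radon_eq[OF h_meas \<xi>] spherical_radon_eq[OF borel_measurable_const \<xi>]
          by (rule Bochner_Integration.integral_diff[symmetric])
      qed
      also have "\<dots> = spherical_radon (\<lambda>\<eta>. h \<eta> - C) \<xi>" by (rule spherical_radon_eq[symmetric]) (use \<xi> in auto)
      also have "\<dots> = spherical_radon g \<xi>"
        unfolding spherical_radon_def
        by (rule Bochner_Integration.integral_cong) (auto simp: space_sphere_measure h_def)
      finally show "spherical_radon h \<xi> - spherical_radon (\<lambda>_. C) \<xi> = spherical_radon g \<xi>" .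
    qed
    finally show ?thesis .
  qed
  ultimately show ?thesis unfolding intersection_body_def using K by blast
qed

text \<open>The obstruction used in high dimensions: a continuous g with nonnegative Radon transform
  tests every candidate measure at once.\<close>

lemma intersection_body_pairing_nonneg:
  fixes K :: "'a::euclidean_space set"
  assumes "intersection_body K" "continuous_on (sphere 0 1) g"
    and "\<And>\<xi>. norm \<xi> = 1 \<Longrightarrow> spherical_radon g \<xi> \<ge> 0"
  shows "(LINT \<xi>|sphere_measure UNIV. radial_fun K \<xi> * g \<xi>) \<ge> 0"
proof -
  obtain \<mu> where \<mu>: "even_finite_sphere_measure \<mu>"
    "(LINT \<xi>|sphere_measure UNIV. radial_fun K \<xi> * g \<xi>) = (LINT \<xi>|\<mu>. spherical_radon g \<xi>)"
    using assms(1,2) unfolding intersection_body_def by blast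
  have "(LINT \<xi>|\<mu>. spherical_radon g \<xi>) \<ge> 0"
    using \<mu>(1) assms(3) by (intro Bochner_Integration.integral_nonneg) (auto simp: even_finite_sphere_measure_def)
  with \<mu>(2) show ?thesis by simp
qed

section \<open>The body and its density in dimension 6\<close>

text \<open>The argument u is the cosine of the angle between the direction and the axis. The
  branches meet at 45 degrees with common value sqrt 2.\<close>

definition Z_radius :: "real \<Rightarrow> real" where
  "Z_radius u = (if u\<^sup>2 \<ge> 1/2 then 1 / \<bar>u\<bar> else 2 * sqrt (1 - u\<^sup>2))"

lemma Z_radius_nonneg: "\<bar>u\<bar> \<le> 1 \<Longrightarrow> 0 \<le> Z_radius u"
  by (simp add: Z_radius_def abs_square_le_1)

lemma inner_axis_one: "x \<bullet> axis k 1 = (x $ k :: real)"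
  by (simp add: inner_axis)

lemma component_le_norm: "norm \<xi> = 1 \<Longrightarrow> \<bar>\<xi> $ k\<bar> \<le> 1" for \<xi> :: "real^'n"
  using component_le_norm_cart[of \<xi> k] by simp

lemma ball_sum_iff: "x \<in> ball_sum k \<longleftrightarrow> (\<exists>p q. x = p + q \<and> norm p \<le> 1 \<and> norm q \<le> 1 \<and> q $ k = 0)"
  unfolding ball_sum_def set_plus_def by (simp add: Bex_def) blast

text \<open>A point is in the body if its height is at most 1 and its distance from the axis at most
  1 plus the half-width of the unit disc at that height. Within 45 degrees of the axis the height
  decides. Otherwise the boundary is a unit circle through the origin with centre on the equator,
  whose chord in direction \<xi> has length 2 r.\<close>

lemma ball_sum_radius:
  fixes \<xi> :: "real^'n"
  assumes \<xi>: "norm \<xi> = 1"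
  shows "a *\<^sub>R \<xi> \<in> ball_sum k \<longleftrightarrow> \<bar>a\<bar> \<le> Z_radius (\<xi> $ k)"
proof -
  let ?e = "axis k 1 :: real^'n"
  define u where "u = \<xi> $ k"
  define r where "r = sqrt (1 - u\<^sup>2)"
  define \<xi>' where "\<xi>' = hyperplane_proj ?e \<xi>"
  have e: "norm ?e = 1" by simp
  have u1: "u\<^sup>2 \<le> 1" using component_le_norm[OF \<xi>, of k] by (simp add: u_def abs_square_le_1)
  have r: "r \<ge> 0" "r\<^sup>2 = 1 - u\<^sup>2" using u1 by (auto simp: r_def)
  have \<xi>_eq: "\<xi> = u *\<^sub>R ?e + \<xi>'" by (simp add: \<xi>'_def hyperplane_proj_def u_def inner_axis_one)
  have \<xi>'e: "\<xi>' \<bullet> ?e = 0" unfolding \<xi>'_def by (rule hyperplane_proj_inner[OF e])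
  have \<xi>'k: "\<xi>' $ k = 0" using \<xi>'e by (simp add: inner_axis_one)
  have norm2: "(norm (s *\<^sub>R ?e + t *\<^sub>R y))\<^sup>2 = s\<^sup>2 + t\<^sup>2 * (norm y)\<^sup>2" if "y \<bullet> ?e = 0" for s t and y :: "real^'n"
    using that by (subst norm_add_Pythagorean) (auto simp: orthogonal_def inner_commute power_mult_distrib)
  have "(norm \<xi>)\<^sup>2 = u\<^sup>2 + (norm \<xi>')\<^sup>2" using norm2[OF \<xi>'e, of u 1] \<xi>_eq by simp
  then have "(norm \<xi>')\<^sup>2 = r\<^sup>2" using \<xi> r by simp
  then have n\<xi>': "norm \<xi>' = r" by (rule power2_eq_imp_eq) (use r in auto)
  have mem: "a *\<^sub>R \<xi> \<in> ball_sum k \<longleftrightarrow> \<bar>a\<bar> * \<bar>u\<bar> \<le> 1 \<and> \<bar>a\<bar> * r \<le> 1 + sqrt (1 - (a * u)\<^sup>2)"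
  proof
    assume "a *\<^sub>R \<xi> \<in> ball_sum k"
    then obtain p q where pq: "a *\<^sub>R \<xi> = p + q" "norm p \<le> 1" "norm q \<le> 1" "q $ k = 0"
      unfolding ball_sum_iff by blast
    have pk: "p $ k = a * u" using arg_cong[OF pq(1), of "\<lambda>x. x $ k"] pq(4) by (simp add: u_def)
    have p_eq: "p = (a * u) *\<^sub>R ?e + hyperplane_proj ?e p" by (simp add: hyperplane_proj_def pk inner_axis_one)
    have "(norm p)\<^sup>2 = (a * u)\<^sup>2 + (norm (hyperplane_proj ?e p))\<^sup>2"
      using norm2[OF hyperplane_proj_inner[OF e], of "a * u" 1 p] p_eq by simp
    moreover have "(norm p)\<^sup>2 \<le> 1" using pq(2) by (simp add: abs_square_le_1)
    ultimately have le: "(a * u)\<^sup>2 + (norm (hyperplane_proj ?e p))\<^sup>2 \<le> 1" by simp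
    then have "(a * u)\<^sup>2 \<le> 1" by (smt (verit) zero_le_power2)
    then have 1: "\<bar>a\<bar> * \<bar>u\<bar> \<le> 1" by (simp add: abs_square_le_1 flip: abs_mult)
    have "a *\<^sub>R \<xi>' = hyperplane_proj ?e (a *\<^sub>R \<xi>)" by (simp add: \<xi>'_def hyperplane_proj_scaleR)
    also have "\<dots> = hyperplane_proj ?e p + q"
      unfolding pq(1) hyperplane_proj_add using pq(4) by (simp add: hyperplane_proj_def[of _ q] inner_axis_one)
    finally have "\<bar>a\<bar> * r \<le> norm (hyperplane_proj ?e p) + norm q"
      using norm_triangle_ineq[of "hyperplane_proj ?e p" q] n\<xi>' by (metis norm_scaleR)
    moreover have "norm (hyperplane_proj ?e p) \<le> sqrt (1 - (a * u)\<^sup>2)"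
      using le by (intro real_le_rsqrt) simp
    ultimately show "\<bar>a\<bar> * \<bar>u\<bar> \<le> 1 \<and> \<bar>a\<bar> * r \<le> 1 + sqrt (1 - (a * u)\<^sup>2)" using 1 pq(3) by simp
  next
    assume *: "\<bar>a\<bar> * \<bar>u\<bar> \<le> 1 \<and> \<bar>a\<bar> * r \<le> 1 + sqrt (1 - (a * u)\<^sup>2)"
    then have au: "(a * u)\<^sup>2 \<le> 1" by (simp add: abs_square_le_1 abs_mult)
    \<comment> \<open>c says how much of the horizontal part is taken from the flat ball.\<close>
    have in_sum: "a *\<^sub>R \<xi> \<in> ball_sum k" if "\<bar>c\<bar> * r \<le> 1" "(a * u)\<^sup>2 + (a - c)\<^sup>2 * r\<^sup>2 \<le> 1" for c
    proof -
      have "a *\<^sub>R \<xi> = ((a * u) *\<^sub>R ?e + (a - c) *\<^sub>R \<xi>') + c *\<^sub>R \<xi>'"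
        using \<xi>_eq by (simp add: algebra_simps)
      moreover have "norm (c *\<^sub>R \<xi>') \<le> 1" "(c *\<^sub>R \<xi>') $ k = 0" using that n\<xi>' \<xi>'k by auto
      moreover have "norm ((a * u) *\<^sub>R ?e + (a - c) *\<^sub>R \<xi>') \<le> 1"
        using norm2[OF \<xi>'e, of "a * u" "a - c"] that n\<xi>'
          abs_square_le_1[of "norm ((a * u) *\<^sub>R ?e + (a - c) *\<^sub>R \<xi>')"] by simp
      ultimately show ?thesis unfolding ball_sum_iff by blast
    qed
    show "a *\<^sub>R \<xi> \<in> ball_sum k"
    proof (cases "\<bar>a\<bar> * r \<le> 1")
      case True
      then show ?thesis using in_sum[of a] au by simp
    next
      case False
      then have a0: "a \<noteq> 0" by auto
      have r0: "r > 0" using False r(1) by (cases "r = 0") auto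
      have "(\<bar>a\<bar> * r - 1)\<^sup>2 \<le> (sqrt (1 - (a * u)\<^sup>2))\<^sup>2" using * False by (intro power_mono) auto
      then have "(\<bar>a\<bar> * r - 1)\<^sup>2 \<le> 1 - (a * u)\<^sup>2" using au by simp
      \<comment> \<open>With c = \<open>sgn a / r\<close> the flat summand has length 1, the
        farthest that the flat ball reaches.\<close>
      moreover have "(a - sgn a / r)\<^sup>2 * r\<^sup>2 = (\<bar>a\<bar> * r - 1)\<^sup>2"
      proof -
        have "(a - sgn a / r) * r = sgn a * (\<bar>a\<bar> * r - 1)"
          using r0 by (simp add: left_diff_distrib right_diff_distrib mult.assoc[symmetric] sgn_mult_abs)
        then have "(a - sgn a / r)\<^sup>2 * r\<^sup>2 = (sgn a)\<^sup>2 * (\<bar>a\<bar> * r - 1)\<^sup>2"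
          by (metis power_mult_distrib)
        also have "(sgn a)\<^sup>2 = 1" using a0 by (simp add: sgn_if)
        finally show ?thesis by simp
      qed
      ultimately have "(a * u)\<^sup>2 + (a - sgn a / r)\<^sup>2 * r\<^sup>2 \<le> 1" by simp
      moreover have "\<bar>sgn a / r\<bar> * r \<le> 1" using r0 a0 by (simp add: abs_sgn_eq)
      ultimately show ?thesis by (intro in_sum[of "sgn a / r"])
    qed
  qed
  show ?thesis
  proof (cases "u\<^sup>2 \<ge> 1/2")
    case True
    have u0: "u \<noteq> 0" using True by auto
    have "\<bar>a\<bar> * r \<le> 1 + sqrt (1 - (a * u)\<^sup>2)" if "\<bar>a\<bar> * \<bar>u\<bar> \<le> 1"
    proof -
      \<comment> \<open>Near the axis the horizontal part is no longer than the height, hence at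
        most 1, and the second condition holds by itself.\<close>
      have "r \<le> \<bar>u\<bar>" by (rule power2_le_imp_le) (use r True in auto)
      then have "\<bar>a\<bar> * r \<le> \<bar>a\<bar> * \<bar>u\<bar>" by (rule mult_left_mono) simp
      moreover have "(a * u)\<^sup>2 \<le> 1" using that by (simp add: abs_square_le_1 abs_mult)
      ultimately show ?thesis using that by (smt (verit) real_sqrt_ge_zero)
    qed
    moreover have "\<bar>a\<bar> * \<bar>u\<bar> \<le> 1 \<longleftrightarrow> \<bar>a\<bar> \<le> 1 / \<bar>u\<bar>" using u0 by (simp add: pos_le_divide_eq)
    ultimately show ?thesis unfolding mem using True by (auto simp: Z_radius_def u_def)
  next
    case False
    have r12: "r\<^sup>2 > 1/2" using r False by simp
    then have r0: "r > 0" using r(1) by (cases "r = 0") auto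
    have "\<bar>a\<bar> * \<bar>u\<bar> \<le> 1 \<and> \<bar>a\<bar> * r \<le> 1 + sqrt (1 - (a * u)\<^sup>2)" if a: "\<bar>a\<bar> \<le> 2 * r"
    proof
      have "\<bar>a\<bar> * \<bar>u\<bar> \<le> 2 * r * \<bar>u\<bar>" using a by (intro mult_right_mono) auto
      also have "\<dots> \<le> r\<^sup>2 + \<bar>u\<bar>\<^sup>2" using sum_squares_bound[of r "\<bar>u\<bar>"] by simp
      also have "\<dots> = 1" using r by simp
      finally show au: "\<bar>a\<bar> * \<bar>u\<bar> \<le> 1" .
      have "\<bar>a\<bar> * \<bar>a\<bar> \<le> \<bar>a\<bar> * (2 * r)" using a by (intro mult_left_mono) auto
      then have "(\<bar>a\<bar> * r - 1)\<^sup>2 \<le> 1 - (a * u)\<^sup>2"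
      proof -
        have "(\<bar>a\<bar> * r - 1)\<^sup>2 - (1 - (a * u)\<^sup>2) = a\<^sup>2 * (r\<^sup>2 + u\<^sup>2) - \<bar>a\<bar> * (2 * r)"
          by (simp add: power2_diff power_mult_distrib algebra_simps)
        also have "\<dots> = \<bar>a\<bar> * \<bar>a\<bar> - \<bar>a\<bar> * (2 * r)" using r(2) by (simp add: power2_eq_square)
        finally show ?thesis using \<open>\<bar>a\<bar> * \<bar>a\<bar> \<le> \<bar>a\<bar> * (2 * r)\<close> by linarith
      qed
      then show "\<bar>a\<bar> * r \<le> 1 + sqrt (1 - (a * u)\<^sup>2)"
        using real_le_rsqrt by fastforce
    qed
    moreover have "\<bar>a\<bar> \<le> 2 * r" if *: "\<bar>a\<bar> * \<bar>u\<bar> \<le> 1" "\<bar>a\<bar> * r \<le> 1 + sqrt (1 - (a * u)\<^sup>2)"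
    proof (cases "\<bar>a\<bar> * r \<le> 1")
      case True
      then have "\<bar>a\<bar> * r \<le> 2 * r * r" using r12 by (simp add: power2_eq_square)
      then show ?thesis using r0 by simp
    next
      case False
      have "(a * u)\<^sup>2 \<le> 1" using *(1) by (simp add: abs_square_le_1 abs_mult)
      moreover have "(\<bar>a\<bar> * r - 1)\<^sup>2 \<le> (sqrt (1 - (a * u)\<^sup>2))\<^sup>2" using * False by (intro power_mono) auto
      ultimately have "(\<bar>a\<bar> * r - 1)\<^sup>2 \<le> 1 - (a * u)\<^sup>2" by simp
      then have "a\<^sup>2 * (r\<^sup>2 + u\<^sup>2) \<le> 2 * \<bar>a\<bar> * r"
        by (simp add: power2_diff power_mult_distrib algebra_simps)
      then have "\<bar>a\<bar> * \<bar>a\<bar> \<le> \<bar>a\<bar> * (2 * r)" using r(2) by (simp add: power2_eq_square mult_ac)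
      moreover have "\<bar>a\<bar> > 0" using False by auto
      ultimately show ?thesis by (rule mult_left_le_imp_le)
    qed
    ultimately show ?thesis unfolding mem using False by (auto simp: Z_radius_def u_def r_def)
  qed
qed

lemma radial_fun_ball_sum:
  fixes \<xi> :: "real^'n"
  assumes "norm \<xi> = 1"
  shows "radial_fun (ball_sum k) \<xi> = Z_radius (\<xi> $ k)"
  unfolding radial_fun_def ball_sum_radius[OF assms]
  by (rule Greatest_equality) (use Z_radius_nonneg[OF component_le_norm[OF assms, of k]] in auto)

text \<open>Clamping each branch at u^2 = 1/2 makes it continuous everywhere. At every u one of the
  two clamped branches has the value sqrt 2, which is subtracted.\<close>

lemma continuous_on_Z_radius: "continuous_on A Z_radius"
proof -
  have "Z_radius u = 1 / max \<bar>u\<bar> (sqrt (1/2)) + 2 * sqrt (1 - min (u\<^sup>2) (1/2)) - sqrt 2" for u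
  proof -
    have "\<bar>u\<bar> \<ge> sqrt (1/2) \<longleftrightarrow> u\<^sup>2 \<ge> 1/2"
      by (metis real_sqrt_abs real_sqrt_le_iff)
    moreover have "2 * sqrt (1/2) = sqrt 2" "1 / sqrt (1/2) = sqrt 2"
      by (simp_all add: real_sqrt_divide real_div_sqrt)
    ultimately show ?thesis
      by (cases "u\<^sup>2 \<ge> 1/2") (simp_all add: Z_radius_def max.absorb1 max.absorb2 min.absorb1 min.absorb2 not_le less_imp_le)
  qed
  then have eq: "Z_radius = (\<lambda>u. 1 / max \<bar>u\<bar> (sqrt (1/2)) + 2 * sqrt (1 - min (u\<^sup>2) (1/2)) - sqrt 2)"
    by (rule ext)
  have "max \<bar>u\<bar> (sqrt (1/2)) \<noteq> 0" for u :: real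
    using real_sqrt_gt_zero[of "1/2"] by (auto simp: max_def)
  then show ?thesis unfolding eq by (intro continuous_intros) auto
qed

lemma star_body_ball_sum: "star_body (ball_sum k :: (real^'n) set)"
proof -
  let ?D = "{y \<in> cball 0 1. y $ k = 0} :: (real^'n) set"
  have D: "?D = cball 0 1 \<inter> {y. axis k 1 \<bullet> y = 0}"
    by (auto simp: inner_axis_one inner_commute[of "axis k 1"])
  have cD: "compact ?D" "convex ?D"
    unfolding D by (auto intro!: compact_Int_closed closed_hyperplane convex_Int convex_hyperplane)
  have eq: "ball_sum k = {x + y | x y. x \<in> cball 0 1 \<and> y \<in> ?D}"
    unfolding ball_sum_def set_plus_def by blast
  have comp: "compact (ball_sum k :: (real^'n) set)"
    unfolding eq by (rule compact_sums[OF compact_cball cD(1)])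
  have conv: "convex (ball_sum k :: (real^'n) set)"
    unfolding ball_sum_def using cD by (intro convex_set_plus) auto
  have sub: "cball 0 1 \<subseteq> (ball_sum k :: (real^'n) set)"
  proof
    fix x :: "real^'n" assume "x \<in> cball 0 1"
    then show "x \<in> ball_sum k" unfolding ball_sum_iff by (intro exI[of _ x] exI[of _ 0]) auto
  qed
  have "0 \<in> interior (ball_sum k :: (real^'n) set)"
    using interior_mono[OF sub] by (auto simp: interior_cball)
  moreover have "closed_segment 0 x \<subseteq> ball_sum k" if "x \<in> ball_sum k" for x :: "real^'n"
    using that conv sub by (intro closed_segment_subset) auto
  moreover have "continuous_on (sphere 0 1) (radial_fun (ball_sum k :: (real^'n) set))"
  proof -
    have "continuous_on (sphere 0 1) (\<lambda>\<xi>::real^'n. Z_radius (\<xi> $ k))"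
      by (intro continuous_on_compose2[OF continuous_on_Z_radius[of UNIV]] continuous_intros) auto
    then show ?thesis
      by (rule continuous_on_cong[THEN iffD1, rotated -1]) (auto simp: radial_fun_ball_sum)
  qed
  ultimately show ?thesis using comp by (simp add: star_body_def)
qed

lemma origin_symmetric_ball_sum: "origin_symmetric (ball_sum k :: (real^'n) set)"
proof -
  have "- x \<in> ball_sum k" if "x \<in> ball_sum k" for x :: "real^'n"
  proof -
    obtain p q where "x = p + q" "norm p \<le> 1" "norm q \<le> 1" "q $ k = 0"
      using \<open>x \<in> ball_sum k\<close> unfolding ball_sum_def set_plus_def by auto
    then have "- p \<in> cball 0 1" "- q \<in> {y \<in> cball 0 1. y $ k = 0}" "- x = - p + - q" by auto
    then show ?thesis unfolding ball_sum_def set_plus_def by blast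
  qed
  then show ?thesis unfolding origin_symmetric_def by (auto intro: image_eqI[of _ _ "- x" for x])
qed

text \<open>For n = 6 and v = r^2 the equation says that G(v) is the integral of (r^2 - s^2) f(s)
  over 0 \<le> s \<le> r. Two derivatives in v give f(s) = 2 s G''(s^2). As G(v) is v^(3/2) / sqrt
  (1 - v) up to v = 1/2 and 2 v^2 beyond, the two branches result; they disagree at the break
  point.\<close>

definition density6 :: "real \<Rightarrow> real" where
  "density6 u = (if u\<^sup>2 \<le> 1/2 then 3 / (2 * sqrt (1 - u\<^sup>2) ^ 5) else 8 * \<bar>u\<bar>)"

lemma measurable_density6 [measurable]: "density6 \<in> borel_measurable borel"
  unfolding density6_def by measurable

lemma density6_nonneg: "density6 u \<ge> 0"
  by (simp add: density6_def)

lemma density6_minus: "density6 (- u) = density6 u"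
  by (simp add: density6_def)

lemma nn_integral_even_interval:
  fixes h :: "real \<Rightarrow> ennreal"
  assumes [measurable]: "h \<in> borel_measurable borel" and even: "\<And>t. h (- t) = h t"
  shows "(\<integral>\<^sup>+t. indicator {-1<..<1} t * h t \<partial>lborel) = 2 * (\<integral>\<^sup>+t. h t * indicator {0..1} t \<partial>lborel)"
proof -
  have "(\<integral>\<^sup>+t. indicator {-1<..<1} t * h t \<partial>lborel) = (\<integral>\<^sup>+t. h t * indicator {0..1} t + h t * indicator {0..1} (- t) \<partial>lborel)"
  proof (rule nn_integral_cong_AE)
    show "AE t in lborel. indicator {-1<..<1} t * h t = h t * indicator {0..1} t + h t * indicator {0..1} (- t)"
      using AE_lborel_singleton[of 0] AE_lborel_singleton[of 1] AE_lborel_singleton[of "-1"]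
      by eventually_elim (auto simp: indicator_def)
  qed
  also have "\<dots> = (\<integral>\<^sup>+t. h t * indicator {0..1} t \<partial>lborel) + (\<integral>\<^sup>+t. h t * indicator {0..1} (- t) \<partial>lborel)"
    by (rule nn_integral_add) measurable
  also have "(\<integral>\<^sup>+t. h t * indicator {0..1} (- t) \<partial>lborel) = (\<integral>\<^sup>+t. h t * indicator {0..1} t \<partial>lborel)"
    by (subst nn_integral_real_affine[where c = "-1" and t = 0]) (auto simp: even)
  finally show ?thesis by (simp add: mult_2)
qed

text \<open>With s^2 = 1 - r^2 t^2 one has 1 - t^2 = s^2 - (1 - r^2) t^2. The integrand is thus a
  combination of D' = 1 / s^3 and D^2 D'.\<close>

lemma density6_antiderivative:
  fixes r t :: real
  assumes "r\<^sup>2 * t\<^sup>2 < 1"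
  defines "D \<equiv> \<lambda>t. t / sqrt (1 - r\<^sup>2 * t\<^sup>2)"
  shows "((\<lambda>t. 3/2 * (D t - (1 - r\<^sup>2) * D t ^ 3 / 3)) has_real_derivative
    3 / (2 * sqrt (1 - (r * t)\<^sup>2) ^ 5) * (1 - t\<^sup>2)) (at t)"
proof -
  define s where "s = sqrt (1 - r\<^sup>2 * t\<^sup>2)"
  have s: "s > 0" "s\<^sup>2 = 1 - r\<^sup>2 * t\<^sup>2" using assms(1) by (auto simp: s_def)
  have "(D has_real_derivative (s - t * (- (r\<^sup>2 * t) / s)) / (s * s)) (at t)"
    unfolding D_def s_def using assms(1)
    by (auto intro!: derivative_eq_intros simp: field_simps)
  also have "(s - t * (- (r\<^sup>2 * t) / s)) / (s * s) = 1 / s ^ 3"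
  proof -
    have "s - t * (- (r\<^sup>2 * t) / s) = (s\<^sup>2 + r\<^sup>2 * t\<^sup>2) / s" using s(1) by (simp add: field_simps power2_eq_square)
    also have "\<dots> = 1 / s" using s(2) by simp
    finally show ?thesis by (simp add: power3_eq_cube)
  qed
  finally have D': "(D has_real_derivative 1 / s ^ 3) (at t)" .
  have "((\<lambda>t. 3/2 * (D t - (1 - r\<^sup>2) * D t ^ 3 / 3)) has_real_derivative
    3/2 * (1 / s ^ 3 - (1 - r\<^sup>2) * (3 * D t ^ 2 * (1 / s ^ 3)) / 3)) (at t)"
    by (auto intro!: derivative_eq_intros D')
  also have "3/2 * (1 / s ^ 3 - (1 - r\<^sup>2) * (3 * D t ^ 2 * (1 / s ^ 3)) / 3) = 3 / (2 * s ^ 5) * (s\<^sup>2 - (1 - r\<^sup>2) * t\<^sup>2)"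
  proof -
    have Dt: "D t = t / s" by (simp add: D_def s_def)
    show ?thesis unfolding Dt using s(1) by (simp add: power_divide field_simps power2_eq_square numeral_eq_Suc)
  qed
  also have "s\<^sup>2 - (1 - r\<^sup>2) * t\<^sup>2 = 1 - t\<^sup>2" using s(2) by (simp add: algebra_simps)
  also have "s = sqrt (1 - (r * t)\<^sup>2)" by (simp add: s_def power_mult_distrib)
  finally show ?thesis .
qed

lemma nn_integral_density6_half:
  assumes r: "0 \<le> r" "r \<le> 1"
  shows "(\<integral>\<^sup>+t. ennreal (density6 (r * t) * (1 - t\<^sup>2)) * indicator {0..1} t \<partial>lborel)
    = ennreal (Z_radius (sqrt (1 - r\<^sup>2)))"
proof -
  define D where "D t = t / sqrt (1 - r\<^sup>2 * t\<^sup>2)" for t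
  define Q where "Q t = 3/2 * (D t - (1 - r\<^sup>2) * D t ^ 3 / 3)" for t
  have r2: "r\<^sup>2 \<le> 1" using r by (simp add: power_le_one)
  let ?f = "\<lambda>t. 3 / (2 * sqrt (1 - (r * t)\<^sup>2) ^ 5) * (1 - t\<^sup>2)"
  have Q': "(Q has_real_derivative ?f t) (at t)" if "r\<^sup>2 * t\<^sup>2 < 1" for t
    using density6_antiderivative[OF that] unfolding Q_def D_def .
  have Q0: "Q 0 = 0" by (simp add: Q_def D_def)
  show ?thesis
  proof (cases "r\<^sup>2 \<le> 1/2")
    case True
    have rt: "r\<^sup>2 * t\<^sup>2 \<le> 1/2" if "0 \<le> t" "t \<le> 1" for t
    proof -
      have "r\<^sup>2 * t\<^sup>2 \<le> 1/2 * 1" using True that by (intro mult_mono) (auto simp: power_le_one)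
      then show ?thesis by simp
    qed
    have "(\<integral>\<^sup>+t. ennreal (density6 (r * t) * (1 - t\<^sup>2)) * indicator {0..1} t \<partial>lborel)
        = (\<integral>\<^sup>+t. ennreal (?f t) * indicator {0..1} t \<partial>lborel)"
      using rt by (intro nn_integral_cong) (auto simp: indicator_def density6_def power_mult_distrib)
    also have "\<dots> = ennreal (Q 1 - Q 0)"
    proof (rule nn_integral_FTC_Icc[where F = Q])
      fix t :: real assume "t \<in> {0..1}"
      then have t: "r\<^sup>2 * t\<^sup>2 \<le> 1/2" "t\<^sup>2 \<le> 1" "(r * t)\<^sup>2 \<le> 1/2"
        using rt by (auto simp: power_le_one power_mult_distrib)
      then show "DERIV Q t :> ?f t" by (intro Q') auto
      show "0 \<le> ?f t" using t by simp
    qed auto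
    also have "Q 1 = 1 / sqrt (1 - r\<^sup>2)"
    proof -
      define s where "s = sqrt (1 - r\<^sup>2)"
      have s: "s > 0" "s\<^sup>2 = 1 - r\<^sup>2" using True by (auto simp: s_def)
      have "Q 1 = 3/2 * (1 / s - s\<^sup>2 * (1 / s) ^ 3 / 3)" unfolding Q_def D_def s by (simp add: s_def)
      also have "\<dots> = 1 / s" using s(1) by (simp add: field_simps power2_eq_square power3_eq_cube)
      finally show ?thesis by (simp add: s_def)
    qed
    also have "1 / sqrt (1 - r\<^sup>2) - Q 0 = Z_radius (sqrt (1 - r\<^sup>2))"
      using True by (simp add: Q0 Z_radius_def)
    finally show ?thesis .
  next
    case False
    then have r0: "r > 0" using r by (cases "r = 0") auto
    \<comment> \<open>The value of t at which r t reaches sqrt (1/2), the break point of the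
      density.\<close>
    define t0 where "t0 = 1 / (sqrt 2 * r)"
    have t0: "t0 > 0" "r\<^sup>2 * t0\<^sup>2 = 1/2" using r0 by (auto simp: t0_def power_divide power_mult_distrib)
    have "t0\<^sup>2 < 1"
    proof (rule ccontr)
      assume "\<not> t0\<^sup>2 < 1"
      then have "r\<^sup>2 * 1 \<le> r\<^sup>2 * t0\<^sup>2" by (intro mult_left_mono) auto
      then show False using t0 False by simp
    qed
    then have t01: "t0 < 1" using t0(1) by (simp add: abs_square_less_1)
    have below: "r\<^sup>2 * t\<^sup>2 \<le> 1/2" if "0 \<le> t" "t \<le> t0" for t
      unfolding t0(2)[symmetric] using that by (intro mult_left_mono power_mono) auto
    have above: "r\<^sup>2 * t\<^sup>2 > 1/2" if "t0 < t" for t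
      unfolding t0(2)[symmetric] using that t0(1) r0 by (intro mult_strict_left_mono power_strict_mono) auto
    let ?g = "\<lambda>t. 8 * (r * t) * (1 - t\<^sup>2)" and ?P = "\<lambda>t. 4 * r * t\<^sup>2 - 2 * r * t ^ 4"
    have "(\<integral>\<^sup>+t. ennreal (density6 (r * t) * (1 - t\<^sup>2)) * indicator {0..1} t \<partial>lborel)
        = (\<integral>\<^sup>+t. ennreal (?f t) * indicator {0..t0} t + ennreal (?g t) * indicator {t0..1} t \<partial>lborel)"
    proof (rule nn_integral_cong_AE)
      show "AE t in lborel. ennreal (density6 (r * t) * (1 - t\<^sup>2)) * indicator {0..1} t
        = ennreal (?f t) * indicator {0..t0} t + ennreal (?g t) * indicator {t0..1} t"
        using AE_lborel_singleton[of t0]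
      proof eventually_elim
        case (elim t)
        then show ?case
          using below[of t] above[of t] t0(1) t01 r0
          by (cases "t < t0") (auto simp: indicator_def density6_def power_mult_distrib abs_mult)
      qed
    qed
    also have "\<dots> = (\<integral>\<^sup>+t. ennreal (?f t) * indicator {0..t0} t \<partial>lborel) + (\<integral>\<^sup>+t. ennreal (?g t) * indicator {t0..1} t \<partial>lborel)"
      by (rule nn_integral_add) measurable
    also have "(\<integral>\<^sup>+t. ennreal (?f t) * indicator {0..t0} t \<partial>lborel) = ennreal (Q t0 - Q 0)"
    proof (rule nn_integral_FTC_Icc[where F = Q])
      fix t :: real assume "t \<in> {0..t0}"
      then have t: "r\<^sup>2 * t\<^sup>2 \<le> 1/2" "t\<^sup>2 \<le> 1" "(r * t)\<^sup>2 \<le> 1/2"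
        using below[of t] t01 by (auto simp: power_le_one power_mult_distrib)
      then show "DERIV Q t :> ?f t" by (intro Q') auto
      show "0 \<le> ?f t" using t by simp
    qed (use t0 in auto)
    also have "(\<integral>\<^sup>+t. ennreal (?g t) * indicator {t0..1} t \<partial>lborel) = ennreal (?P 1 - ?P t0)"
    proof (rule nn_integral_FTC_Icc[where F = ?P])
      fix t :: real assume t: "t \<in> {t0..1}"
      show "DERIV ?P t :> ?g t"
        by (auto intro!: derivative_eq_intros simp: algebra_simps power2_eq_square power3_eq_cube)
      show "0 \<le> ?g t" using t t0(1) r0 by (auto simp: power_le_one)
    qed (use t01 in auto)
    also have "ennreal (Q t0 - Q 0) + ennreal (?P 1 - ?P t0) = ennreal ((Q t0 - Q 0) + (?P 1 - ?P t0))"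
    proof (rule ennreal_plus[symmetric])
      have "Q 0 \<le> Q t0"
      proof (rule DERIV_nonneg_imp_nondecreasing[where f = Q])
        fix t assume t: "0 \<le> t" "t \<le> t0"
        then have t2: "r\<^sup>2 * t\<^sup>2 \<le> 1/2" "t\<^sup>2 \<le> 1" "(r * t)\<^sup>2 \<le> 1/2"
          using below[of t] t01 by (auto simp: power_le_one power_mult_distrib)
        then have "r\<^sup>2 * t\<^sup>2 < 1" "0 \<le> ?f t" by auto
        then show "\<exists>y. DERIV Q t :> y \<and> 0 \<le> y" using Q' by blast
      qed (use t0 in auto)
      then show "0 \<le> Q t0 - Q 0" by simp
      have "?P 1 - ?P t0 = 2 * r * (1 - t0\<^sup>2)\<^sup>2" by (simp add: algebra_simps power2_eq_square numeral_eq_Suc)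
      then show "0 \<le> ?P 1 - ?P t0" using r0 by simp
    qed
    \<comment> \<open>Q and \<open>?P\<close> take the same value 2 / r - 1 / (2 r^3) at
      \<open>t0\<close>, so that \<open>?P 1\<close> = 2 r remains.\<close>
    also have "(Q t0 - Q 0) + (?P 1 - ?P t0) = 2 * r"
    proof -
      have s: "sqrt (1 - r\<^sup>2 * t0\<^sup>2) = 1 / sqrt 2" unfolding t0(2) by (simp add: real_sqrt_divide)
      have "D t0 = 1 / r" unfolding D_def s by (simp add: t0_def)
      then have "Q t0 = 3/2 * (1 / r - (1 - r\<^sup>2) * (1 / r) ^ 3 / 3)" by (simp add: Q_def)
      also have "\<dots> = 2 / r - 1 / (2 * r ^ 3)" using r0 by (simp add: field_simps power2_eq_square power3_eq_cube)
      finally have Qt: "Q t0 = 2 / r - 1 / (2 * r ^ 3)" .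
      have t2: "t0\<^sup>2 = 1 / (2 * r\<^sup>2)" by (simp add: t0_def power_divide power_mult_distrib)
      have "t0 ^ 4 = (t0\<^sup>2)\<^sup>2" by simp
      then have "?P t0 = 2 / r - 1 / (2 * r ^ 3)"
        using r0 by (simp add: t2 power_divide power_mult_distrib field_simps) (simp add: power2_eq_square numeral_eq_Suc)
      then show ?thesis using Qt Q0 by simp
    qed
    also have "2 * r = Z_radius (sqrt (1 - r\<^sup>2))"
      using False r r2 by (simp add: Z_radius_def)
    finally show ?thesis .
  qed
qed

lemma nn_integral_density6:
  assumes r: "0 \<le> r" "r \<le> 1"
  shows "(\<integral>\<^sup>+t. indicator {-1<..<1} t * ennreal (density6 (r * t) * (1 - t\<^sup>2)) \<partial>lborel)
    = ennreal (2 * Z_radius (sqrt (1 - r\<^sup>2)))"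
proof -
  have "(\<integral>\<^sup>+t. indicator {-1<..<1} t * ennreal (density6 (r * t) * (1 - t\<^sup>2)) \<partial>lborel)
    = 2 * (\<integral>\<^sup>+t. ennreal (density6 (r * t) * (1 - t\<^sup>2)) * indicator {0..1} t \<partial>lborel)"
    by (rule nn_integral_even_interval) (auto simp: density6_minus)
  moreover have "0 \<le> Z_radius (sqrt (1 - r\<^sup>2))"
    using r by (intro Z_radius_nonneg) (auto simp: power_le_one)
  ultimately show ?thesis
    using nn_integral_density6_half[OF r] by (simp add: ennreal_mult)
qed

section \<open>Dimension 5\<close>

text \<open>Found by x^2 = a + (1 - a) sin^2 \<phi>: the root becomes tan \<phi>, x dx becomes (1 -
  a) sin \<phi> cos \<phi> d\<phi>, and sin^2 \<phi> has the antiderivative (\<phi> - sin \<phi> cos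
  \<phi>) / 2.\<close>

lemma sqrt_ratio_antiderivative:
  fixes a :: real
  assumes a: "0 \<le> a" and x: "a < x\<^sup>2" "x\<^sup>2 < 1" "x > 0"
  shows "((\<lambda>x. ((1 - a) * arcsin (sqrt ((x\<^sup>2 - a) / (1 - a))) - sqrt ((x\<^sup>2 - a) * (1 - x\<^sup>2))) / 2)
    has_real_derivative x * sqrt ((x\<^sup>2 - a) / (1 - x\<^sup>2))) (at x)"
proof -
  define p where "p = sqrt (x\<^sup>2 - a)"
  define q where "q = sqrt (1 - x\<^sup>2)"
  define c where "c = sqrt (1 - a)"
  have pqc: "p > 0" "q > 0" "c > 0" "p\<^sup>2 = x\<^sup>2 - a" "q\<^sup>2 = 1 - x\<^sup>2" "c\<^sup>2 = 1 - a"
    using x by (auto simp: p_def q_def c_def)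
  have c2: "c\<^sup>2 = p\<^sup>2 + q\<^sup>2" using pqc by simp
  have dp: "((\<lambda>x. sqrt (x\<^sup>2 - a)) has_real_derivative x / p) (at x)"
    unfolding p_def using x by (auto intro!: derivative_eq_intros simp: field_simps)
  have dq: "((\<lambda>x. sqrt (1 - x\<^sup>2)) has_real_derivative - x / q) (at x)"
    unfolding q_def using x by (auto intro!: derivative_eq_intros simp: field_simps)
  have "p < c" by (rule power2_less_imp_less) (use pqc x in auto)
  then have pc: "p / c < 1" "-1 < p / c" using pqc(1,3) by (auto intro: less_trans[of _ 0])
  have "sqrt (1 - (p / c)\<^sup>2) = q / c"
  proof -
    have "1 - (p / c)\<^sup>2 = (c\<^sup>2 - p\<^sup>2) / c\<^sup>2" using pqc(3) by (simp add: power_divide field_simps)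
    also have "\<dots> = (q / c)\<^sup>2" using c2 by (simp add: power_divide)
    finally have "1 - (p / c)\<^sup>2 = (q / c)\<^sup>2" .
    then show ?thesis using pqc by simp
  qed
  then have "DERIV arcsin (sqrt (x\<^sup>2 - a) / c) :> inverse (q / c)"
    using DERIV_arcsin[OF pc(2,1)] by (simp add: p_def)
  from DERIV_chain2[OF this DERIV_cdivide[OF dp]]
  have "((\<lambda>x. arcsin (sqrt (x\<^sup>2 - a) / c)) has_real_derivative inverse (q / c) * (x / p / c)) (at x)" .
  then have da: "((\<lambda>x. arcsin (sqrt (x\<^sup>2 - a) / c)) has_real_derivative x / (p * q)) (at x)"
    using pqc by (simp add: field_simps)
  have "((\<lambda>x. (c\<^sup>2 * arcsin (sqrt (x\<^sup>2 - a) / c) - sqrt (x\<^sup>2 - a) * sqrt (1 - x\<^sup>2)) / 2)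
      has_real_derivative (c\<^sup>2 * (x / (p * q)) - (x / p * q + p * (- x / q))) / 2) (at x)"
    using DERIV_cdivide[OF DERIV_diff[OF DERIV_cmult[OF da, of "c\<^sup>2"] DERIV_mult[OF dp dq]], of 2]
    by (simp only: p_def[symmetric] q_def[symmetric] mult.commute[of p])
  also have "(c\<^sup>2 * (x / (p * q)) - (x / p * q + p * (- x / q))) / 2 = x * (p / q)"
    unfolding c2 using pqc(1,2) by (simp add: field_simps power2_eq_square)
  finally show ?thesis
    using pqc(6) by (simp add: p_def q_def c_def real_sqrt_mult real_sqrt_divide)
qed

text \<open>The integrand is unbounded near x = 1. Hence the antiderivative is differentiated in the
  interior only and is continuous at the ends, where the arcsine contributes pi / 2.\<close>

lemma nn_integral_sqrt_ratio:
  fixes a :: real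
  assumes a: "0 \<le> a" "a < 1"
  shows "(\<integral>\<^sup>+x. ennreal (x * sqrt ((x\<^sup>2 - a) / (1 - x\<^sup>2))) * indicator {sqrt a..1} x \<partial>lborel) = ennreal (pi / 4 * (1 - a))"
proof -
  let ?f = "\<lambda>x. x * sqrt ((x\<^sup>2 - a) / (1 - x\<^sup>2))"
  let ?F = "\<lambda>x. ((1 - a) * arcsin (sqrt ((x\<^sup>2 - a) / (1 - a))) - sqrt ((x\<^sup>2 - a) * (1 - x\<^sup>2))) / 2"
  have x2: "a \<le> x\<^sup>2" "x\<^sup>2 \<le> 1" "0 \<le> x" if x: "x \<in> {sqrt a..1}" for x
  proof -
    have "0 \<le> sqrt a" using a by simp
    then show "0 \<le> x" using x by (meson atLeastAtMost_iff order_trans)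
    show "a \<le> x\<^sup>2" using x a by (simp add: sqrt_le_D)
    show "x\<^sup>2 \<le> 1" using x \<open>0 \<le> x\<close> by (simp add: power_le_one)
  qed
  have FI: "(?f has_integral ?F 1 - ?F (sqrt a)) {sqrt a..1}"
  proof (rule fundamental_theorem_of_calculus_interior)
    show "sqrt a \<le> 1" using a by simp
    have "(x\<^sup>2 - a) / (1 - a) \<in> {0..1}" if "x \<in> {sqrt a..1}" for x
      using x2[OF that] a by (simp add: divide_le_eq_1)
    then show "continuous_on {sqrt a..1} ?F"
      using a by (intro continuous_intros) (auto intro: order_trans[of "-1" 0])
    fix x assume x: "x \<in> {sqrt a<..<1}"
    have "0 \<le> sqrt a" using a by simp
    then have x0: "0 < x" using x by (meson greaterThanLessThan_iff order_le_less_trans)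
    have "a < x\<^sup>2" using power_strict_mono[of "sqrt a" x 2] x a by simp
    moreover have "x\<^sup>2 < 1" using x x0 by (simp add: abs_square_less_1)
    ultimately show "(?F has_vector_derivative ?f x) (at x)"
      using sqrt_ratio_antiderivative[of a x] x0 a by (simp add: has_real_derivative_iff_has_vector_derivative)
  qed
  have F_eq: "?F 1 - ?F (sqrt a) = pi / 4 * (1 - a)" using a by (simp add: algebra_simps)
  have hi: "(?f has_integral pi / 4 * (1 - a)) {sqrt a..1}" using FI unfolding F_eq .
  have "(\<integral>\<^sup>+x. ennreal (indicator {sqrt a..1} x *\<^sub>R ?f x) \<partial>lborel) = ennreal (pi / 4 * (1 - a))"
  proof (rule nn_integral_has_integral_lborel)
    show "((\<lambda>x. indicator {sqrt a..1} x *\<^sub>R ?f x) has_integral pi / 4 * (1 - a)) UNIV"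
    proof -
      have "(\<lambda>x. indicator {sqrt a..1} x *\<^sub>R ?f x) = (\<lambda>x. if x \<in> {sqrt a..1} then ?f x else 0)"
        by (auto simp: fun_eq_iff)
      then show ?thesis using hi by (simp only: has_integral_restrict_UNIV)
    qed
    show "0 \<le> indicator {sqrt a..1} x *\<^sub>R ?f x" for x
      using x2[of x] by (auto simp: indicator_def)
  qed measurable
  also have "(\<integral>\<^sup>+x. ennreal (indicator {sqrt a..1} x *\<^sub>R ?f x) \<partial>lborel)
      = (\<integral>\<^sup>+x. ennreal (?f x) * indicator {sqrt a..1} x \<partial>lborel)"
    by (rule nn_integral_cong) (auto simp: indicator_def)
  finally show ?thesis .
qed

text \<open>The density for \<open>n = 5\<close> is obtained from the one for \<open>n = 6\<close> by averaging, because the kernel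
  \<open>1 - t\<^sup>2\<close> of the zonal Radon transform in dimension 6 is a multiplicative convolution of the
  kernel \<open>sqrt (1 - t\<^sup>2)\<close> of dimension 5 with a positive weight.\<close>

definition density5 :: "real \<Rightarrow> ennreal" where
  "density5 u = (\<integral>\<^sup>+\<tau>. ennreal (density6 (\<tau> * u)) * ennreal (\<tau> ^ 3 / sqrt (1 - \<tau>\<^sup>2)) * indicator {0<..<1} \<tau> \<partial>lborel)"

lemma measurable_density5 [measurable]: "density5 \<in> borel_measurable borel"
  unfolding density5_def by measurable

lemma density5_minus: "density5 (- u) = density5 u"
  by (simp add: density5_def density6_minus)

lemma nn_integral_density5:
  assumes r: "0 \<le> r" "r \<le> 1"
  shows "(\<integral>\<^sup>+s. ennreal (sqrt (1 - s\<^sup>2)) * indicator {-1<..<1} s * density5 (r * s) \<partial>lborel)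
    = ennreal (pi / 2 * Z_radius (sqrt (1 - r\<^sup>2)))"
proof -
  let ?w = "\<lambda>\<tau>. ennreal (\<tau> ^ 3 / sqrt (1 - \<tau>\<^sup>2)) * indicator {0<..<1} \<tau>"
  let ?ker = "\<lambda>\<tau> \<sigma>. ennreal (\<tau> * sqrt ((\<tau>\<^sup>2 - \<sigma>\<^sup>2) / (1 - \<tau>\<^sup>2))) * indicator {x. \<bar>snd x\<bar> < fst x \<and> fst x < 1} (\<tau>, \<sigma>)"
  let ?k = "\<lambda>s. ennreal (sqrt (1 - s\<^sup>2)) * indicator {-1<..<1} s"
  have "(\<integral>\<^sup>+s. ?k s * density5 (r * s) \<partial>lborel)
      = (\<integral>\<^sup>+s. (\<integral>\<^sup>+\<tau>. ?k s * (?w \<tau> * ennreal (density6 (\<tau> * (r * s)))) \<partial>lborel) \<partial>lborel)"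
    unfolding density5_def by (subst nn_integral_cmult[symmetric]) (auto simp: mult_ac)
  also have "\<dots> = (\<integral>\<^sup>+\<tau>. (\<integral>\<^sup>+s. ?k s * (?w \<tau> * ennreal (density6 (\<tau> * (r * s)))) \<partial>lborel) \<partial>lborel)"
    by (rule lborel_pair.Fubini') measurable
  also have "\<dots> = (\<integral>\<^sup>+\<tau>. (\<integral>\<^sup>+\<sigma>. ennreal (density6 (r * \<sigma>)) * ?ker \<tau> \<sigma> \<partial>lborel) \<partial>lborel)"
  proof (rule nn_integral_cong)
    fix \<tau> :: real
    show "(\<integral>\<^sup>+s. ?k s * (?w \<tau> * ennreal (density6 (\<tau> * (r * s)))) \<partial>lborel)
      = (\<integral>\<^sup>+\<sigma>. ennreal (density6 (r * \<sigma>)) * ?ker \<tau> \<sigma> \<partial>lborel)"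
    proof (cases "0 < \<tau> \<and> \<tau> < 1")
      case False
      then have w0: "?w \<tau> = 0" by (auto simp: indicator_def)
      have "indicator {x. \<bar>snd x\<bar> < fst x \<and> fst x < 1} (\<tau>, \<sigma>) = (0::ennreal)" for \<sigma> :: real
        using False by (auto simp: indicator_def)
      then show ?thesis by (simp only: w0 mult_zero_left mult_zero_right)
    next
      \<comment> \<open>\<sigma> = \<tau> s brings a factor 1 / \<tau>, and sqrt (1 - s^2) = sqrt
        (\<tau>^2 - \<sigma>^2) / \<tau> another. The cube in the weight of \<open>density5\<close>
        leaves the single power of \<tau> that makes the integral over \<tau> elementary.\<close>
      case True
      have "(\<integral>\<^sup>+s. ?k s * (?w \<tau> * ennreal (density6 (\<tau> * (r * s)))) \<partial>lborel)
        = ennreal (1 / \<tau>) * (\<integral>\<^sup>+\<sigma>. ?k (1 / \<tau> * \<sigma>) * (?w \<tau> * ennreal (density6 (\<tau> * (r * (1 / \<tau> * \<sigma>))))) \<partial>lborel)"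
        using True by (subst nn_integral_real_affine[where c = "1 / \<tau>" and t = 0]) auto
      also have "\<dots> = (\<integral>\<^sup>+\<sigma>. ennreal (1 / \<tau>) * (?k (1 / \<tau> * \<sigma>) * (?w \<tau> * ennreal (density6 (\<tau> * (r * (1 / \<tau> * \<sigma>)))))) \<partial>lborel)"
        by (rule nn_integral_cmult[symmetric]) measurable
      also have "\<dots> = (\<integral>\<^sup>+\<sigma>. ennreal (density6 (r * \<sigma>)) * ?ker \<tau> \<sigma> \<partial>lborel)"
      proof (rule nn_integral_cong)
        fix \<sigma> :: real
        have ind: "1 / \<tau> * \<sigma> \<in> {-1<..<1} \<longleftrightarrow> \<bar>\<sigma>\<bar> < \<tau>" using True by (auto simp: field_simps abs_less_iff)
        show "ennreal (1 / \<tau>) * (?k (1 / \<tau> * \<sigma>) * (?w \<tau> * ennreal (density6 (\<tau> * (r * (1 / \<tau> * \<sigma>))))))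
          = ennreal (density6 (r * \<sigma>)) * ?ker \<tau> \<sigma>"
        proof (cases "\<bar>\<sigma>\<bar> < \<tau>")
          case False
          then have "1 / \<tau> * \<sigma> \<notin> {-1<..<1}" using ind by simp
          then have "indicator {-1<..<1} (1 / \<tau> * \<sigma>) = (0::ennreal)" by (rule indicator_simps(2))
          then have "?k (1 / \<tau> * \<sigma>) = 0" by (simp only: mult_zero_right)
          moreover have "indicator {x. \<bar>snd x\<bar> < fst x \<and> fst x < 1} (\<tau>, \<sigma>) = (0::ennreal)" using False by simp
          ultimately show ?thesis by (simp only: mult_zero_left mult_zero_right)
        next
          case c: True
          have s2: "\<sigma>\<^sup>2 < \<tau>\<^sup>2" using power_strict_mono[of "\<bar>\<sigma>\<bar>" \<tau> 2] c by simp
          have t2: "\<tau>\<^sup>2 < 1" using True by (simp add: abs_square_less_1)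
          have a: "sqrt (1 - (1 / \<tau> * \<sigma>)\<^sup>2) = sqrt (\<tau>\<^sup>2 - \<sigma>\<^sup>2) / \<tau>"
          proof -
            have "1 - (1 / \<tau> * \<sigma>)\<^sup>2 = (\<tau>\<^sup>2 - \<sigma>\<^sup>2) / \<tau>\<^sup>2" using True by (simp add: power_mult_distrib power_divide field_simps)
            then show ?thesis using True by (simp add: real_sqrt_divide)
          qed
          have b: "1 / \<tau> * (sqrt (\<tau>\<^sup>2 - \<sigma>\<^sup>2) / \<tau> * (\<tau> ^ 3 / sqrt (1 - \<tau>\<^sup>2))) = \<tau> * sqrt ((\<tau>\<^sup>2 - \<sigma>\<^sup>2) / (1 - \<tau>\<^sup>2))"
            using True by (simp add: real_sqrt_divide power3_eq_cube)
          have e: "ennreal (1 / \<tau>) * (ennreal (sqrt (\<tau>\<^sup>2 - \<sigma>\<^sup>2) / \<tau>) * ennreal (\<tau> ^ 3 / sqrt (1 - \<tau>\<^sup>2))) = ennreal (\<tau> * sqrt ((\<tau>\<^sup>2 - \<sigma>\<^sup>2) / (1 - \<tau>\<^sup>2)))"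
          proof -
            have "0 \<le> 1 / \<tau>" "0 \<le> sqrt (\<tau>\<^sup>2 - \<sigma>\<^sup>2) / \<tau>" "0 \<le> \<tau> ^ 3 / sqrt (1 - \<tau>\<^sup>2)"
              using True s2 t2 by auto
            then show ?thesis unfolding b[symmetric] by (simp only: ennreal_mult mult_nonneg_nonneg)
          qed
          have d: "\<tau> * (r * (1 / \<tau> * \<sigma>)) = r * \<sigma>" using True by simp
          have i: "indicator {x. \<bar>snd x\<bar> < fst x \<and> fst x < 1} (\<tau>, \<sigma>) = (1::ennreal)"
            "indicator {-1<..<1} (1 / \<tau> * \<sigma>) = (1::ennreal)" "indicator {0<..<1} \<tau> = (1::ennreal)"
            using True c ind by (simp_all only: indicator_simps) (simp_all add: True c)
          have regroup: "A * (B * (C * Dd)) = Dd * (A * (B * C))" for A B C Dd :: ennreal by (simp only: mult_ac)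
          show ?thesis unfolding a d i mult_1_right by (subst regroup, subst e) (rule refl)
        qed
      qed
      finally show ?thesis .
    qed
  qed
  also have "\<dots> = (\<integral>\<^sup>+\<sigma>. (\<integral>\<^sup>+\<tau>. ennreal (density6 (r * \<sigma>)) * ?ker \<tau> \<sigma> \<partial>lborel) \<partial>lborel)"
    by (rule lborel_pair.Fubini'[symmetric]) measurable
  also have "\<dots> = (\<integral>\<^sup>+\<sigma>. ennreal (pi / 4) * (indicator {-1<..<1} \<sigma> * ennreal (density6 (r * \<sigma>) * (1 - \<sigma>\<^sup>2))) \<partial>lborel)"
  proof (rule nn_integral_cong)
    fix \<sigma> :: real
    show "(\<integral>\<^sup>+\<tau>. ennreal (density6 (r * \<sigma>)) * ?ker \<tau> \<sigma> \<partial>lborel)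
      = ennreal (pi / 4) * (indicator {-1<..<1} \<sigma> * ennreal (density6 (r * \<sigma>) * (1 - \<sigma>\<^sup>2)))"
    proof (cases "\<bar>\<sigma>\<bar> < 1")
      case False
      then have "indicator {x. \<bar>snd x\<bar> < fst x \<and> fst x < 1} (\<tau>, \<sigma>) = (0::ennreal)" for \<tau> :: real
        by (auto simp: indicator_def)
      moreover have "\<sigma> \<notin> {-1<..<1}" using False by (auto simp: abs_less_iff)
      ultimately show ?thesis by simp
    next
      \<comment> \<open>Integrating over \<tau> between |\<sigma>| and 1 reproduces the kernel 1 -
        \<sigma>^2 of dimension 6, with the constant pi / 4.\<close>
      case True
      have "(\<integral>\<^sup>+\<tau>. ?ker \<tau> \<sigma> \<partial>lborel)
        = (\<integral>\<^sup>+\<tau>. ennreal (\<tau> * sqrt ((\<tau>\<^sup>2 - \<sigma>\<^sup>2) / (1 - \<tau>\<^sup>2))) * indicator {sqrt (\<sigma>\<^sup>2)..1} \<tau> \<partial>lborel)"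
      proof (rule nn_integral_cong_AE)
        show "AE \<tau> in lborel. ?ker \<tau> \<sigma>
          = ennreal (\<tau> * sqrt ((\<tau>\<^sup>2 - \<sigma>\<^sup>2) / (1 - \<tau>\<^sup>2))) * indicator {sqrt (\<sigma>\<^sup>2)..1} \<tau>"
          using AE_lborel_singleton[of 1] AE_lborel_singleton[of "\<bar>\<sigma>\<bar>"]
          by eventually_elim (auto simp: indicator_def)
      qed
      also have "\<dots> = ennreal (pi / 4 * (1 - \<sigma>\<^sup>2))"
        using True by (intro nn_integral_sqrt_ratio) (auto simp: abs_square_less_1)
      finally have I: "(\<integral>\<^sup>+\<tau>. ?ker \<tau> \<sigma> \<partial>lborel) = ennreal (pi / 4 * (1 - \<sigma>\<^sup>2))" .
      have "ennreal (density6 (r * \<sigma>)) * ennreal (pi / 4 * (1 - \<sigma>\<^sup>2)) = ennreal (pi / 4) * ennreal (density6 (r * \<sigma>) * (1 - \<sigma>\<^sup>2))"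
        using density6_nonneg True by (simp add: mult_ac abs_square_le_1 less_imp_le flip: ennreal_mult)
      moreover have "\<sigma> \<in> {-1<..<1}" using True by (auto simp: abs_less_iff)
      moreover have "(\<lambda>\<tau>. ennreal (\<tau> * sqrt ((\<tau>\<^sup>2 - \<sigma>\<^sup>2) / (1 - \<tau>\<^sup>2))) *
          indicator {x. \<bar>snd x\<bar> < fst x \<and> fst x < 1} (\<tau>, \<sigma>)) \<in> borel_measurable lborel"
      proof -
        have "indicator {x. \<bar>snd x\<bar> < fst x \<and> fst x < 1} (\<tau>, \<sigma>) = (indicator {\<bar>\<sigma>\<bar><..<1} \<tau> :: ennreal)" for \<tau>
          by (auto simp: indicator_def)
        then show ?thesis by simp
      qed
      ultimately show ?thesis by (subst nn_integral_cmult) (simp_all add: I)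
    qed
  qed
  also have "\<dots> = ennreal (pi / 4) * (\<integral>\<^sup>+\<sigma>. indicator {-1<..<1} \<sigma> * ennreal (density6 (r * \<sigma>) * (1 - \<sigma>\<^sup>2)) \<partial>lborel)"
    by (rule nn_integral_cmult) measurable
  also have "\<dots> = ennreal (pi / 4) * ennreal (2 * Z_radius (sqrt (1 - r\<^sup>2)))"
    by (simp only: nn_integral_density6[OF r])
  also have "\<dots> = ennreal (pi / 2 * Z_radius (sqrt (1 - r\<^sup>2)))"
    using r by (subst ennreal_mult[symmetric]) (auto intro!: Z_radius_nonneg simp: power_le_one)
  finally show ?thesis .
qed

lemma Z_radius_abs: "Z_radius (sqrt (1 - (sqrt (1 - u\<^sup>2))\<^sup>2)) = Z_radius u" if "\<bar>u\<bar> \<le> 1"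
  using that by (simp add: abs_square_le_1) (simp add: Z_radius_def)

text \<open>For a zonal density the Radon equation involves one variable r, the sine of the angle
  between \<xi> and the axis. The constants c and \<open>zonal_const\<close> are divided out of the
  density.\<close>

lemma intersection_body_ball_sum_if_zonal_density:
  fixes k :: "'n::finite" and f :: "real \<Rightarrow> ennreal"
  assumes n: "CARD('n) \<ge> 4" and [measurable]: "f \<in> borel_measurable borel"
    and even: "\<And>u. f (- u) = f u" and c: "c > 0"
    and f: "\<And>r. 0 \<le> r \<Longrightarrow> r \<le> 1 \<Longrightarrow>
      (\<integral>\<^sup>+t. ennreal (sqrt (1 - t\<^sup>2) ^ (CARD('n) - 4)) * indicator {-1<..<1} t * f (r * t) \<partial>lborel)
      = ennreal (c * Z_radius (sqrt (1 - r\<^sup>2)))"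
  shows "intersection_body (ball_sum k)"
proof -
  let ?e = "axis k 1 :: real^'n"
  let ?z = "zonal_const TYPE(real^'n)"
  have z: "?z > 0" using n by (intro zonal_const) simp
  define b where "b \<theta> = ennreal (1 / (?z * c)) * f (\<theta> \<bullet> ?e)" for \<theta> :: "real^'n"
  show ?thesis
  proof (rule intersection_body_if_radon_density)
    show "DIM(real^'n) \<ge> 2" using n by simp
    show "star_body (ball_sum k)" by (rule star_body_ball_sum)
    show "origin_symmetric (ball_sum k)" by (rule origin_symmetric_ball_sum)
    show "b \<in> borel_measurable borel" unfolding b_def by measurable
    show "b (- x) = b x" for x by (simp add: b_def even)
    fix \<xi> :: "real^'n" assume \<xi>: "norm \<xi> = 1"
    define u where "u = \<xi> $ k"
    have u: "\<bar>u\<bar> \<le> 1" using component_le_norm[OF \<xi>] by (simp add: u_def)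
    have Z: "0 \<le> Z_radius u" using u by (rule Z_radius_nonneg)
    have "radon b \<xi> = ennreal (1 / (?z * c)) * radon (\<lambda>\<theta>. f (\<theta> \<bullet> ?e)) \<xi>"
      unfolding b_def by (rule radon_cmult) measurable
    also have "radon (\<lambda>\<theta>. f (\<theta> \<bullet> ?e)) \<xi> = ennreal ?z * ennreal (c * Z_radius (sqrt (1 - (sqrt (1 - u\<^sup>2))\<^sup>2)))"
    proof -
      have "radon (\<lambda>\<theta>. f (\<theta> \<bullet> ?e)) \<xi> = ennreal ?z *
        (\<integral>\<^sup>+t. ennreal (sqrt (1 - t\<^sup>2) ^ (CARD('n) - 4)) * indicator {-1<..<1} t * f (sqrt (1 - u\<^sup>2) * t) \<partial>lborel)"
        using radon_zonal[OF \<xi>, of ?e f] n by (simp add: inner_axis_one u_def)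
      also have "(\<integral>\<^sup>+t. ennreal (sqrt (1 - t\<^sup>2) ^ (CARD('n) - 4)) * indicator {-1<..<1} t * f (sqrt (1 - u\<^sup>2) * t) \<partial>lborel)
        = ennreal (c * Z_radius (sqrt (1 - (sqrt (1 - u\<^sup>2))\<^sup>2)))"
        using u by (intro f) (auto simp: abs_square_le_1)
      finally show ?thesis .
    qed
    also have "\<dots> = ennreal ?z * ennreal (c * Z_radius u)" by (simp only: Z_radius_abs[OF u])
    also have "ennreal (1 / (?z * c)) * \<dots> = ennreal (1 / (?z * c) * (?z * (c * Z_radius u)))"
      using z c Z by (simp only: ennreal_mult[symmetric] mult_nonneg_nonneg less_imp_le divide_nonneg_nonneg zero_le_one)
    also have "1 / (?z * c) * (?z * (c * Z_radius u)) = radial_fun (ball_sum k) \<xi>"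
      using z c by (simp add: radial_fun_ball_sum[OF \<xi>] u_def)
    finally show "0 \<le> radial_fun (ball_sum k) \<xi> \<and> radon b \<xi> = ennreal (radial_fun (ball_sum k) \<xi>)"
      using Z by (simp add: radial_fun_ball_sum[OF \<xi>] u_def)
  qed
qed

lemma intersection_body_ball_sum_6:
  fixes k :: "'n::finite"
  assumes "CARD('n) = 6"
  shows "intersection_body (ball_sum k)"
proof (rule intersection_body_ball_sum_if_zonal_density[where f = "\<lambda>u. ennreal (density6 u)" and c = 2])
  fix r :: real assume r: "0 \<le> r" "r \<le> 1"
  have "(\<integral>\<^sup>+t. ennreal (sqrt (1 - t\<^sup>2) ^ (CARD('n) - 4)) * indicator {-1<..<1} t * ennreal (density6 (r * t)) \<partial>lborel)
    = (\<integral>\<^sup>+t. indicator {-1<..<1} t * ennreal (density6 (r * t) * (1 - t\<^sup>2)) \<partial>lborel)"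
  proof (rule nn_integral_cong)
    fix t :: real
    show "ennreal (sqrt (1 - t\<^sup>2) ^ (CARD('n) - 4)) * indicator {-1<..<1} t * ennreal (density6 (r * t))
      = indicator {-1<..<1} t * ennreal (density6 (r * t) * (1 - t\<^sup>2))"
      using density6_nonneg[of "r * t"]
      by (cases "\<bar>t\<bar> < 1") (auto simp: assms indicator_def abs_square_le_1 ennreal_mult mult.commute)
  qed
  then show "(\<integral>\<^sup>+t. ennreal (sqrt (1 - t\<^sup>2) ^ (CARD('n) - 4)) * indicator {-1<..<1} t * ennreal (density6 (r * t)) \<partial>lborel)
    = ennreal (2 * Z_radius (sqrt (1 - r\<^sup>2)))"
    by (simp only: nn_integral_density6[OF r])
qed (use assms in \<open>auto simp: density6_minus\<close>)

lemma intersection_body_ball_sum_5: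
  fixes k :: "'n::finite"
  assumes "CARD('n) = 5"
  shows "intersection_body (ball_sum k)"
proof (rule intersection_body_ball_sum_if_zonal_density[where f = density5 and c = "pi / 2"])
  fix r :: real assume r: "0 \<le> r" "r \<le> 1"
  show "(\<integral>\<^sup>+t. ennreal (sqrt (1 - t\<^sup>2) ^ (CARD('n) - 4)) * indicator {-1<..<1} t * density5 (r * t) \<partial>lborel)
    = ennreal (pi / 2 * Z_radius (sqrt (1 - r\<^sup>2)))"
    using nn_integral_density5[OF r] by (simp add: assms)
qed (use assms in \<open>auto simp: density5_minus\<close>)

section \<open>Dimension at least 8\<close>

lemma DERIV_sqrt_power:
  assumes "v > 0"
  shows "((\<lambda>v. sqrt v ^ (k + 2)) has_real_derivative real (k + 2) / 2 * sqrt v ^ k) (at v)"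
proof -
  have "((\<lambda>v. sqrt v ^ (k + 2)) has_real_derivative real (k + 2) * sqrt v ^ (k + 1) * (inverse (sqrt v) / 2)) (at v)"
    using DERIV_power[OF DERIV_real_sqrt[OF assms], of "k + 2"] by (simp add: mult_ac)
  also have "real (k + 2) * sqrt v ^ (k + 1) * (inverse (sqrt v) / 2) = real (k + 2) / 2 * sqrt v ^ k"
    using assms by simp
  finally show ?thesis .
qed

lemma DERIV_inverse_sqrt_power:
  assumes "v < 1"
  shows "((\<lambda>v. 1 / sqrt (1 - v) ^ k) has_real_derivative real k / 2 * (1 / sqrt (1 - v) ^ (k + 2))) (at v)"
proof -
  have s: "sqrt (1 - v) > 0" using assms by simp
  define i where "i = inverse (sqrt (1 - v))"
  have "((\<lambda>v. 1 - v) has_real_derivative -1) (at v)" by (auto intro!: derivative_eq_intros)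
  from DERIV_chain2[OF DERIV_real_sqrt this] assms
  have "((\<lambda>v. sqrt (1 - v)) has_real_derivative i / 2 * -1) (at v)" by (simp add: i_def)
  from DERIV_inverse_fun[OF this less_imp_neq[OF s, symmetric]]
  have "((\<lambda>v. inverse (sqrt (1 - v))) has_real_derivative - (i / 2 * -1 * inverse (sqrt (1 - v) ^ Suc (Suc 0)))) (at v)" .
  also have "- (i / 2 * -1 * inverse (sqrt (1 - v) ^ Suc (Suc 0))) = i / 2 * i ^ 2"
    by (simp only: power_inverse[symmetric] i_def[symmetric]) (simp add: power2_eq_square)
  finally have "((\<lambda>v. inverse (sqrt (1 - v))) has_real_derivative i / 2 * i ^ 2) (at v)" .
  from DERIV_power[OF this, of k]
  have "((\<lambda>v. inverse (sqrt (1 - v)) ^ k) has_real_derivative real k * (i / 2 * i ^ 2 * i ^ (k - Suc 0))) (at v)"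
    by (simp only: i_def)
  also have "real k * (i / 2 * i ^ 2 * i ^ (k - Suc 0)) = real k / 2 * i ^ (k + 2)"
    by (cases k) (simp_all add: power2_eq_square)
  finally show ?thesis
    unfolding i_def by (simp only: power_inverse divide_inverse mult_1_left)
qed

text \<open>The function x_+^(m/2), so that half-integer exponents remain natural powers of a
  root.\<close>

definition truncated_power :: "nat \<Rightarrow> real \<Rightarrow> real" where
  "truncated_power m x = sqrt (max 0 x) ^ m"

lemma continuous_on_truncated_power [continuous_intros]:
  "continuous_on A f \<Longrightarrow> continuous_on A (\<lambda>x. truncated_power m (f x))"
  unfolding truncated_power_def by (intro continuous_intros)

text \<open>The exponent is at least 2, so near 0 the function is bounded by x^2 and has derivative
  0 there.\<close>

lemma DERIV_truncated_power:
  "(truncated_power (k + 4) has_real_derivative real (k + 4) / 2 * truncated_power (k + 2) x) (at x)"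
proof (cases x "0::real" rule: linorder_cases)
  case greater
  have "k + 2 + 2 = k + 4" by simp
  then have "((\<lambda>v. sqrt v ^ (k + 4)) has_real_derivative real (k + 4) / 2 * sqrt x ^ (k + 2)) (at x)"
    using DERIV_sqrt_power[OF greater, of "k + 2"] by (simp only:)
  then have "(truncated_power (k + 4) has_real_derivative real (k + 4) / 2 * sqrt x ^ (k + 2)) (at x)"
    by (rule has_field_derivative_transform_within_open[of _ _ _ "{0<..}"])
      (use greater in \<open>auto simp: truncated_power_def max_def\<close>)
  then show ?thesis using greater by (simp add: truncated_power_def max_def)
next
  case less
  have "(truncated_power (k + 4) has_real_derivative 0) (at x)"
    by (rule has_field_derivative_transform_within_open[of "\<lambda>_. 0" _ _ "{..<0}"])
      (use less in \<open>auto simp: truncated_power_def max_def\<close>)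
  then show ?thesis using less by (simp add: truncated_power_def max_def)
next
  case equal
  have bound: "\<bar>truncated_power (k + 4) h / h\<bar> \<le> \<bar>h\<bar>" if "\<bar>h\<bar> < 1" for h :: real
  proof (cases "h > 0")
    case True
    have "sqrt h ^ (k + 4) = h\<^sup>2 * sqrt h ^ k" using True by (simp add: power_add numeral_eq_Suc)
    also have "\<dots> \<le> h\<^sup>2 * 1" using that True by (intro mult_left_mono) (auto simp: power_le_one)
    finally have "sqrt h ^ (k + 4) / h \<le> h" using True by (simp add: divide_le_eq power2_eq_square)
    then show ?thesis using True by (simp add: truncated_power_def)
  qed (simp add: truncated_power_def power_0_left)
  have "(\<lambda>h. truncated_power (k + 4) h / h) \<midarrow>0\<rightarrow> 0"
  proof (rule Lim_null_comparison)
    show "eventually (\<lambda>h. norm (truncated_power (k + 4) h / h) \<le> \<bar>h\<bar>) (at (0::real))"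
      unfolding eventually_at using bound by (intro exI[of _ 1]) (auto simp: dist_real_def)
    show "(\<lambda>h::real. \<bar>h\<bar>) \<midarrow>0\<rightarrow> 0" by (auto intro!: tendsto_eq_intros)
  qed
  moreover have "truncated_power (k + 4) 0 = 0" "truncated_power (k + 2) 0 = 0"
    by (simp_all add: truncated_power_def)
  ultimately show ?thesis using equal by (simp add: DERIV_def)
qed

text \<open>Midpoint convexity of x_+^p with p = (k + 2) / 2 \<ge> 1. Truncation is convex, and so
  is the power: by \<open>powr_convex\<close> when both arguments are positive, by
  \<open>half\<close> when one of them is 0.\<close>

lemma truncated_power_midpoint:
  "2 * truncated_power (k + 2) (x + h) \<le> truncated_power (k + 2) (x + 2 * h) + truncated_power (k + 2) x"
proof -
  define p where "p = max 0 x"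
  define q where "q = max 0 (x + 2 * h)"
  have pq: "p \<ge> 0" "q \<ge> 0" by (auto simp: p_def q_def)
  have half: "2 * sqrt (z / 2) ^ (k + 2) \<le> sqrt z ^ (k + 2)" if z: "z \<ge> 0" for z :: real
  proof -
    have e: "sqrt y ^ (k + 2) = sqrt y ^ k * y" if "y \<ge> 0" for y :: real
      using that by (subst power_add, subst real_sqrt_pow2) auto
    have "sqrt (z / 2) ^ k * (z / 2) \<le> sqrt z ^ k * (z / 2)" using z by (intro mult_right_mono power_mono) auto
    then show ?thesis using e[of "z / 2"] e[OF z] z by linarith
  qed
  have "max 0 (x + h) \<le> (p + q) / 2" by (auto simp: p_def q_def max_def)
  then have "2 * truncated_power (k + 2) (x + h) \<le> 2 * sqrt ((p + q) / 2) ^ (k + 2)"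
    unfolding truncated_power_def by (intro mult_left_mono power_mono) auto
  also have "\<dots> \<le> sqrt q ^ (k + 2) + sqrt p ^ (k + 2)"
  proof (cases "p = 0 \<or> q = 0")
    case True
    then show ?thesis using half[OF pq(1)] half[OF pq(2)] by auto
  next
    case False
    then have pos: "p > 0" "q > 0" using pq by auto
    have powr: "sqrt z ^ (k + 2) = z powr (real (k + 2) / 2)" if "z > 0" for z
    proof -
      have "sqrt z ^ (k + 2) = sqrt z powr real (k + 2)" using that by (intro powr_realpow[symmetric]) simp
      also have "\<dots> = (z powr (1/2)) powr real (k + 2)" using that by (simp only: powr_half_sqrt less_imp_le)
      finally show ?thesis by (simp only: powr_powr) simp
    qed
    have "((1 - 1/2) *\<^sub>R p + (1/2) *\<^sub>R q) powr (real (k + 2) / 2)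
        \<le> (1 - 1/2) * p powr (real (k + 2) / 2) + 1/2 * q powr (real (k + 2) / 2)"
      by (rule convex_onD[OF powr_convex]) (use pos in auto)
    moreover have "(1 - 1/2) *\<^sub>R p + (1/2) *\<^sub>R q = (p + q) / 2" by simp
    moreover have "(p + q) / 2 > 0" using pos by simp
    ultimately have "sqrt ((p + q) / 2) ^ (k + 2) \<le> (1 - 1/2) * sqrt p ^ (k + 2) + 1/2 * sqrt q ^ (k + 2)"
      using pos by (simp only: powr)
    moreover have fin: "2 * A \<le> C + B" if "A \<le> (1 - 1/2) * B + 1/2 * C" for A B C :: real
      using that by simp
    ultimately show ?thesis by (intro fin)
  qed
  finally show ?thesis by (simp add: truncated_power_def p_def q_def)
qed

definition third_difference :: "real \<Rightarrow> (real \<Rightarrow> real) \<Rightarrow> real \<Rightarrow> real" where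
  "third_difference h X v = X (v + 3 * h) - 3 * X (v + 2 * h) + 3 * X (v + h) - X v"

text \<open>The third difference is an increment of the second difference, whose derivative is a
  second difference of a multiple of x_+^((k + 2) / 2), nonnegative by convexity. With k + 4 = n - 4
  this is where n \<ge> 8 enters.\<close>

lemma third_difference_truncated_power_nonneg:
  assumes h: "h > 0"
  shows "third_difference h (\<lambda>v. truncated_power (k + 4) (v - w)) v \<ge> 0"
proof -
  let ?T = "truncated_power (k + 4)"
  let ?\<psi> = "\<lambda>x. ?T (x + 2 * h) - 2 * ?T (x + h) + ?T x"
  have D: "((\<lambda>x. ?T (x + c)) has_real_derivative real (k + 4) / 2 * truncated_power (k + 2) (x + c)) (at x)" for x c
  proof -
    have "((\<lambda>x. x + c) has_real_derivative 1) (at x)" by (auto intro!: derivative_eq_intros)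
    from DERIV_chain2[OF DERIV_truncated_power this] show ?thesis by (simp only: mult_1_right)
  qed
  have "?\<psi> (v - w) \<le> ?\<psi> (v - w + h)"
  proof (rule DERIV_nonneg_imp_nondecreasing[where f = ?\<psi>])
    fix x
    have deriv: "(?\<psi> has_real_derivative real (k + 4) / 2 * truncated_power (k + 2) (x + 2 * h)
        - 2 * (real (k + 4) / 2 * truncated_power (k + 2) (x + h)) + real (k + 4) / 2 * truncated_power (k + 2) x) (at x)"
      by (intro DERIV_add DERIV_diff DERIV_cmult D DERIV_truncated_power)
    have nonneg: "c * A - 2 * (c * B) + c * C \<ge> 0" if "c \<ge> 0" "2 * B \<le> A + C" for c A B C :: real
    proof -
      have "c * (A - 2 * B + C) \<ge> 0" using that by (intro mult_nonneg_nonneg) auto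
      then show ?thesis by (simp add: algebra_simps)
    qed
    show "\<exists>y. DERIV ?\<psi> x :> y \<and> 0 \<le> y"
      by (rule exI, rule conjI, rule deriv, rule nonneg[OF _ truncated_power_midpoint], simp)
  qed (use h in simp)
  then show ?thesis by (simp add: third_difference_def algebra_simps)
qed

text \<open>The function G for n = j + 8, so that n - 3 = j + 5. The argument v is the squared sine
  of the angle to the axis.\<close>

definition Z_profile :: "nat \<Rightarrow> real \<Rightarrow> real" where
  "Z_profile j v = sqrt v ^ (j + 5) * Z_radius (sqrt (1 - v))"

lemma continuous_on_Z_profile: "continuous_on UNIV (Z_profile j)"
  unfolding Z_profile_def
  by (intro continuous_intros continuous_on_compose2[OF continuous_on_Z_radius[of UNIV]]) auto

text \<open>The second derivative of the profile drops from \<open>(N\<^sup>2 + 3) / 4\<close> to \<open>(N\<^sup>2 - 1) / 4\<close> (up to a common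
  factor, \<open>N = j + 5\<close>) when \<open>v\<close> passes \<open>1/2\<close>, where the flat and the round part of the boundary meet.\<close>

lemma third_difference_Z_profile_neg:
  obtains h where "0 < h" "h < 1/8" "third_difference h (Z_profile j) (1/2 - 2 * h) < 0"
proof -
  \<comment> \<open>\<open>?L\<close> is the profile over the flat part of the boundary, v \<le>
    1/2, and \<open>?R\<close> the one over the round part.\<close>
  let ?L = "\<lambda>v. sqrt v ^ (j + 5) * (1 / sqrt (1 - v) ^ 1)"
  let ?L1 = "\<lambda>v. real (j + 5) / 2 * sqrt v ^ (j + 3) * (1 / sqrt (1 - v) ^ 1) + real 1 / 2 * (1 / sqrt (1 - v) ^ 3) * sqrt v ^ (j + 5)"
  let ?R = "\<lambda>v. 2 * sqrt v ^ (j + 6)"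
  let ?R1 = "\<lambda>v. 2 * (real (j + 6) / 2 * sqrt v ^ (j + 4))"
  have e: "j + 1 + 2 = j + 3" "j + 2 + 2 = j + 4" "j + 3 + 2 = j + 5" "j + 4 + 2 = j + 6" "1 + 2 = (3::nat)" "3 + 2 = (5::nat)"
    by simp_all
  have dL: "(?L has_real_derivative ?L1 v) (at v)" if "0 < v" "v < 1" for v
    using DERIV_mult[OF DERIV_sqrt_power[OF that(1), of "j + 3"] DERIV_inverse_sqrt_power[OF that(2), of 1]]
    unfolding e .
  have dR: "(?R has_real_derivative ?R1 v) (at v)" if "0 < v" for v
    using DERIV_cmult[OF DERIV_sqrt_power[OF that, of "j + 4"], of 2] unfolding e .
  \<comment> \<open>At v = 1/2 both sqrt v and sqrt (1 - v) equal s, so the second derivatives are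
    monomials in s up to factors.\<close>
  define s :: real where "s = sqrt (1/2)"
  define L2 where "L2 = real (j + 5) / 2 * (real (j + 3) / 2 * s ^ (j + 1)) * (1 / s ^ 1)
      + real 1 / 2 * (1 / s ^ 3) * (real (j + 5) / 2 * s ^ (j + 3))
      + (real 1 / 2 * (real 3 / 2 * (1 / s ^ 5)) * s ^ (j + 5) + real (j + 5) / 2 * s ^ (j + 3) * (real 1 / 2 * (1 / s ^ 3)))"
  define R2 where "R2 = 2 * (real (j + 6) / 2 * (real (j + 4) / 2 * s ^ (j + 2)))"
  have half: "0 < (1/2::real)" "(1/2::real) < 1" "1 - (1/2::real) = 1/2" by simp_all
  have dL1: "(?L1 has_real_derivative L2) (at (1/2))"
    using DERIV_add[OF
        DERIV_mult[OF DERIV_cmult[OF DERIV_sqrt_power[OF half(1), of "j + 1"], of "real (j + 5) / 2"]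
          DERIV_inverse_sqrt_power[OF half(2), of 1]]
        DERIV_mult[OF DERIV_cmult[OF DERIV_inverse_sqrt_power[OF half(2), of 3], of "real 1 / 2"]
          DERIV_sqrt_power[OF half(1), of "j + 3"]]]
    unfolding e half(3) L2_def s_def by (simp only: mult.assoc add.assoc)
  have dR1: "(?R1 has_real_derivative R2) (at (1/2))"
    using DERIV_cmult[OF DERIV_cmult[OF DERIV_sqrt_power[OF half(1), of "j + 2"], of "real (j + 6) / 2"], of 2]
    unfolding e R2_def s_def .
  have s: "s > 0" "s * s = 1/2" by (auto simp: s_def)
  have s2: "s * (s * x) = x / 2" for x using s(2) by (simp flip: mult.assoc)
  have s3: "s ^ 3 = s / 2" "s ^ 5 = s / 4" by (simp_all add: numeral_eq_Suc s2 mult.commute s(2))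
  have sj: "s ^ (j + 1) = s ^ j * s" "s ^ (j + 2) = s ^ j / 2" "s ^ (j + 3) = s ^ j * s / 2"
    "s ^ (j + 4) = s ^ j / 4" "s ^ (j + 5) = s ^ j * s / 4" "s ^ (j + 6) = s ^ j / 8"
    by (simp_all add: numeral_eq_Suc s2)
  have jump: "R2 < L2"
  proof -
    have "L2 - R2 = s ^ j"
      unfolding L2_def R2_def sj s3 using s(1) by (simp add: field_simps)
    moreover have "s ^ j > 0" using s(1) by (rule zero_less_power)
    ultimately show ?thesis by linarith
  qed
  \<comment> \<open>Flat and round part meet with a common tangent, so the second derivative is the
    first to jump.\<close>
  have C1: "?L (1/2) = ?R (1/2)" "?L1 (1/2) = ?R1 (1/2)"
  proof -
    have "s ^ j * s / 4 * (1 / s ^ 1) = 2 * (s ^ j / 8)" using s(1) by simp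
    then show "?L (1/2) = ?R (1/2)" unfolding half(3) s_def[symmetric] sj .
    have "real (j + 5) / 2 * (s ^ j * s / 2) * (1 / s ^ 1) + real 1 / 2 * (1 / (s / 2)) * (s ^ j * s / 4)
        = 2 * (real (j + 6) / 2 * (s ^ j / 4))"
      using s(1) by (simp add: field_simps)
    then show "?L1 (1/2) = ?R1 (1/2)" unfolding half(3) s_def[symmetric] sj s3 .
  qed
  \<comment> \<open>Of the four nodes from 1/2 - 2 h to 1/2 + h only the last is beyond the break
    point. \<open>?E\<close> and its first derivative vanish at h = 0, and its second derivative
    there is the negative jump R2 - L2.\<close>
  let ?E = "\<lambda>h. ?R (1/2 + h) - 3 * ?L (1/2) + 3 * ?L (1/2 - h) - ?L (1/2 - 2 * h)"
  let ?E1 = "\<lambda>h. ?R1 (1/2 + h) - 3 * ?L1 (1/2 - h) + 2 * ?L1 (1/2 - 2 * h)"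
  have lin: "((\<lambda>h. 1/2 + c * h) has_real_derivative c) (at h)" for c h :: real
    by (auto intro!: derivative_eq_intros)
  have comp: "((\<lambda>h. X (1/2 + c * h)) has_real_derivative D * c) (at h)" if "(X has_real_derivative D) (at (1/2 + c * h))" for X D c h
    using DERIV_chain2[OF that lin] .
  have args: "1/2 + 1 * h = 1/2 + h" "1/2 + (-1) * h = 1/2 - h" "1/2 + (-2) * h = 1/2 - 2 * h" for h :: real
    by simp_all
  have coeff: "A * 1 - 0 + 3 * (B * (-1)) - C * (-2) = A - 3 * B + 2 * C" for A B C :: real
    by simp
  have E': "(?E has_real_derivative ?E1 h) (at h)" if h: "0 \<le> h" "h < 1/8" for h
  proof -
    have "((\<lambda>h. ?R (1/2 + 1 * h) - 3 * ?L (1/2) + 3 * ?L (1/2 + (-1) * h) - ?L (1/2 + (-2) * h)) has_real_derivative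
      ?R1 (1/2 + 1 * h) * 1 - 0 + 3 * (?L1 (1/2 + (-1) * h) * (-1)) - ?L1 (1/2 + (-2) * h) * (-2)) (at h)"
      by (intro DERIV_diff DERIV_add DERIV_cmult comp DERIV_const dR dL) (use h in auto)
    then show ?thesis unfolding args coeff .
  qed
  have E1': "(?E1 has_real_derivative (R2 - L2)) (at 0)"
  proof -
    have "((\<lambda>h. ?R1 (1/2 + 1 * h) - 3 * ?L1 (1/2 + (-1) * h) + 2 * ?L1 (1/2 + (-2) * h)) has_real_derivative
      R2 * 1 - 3 * (L2 * (-1)) + 2 * (L2 * (-2))) (at 0)"
      using dR1 dL1 by (intro DERIV_diff DERIV_add DERIV_cmult comp) (simp_all only: mult_zero_right add_0_right)
    moreover have "R2 * 1 - 3 * (L2 * (-1)) + 2 * (L2 * (-2)) = R2 - L2" by simp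
    ultimately show ?thesis unfolding args by (simp only:)
  qed
  have E10: "?E1 0 = 0" using C1(2) by simp
  obtain d where d: "d > 0" "\<And>h. 0 < h \<Longrightarrow> h < d \<Longrightarrow> ?E1 h < 0"
    using DERIV_neg_dec_right[OF E1'] jump E10 by auto
  \<comment> \<open>h < 1/8 keeps the nodes inside (0, 1), with room for a tent around each.\<close>
  define h where "h = min d (1/8) / 2"
  have h: "0 < h" "h < d" "h < 1/8" using d(1) by (auto simp: h_def)
  have "?E h < ?E 0"
  proof (rule DERIV_neg_imp_decreasing_open[OF h(1), of ?E])
    fix x assume "0 < x" "x < h"
    then show "\<exists>y. DERIV ?E x :> y \<and> y < 0" using E'[of x] d(2)[of x] h by (intro exI[of _ "?E1 x"]) auto
  next
    show "continuous_on {0..h} ?E"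
      by (rule DERIV_continuous_on[of _ _ ?E1]) (use E' h in \<open>auto intro: has_field_derivative_at_within\<close>)
  qed
  then have neg: "?E h < 0" using C1(1) by simp
  have ZL: "Z_profile j v = ?L v" if "0 \<le> v" "v \<le> 1/2" for v
    using that by (simp add: Z_profile_def Z_radius_def)
  have ZR: "Z_profile j v = ?R v" if "1/2 \<le> v" "v \<le> 1" for v
  proof (cases "v = 1/2")
    case True
    show ?thesis unfolding True by (rule trans[OF ZL C1(1)]) auto
  next
    case False
    then show ?thesis using that by (simp add: Z_profile_def Z_radius_def numeral_eq_Suc)
  qed
  have "third_difference h (Z_profile j) (1/2 - 2 * h) = ?E h"
  proof -
    have "1/2 - 2 * h + 3 * h = 1/2 + h" "1/2 - 2 * h + 2 * h = 1/2" "1/2 - 2 * h + h = 1/2 - h" by auto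
    moreover have "Z_profile j (1/2 + h) = ?R (1/2 + h)" "Z_profile j (1/2) = ?L (1/2)"
      "Z_profile j (1/2 - h) = ?L (1/2 - h)" "Z_profile j (1/2 - 2 * h) = ?L (1/2 - 2 * h)"
      by (intro ZL ZR; use h in simp)+
    ultimately show ?thesis by (simp only: third_difference_def)
  qed
  with neg h show ?thesis by (intro that[of h]) auto
qed

section \<open>Test functions and the contradiction\<close>

definition tent :: "real \<Rightarrow> real \<Rightarrow> real \<Rightarrow> real" where
  "tent v0 \<delta> v = max 0 (\<delta> - \<bar>v - v0\<bar>)"

text \<open>The adjoint of \<open>third_difference\<close>: equal coefficients, opposite
  shifts.\<close>

definition tent_difference :: "real \<Rightarrow> real \<Rightarrow> real \<Rightarrow> real \<Rightarrow> real" where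
  "tent_difference h v0 \<delta> v = tent v0 \<delta> (v - 3 * h) - 3 * tent v0 \<delta> (v - 2 * h) + 3 * tent v0 \<delta> (v - h) - tent v0 \<delta> v"

lemma continuous_on_tent [continuous_intros]: "continuous_on A f \<Longrightarrow> continuous_on A (\<lambda>v. tent v0 \<delta> (f v))"
  unfolding tent_def by (intro continuous_intros)

lemma continuous_on_tent_difference: "continuous_on A (tent_difference h v0 \<delta>)"
  unfolding tent_difference_def by (intro continuous_intros)

lemma integrable_continuous_bounded_support:
  fixes f :: "real \<Rightarrow> real"
  assumes "continuous_on UNIV f" "\<And>x. x \<notin> {a..b} \<Longrightarrow> f x = 0"
  shows "integrable lborel f"
proof -
  have "integrable lborel (\<lambda>x. indicator {a..b} x *\<^sub>R f x)"
    by (rule borel_integrable_compact) (use assms(1) continuous_on_subset in auto)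
  also have "(\<lambda>x. indicator {a..b} x *\<^sub>R f x) = f" using assms(2) by (auto simp: fun_eq_iff indicator_def)
  finally show ?thesis .
qed

text \<open>A discrete integration by parts: translation invariance moves each shift from the tent
  to X, and the compact support of the tent makes every term integrable.\<close>

lemma integral_tent_difference:
  assumes X: "continuous_on UNIV X"
  shows "(LINT v|lborel. tent_difference h v0 \<delta> v * X v) = (LINT v|lborel. tent v0 \<delta> v * third_difference h X v)"
    and "integrable lborel (\<lambda>v. tent v0 \<delta> v * third_difference h X v)"
proof -
  let ?t = "tent v0 \<delta>"
  have shift: "(LINT v|lborel. ?t (v - c) * X v) = (LINT v|lborel. ?t v * X (v + c))" for c
    by (subst lborel_integral_real_affine[where c = 1 and t = c]) (auto simp: add.commute)
  have I1: "integrable lborel (\<lambda>v. ?t (v - c) * X v)" for c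
    by (rule integrable_continuous_bounded_support[of _ "v0 + c - \<delta>" "v0 + c + \<delta>"])
      (auto intro!: continuous_intros X simp: tent_def)
  have I2: "integrable lborel (\<lambda>v. ?t v * X (v + c))" for c
    by (rule integrable_continuous_bounded_support[of _ "v0 - \<delta>" "v0 + \<delta>"])
      (auto intro!: continuous_intros continuous_on_compose2[OF X] simp: tent_def)
  have "(LINT v|lborel. tent_difference h v0 \<delta> v * X v)
      = (LINT v|lborel. ?t (v - 3 * h) * X v - 3 * (?t (v - 2 * h) * X v) + 3 * (?t (v - h) * X v) - ?t v * X v)"
    by (simp add: tent_difference_def algebra_simps)
  also have "\<dots> = (LINT v|lborel. ?t (v - 3 * h) * X v) - 3 * (LINT v|lborel. ?t (v - 2 * h) * X v)
      + 3 * (LINT v|lborel. ?t (v - h) * X v) - (LINT v|lborel. ?t v * X v)"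
    using I1 I1[of 0] by simp
  also have "\<dots> = (LINT v|lborel. ?t v * X (v + 3 * h)) - 3 * (LINT v|lborel. ?t v * X (v + 2 * h))
      + 3 * (LINT v|lborel. ?t v * X (v + h)) - (LINT v|lborel. ?t v * X v)"
    by (simp only: shift)
  also have "\<dots> = (LINT v|lborel. ?t v * X (v + 3 * h) - 3 * (?t v * X (v + 2 * h)) + 3 * (?t v * X (v + h)) - ?t v * X v)"
    using I2 I2[of 0] by simp
  also have "\<dots> = (LINT v|lborel. ?t v * third_difference h X v)"
    by (simp add: third_difference_def algebra_simps)
  finally show "(LINT v|lborel. tent_difference h v0 \<delta> v * X v) = (LINT v|lborel. ?t v * third_difference h X v)" .
  show "integrable lborel (\<lambda>v. tent v0 \<delta> v * third_difference h X v)"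
    unfolding third_difference_def
    by (rule integrable_continuous_bounded_support[of _ "v0 - \<delta>" "v0 + \<delta>"])
      (auto intro!: continuous_intros continuous_on_compose2[OF X] simp: tent_def)
qed

text \<open>The substitution is v = 1 - r^2 t^2, the squared sine for a vector whose angle to the
  axis has cosine r t; |t| is the Jacobian up to a constant.\<close>

lemma integral_square_substitution:
  fixes H :: "real \<Rightarrow> real"
  assumes H: "continuous_on UNIV H" and r: "r > 0"
  shows "(LINT t|lborel. indicator {-1<..<1} t * (\<bar>t\<bar> * H (1 - r\<^sup>2 * t\<^sup>2)))
    = (1 / r\<^sup>2) * (LINT v|lborel. H v * indicator {1 - r\<^sup>2..1} v)"
proof -
  let ?q = "\<lambda>t. \<bar>t\<bar> * H (1 - r\<^sup>2 * t\<^sup>2)"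
  have q: "continuous_on UNIV ?q"
    by (intro continuous_intros continuous_on_compose2[OF H]) auto
  \<comment> \<open>The negative half is kept because v increases with t on it.\<close>
  have iq: "integrable lborel (\<lambda>t. ?q t * indicator {-1..0} t)"
  proof -
    have "integrable lborel (\<lambda>t. indicator {-1..0} t *\<^sub>R ?q t)"
      by (rule borel_integrable_compact) (use q continuous_on_subset in auto)
    then show ?thesis by (simp add: mult.commute)
  qed
  have flip: "(LINT t|lborel. ?q t * indicator {-1..0} (- t)) = (LINT t|lborel. ?q t * indicator {-1..0} t)"
    by (subst lborel_integral_real_affine[where c = "-1" and t = 0]) auto
  have iq': "integrable lborel (\<lambda>t. ?q t * indicator {-1..0} (- t))"
    using lborel_integrable_real_affine[OF iq, of "-1" 0] by simp
  have "(LINT t|lborel. indicator {-1<..<1} t * ?q t) = (LINT t|lborel. ?q t * indicator {-1..0} t + ?q t * indicator {-1..0} (- t))"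
  proof (rule integral_cong_AE)
    have [measurable]: "?q \<in> borel_measurable borel" using q by (rule borel_measurable_continuous_onI)
    show "(\<lambda>t. indicator {-1<..<1} t * ?q t) \<in> borel_measurable lborel"
      "(\<lambda>t. ?q t * indicator {-1..0} t + ?q t * indicator {-1..0} (- t)) \<in> borel_measurable lborel"
      by measurable
    show "AE t in lborel. indicator {-1<..<1} t * ?q t = ?q t * indicator {-1..0} t + ?q t * indicator {-1..0} (- t)"
      using AE_lborel_singleton[of 0] AE_lborel_singleton[of 1] AE_lborel_singleton[of "-1"]
      by eventually_elim (auto simp: indicator_def)
  qed
  also have "\<dots> = 2 * (LINT t|lborel. ?q t * indicator {-1..0} t)"
    using iq iq' flip by simp
  also have "(LINT t|lborel. ?q t * indicator {-1..0} t)
      = (LINT t|lborel. 1 / (2 * r\<^sup>2) * (H (1 - r\<^sup>2 * t\<^sup>2) * (- 2 * r\<^sup>2 * t) * indicator {-1..0} t))"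
    by (rule Bochner_Integration.integral_cong) (use r in \<open>auto simp: indicator_def\<close>)
  also have "\<dots> = 1 / (2 * r\<^sup>2) * (LINT t|lborel. H (1 - r\<^sup>2 * t\<^sup>2) * (- 2 * r\<^sup>2 * t) * indicator {-1..0} t)"
    by (rule integral_mult_right_zero)
  also have "(LINT t|lborel. H (1 - r\<^sup>2 * t\<^sup>2) * (- 2 * r\<^sup>2 * t) * indicator {-1..0} t)
      = (LINT v|lborel. H v * indicator {1 - r\<^sup>2 * (-1)\<^sup>2..1 - r\<^sup>2 * 0\<^sup>2} v)"
  proof (rule integral_substitution(2)[symmetric])
    show "set_integrable lborel {1 - r\<^sup>2 * (-1)\<^sup>2..1 - r\<^sup>2 * 0\<^sup>2} H"
      unfolding set_integrable_def by (rule borel_integrable_compact) (use H continuous_on_subset in auto)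
    show "((\<lambda>t. 1 - r\<^sup>2 * t\<^sup>2) has_real_derivative - 2 * r\<^sup>2 * t) (at t)" for t
      by (auto intro!: derivative_eq_intros)
    show "0 \<le> - 2 * r\<^sup>2 * t" if "t \<in> {-1..0}" for t
      using that mult_nonneg_nonpos[of "2 * r\<^sup>2" t] by simp
  qed (auto intro!: continuous_intros)
  finally show ?thesis by simp
qed

text \<open>Up to positive factors, the Radon transform of the test function is a tent integrated
  against a third difference of the kernel, and its pairing with the radial function is the same
  tent against the third difference of G. The former is nonnegative; the tent is placed where the
  latter is negative.\<close>

theorem not_intersection_body_ball_sum:
  fixes k :: "'n::finite"
  assumes n: "CARD('n) \<ge> 8"
  shows "\<not> intersection_body (ball_sum k)"
proof
  assume IB: "intersection_body (ball_sum k)"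
  let ?e = "axis k 1 :: real^'n"
  obtain j where j: "CARD('n) = j + 8" using n by (metis le_add_diff_inverse2)
  have dims: "DIM(real^'n) \<ge> 4" "DIM(real^'n) \<ge> 3" "DIM(real^'n) - 4 = j + 4" "DIM(real^'n) - 3 = j + 5"
    using j by auto
  let ?G = "Z_profile j"
  obtain h where h: "0 < h" "h < 1/8" "third_difference h ?G (1/2 - 2 * h) < 0"
    by (rule third_difference_Z_profile_neg)
  define v0 where "v0 = 1/2 - 2 * h"
  have "continuous_on UNIV (third_difference h ?G)"
    unfolding third_difference_def
    by (intro continuous_intros continuous_on_compose2[OF continuous_on_Z_profile]) auto
  then have "isCont (third_difference h ?G) v0" by (simp add: continuous_on_eq_continuous_at)
  then have "eventually (\<lambda>v. third_difference h ?G v < 0) (at v0)"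
    using h(3) by (intro order_tendstoD(2)[OF isContD]) (simp_all only: v0_def)
  then obtain d where d: "d > 0" "\<And>v. v \<noteq> v0 \<Longrightarrow> dist v v0 < d \<Longrightarrow> third_difference h ?G v < 0"
    unfolding eventually_at by auto
  have d_neg: "third_difference h ?G v < 0" if "\<bar>v - v0\<bar> < d" for v
    using d(2)[of v] that h(3) by (cases "v = v0") (auto simp: dist_real_def v0_def)
  \<comment> \<open>With h < 1/8 and \<delta> \<le> 1/8 all shifted tents are supported in
    [0, 1].\<close>
  define \<delta> where "\<delta> = min d (1/8)"
  have \<delta>: "0 < \<delta>" "\<delta> \<le> 1/8" "\<And>v. \<bar>v - v0\<bar> < \<delta> \<Longrightarrow> third_difference h ?G v < 0"
    using d(1) d_neg by (auto simp: \<delta>_def)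
  define K where "K = tent_difference h v0 \<delta>"
  have K_cont: "continuous_on A K" for A unfolding K_def by (rule continuous_on_tent_difference)
  have K_supp: "K v = 0" if "v \<notin> {0..1}" for v
    using that h \<delta> by (auto simp: K_def tent_difference_def tent_def v0_def max_def)
  \<comment> \<open>The factor |u| is the Jacobian of v = 1 - u^2, so that K is paired with plain
    functions of v. It also makes f vanish at 0, which settles the case of \<xi> on the
    axis.\<close>
  define f where "f u = \<bar>u\<bar> * K (1 - u\<^sup>2)" for u
  have f_cont: "continuous_on A f" for A
    unfolding f_def by (intro continuous_intros continuous_on_compose2[OF K_cont[of UNIV]]) auto
  have [measurable]: "f \<in> borel_measurable borel" by (rule borel_measurable_continuous_onI[OF f_cont])
  have [measurable]: "Z_radius \<in> borel_measurable borel" by (rule borel_measurable_continuous_onI[OF continuous_on_Z_radius])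
  define g where "g \<theta> = f (\<theta> \<bullet> ?e)" for \<theta> :: "real^'n"
  have g_cont: "continuous_on (sphere 0 1) g"
    unfolding g_def by (intro continuous_on_compose2[OF f_cont[of UNIV]] continuous_intros) auto
  have radon_g: "spherical_radon g \<xi> \<ge> 0" if \<xi>: "norm \<xi> = 1" for \<xi>
  proof -
    define w where "w = (\<xi> \<bullet> ?e)\<^sup>2"
    define r where "r = sqrt (1 - w)"
    have w: "0 \<le> w" "w \<le> 1"
      using component_le_norm[OF \<xi>, of k] by (auto simp: w_def inner_axis_one abs_square_le_1)
    have r: "r \<ge> 0" "r\<^sup>2 = 1 - w" using w by (auto simp: r_def)
    have eq: "spherical_radon g \<xi> = zonal_const TYPE(real^'n) *
        (LINT t|lborel. sqrt (1 - t\<^sup>2) ^ (j + 4) * indicator {-1<..<1} t * f (r * t))"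
      using spherical_radon_zonal[OF \<xi> _ dims(1), of ?e f] unfolding g_def[abs_def] dims r_def w_def by simp
    have "(LINT t|lborel. sqrt (1 - t\<^sup>2) ^ (j + 4) * indicator {-1<..<1} t * f (r * t)) \<ge> 0"
    proof (cases "r = 0")
      case True
      then show ?thesis by (simp add: f_def)
    next
      case False
      then have r0: "r > 0" using r(1) by simp
      let ?X = "\<lambda>v. truncated_power (j + 4) (v - w)"
      \<comment> \<open>One r comes from |r t| in f. The power r^(j + 4) is the ratio of the
        truncated power of v - w = r^2 (1 - t^2) to the weight of the subsphere.\<close>
      define c where "c = r / r ^ (j + 4)"
      have c: "c \<ge> 0" using r0 by (simp add: c_def)
      have X: "continuous_on UNIV ?X" by (intro continuous_intros)
      have "(LINT t|lborel. sqrt (1 - t\<^sup>2) ^ (j + 4) * indicator {-1<..<1} t * f (r * t))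
        = (LINT t|lborel. indicator {-1<..<1} t * (\<bar>t\<bar> * (c * (K (1 - r\<^sup>2 * t\<^sup>2) * ?X (1 - r\<^sup>2 * t\<^sup>2)))))"
      proof (rule Bochner_Integration.integral_cong[OF refl])
        fix t :: real
        show "sqrt (1 - t\<^sup>2) ^ (j + 4) * indicator {-1<..<1} t * f (r * t)
          = indicator {-1<..<1} t * (\<bar>t\<bar> * (c * (K (1 - r\<^sup>2 * t\<^sup>2) * ?X (1 - r\<^sup>2 * t\<^sup>2))))"
        proof (cases "t \<in> {-1<..<1}")
          case True
          then have t: "t\<^sup>2 \<le> 1" by (auto simp: abs_square_le_1)
          have "1 - r\<^sup>2 * t\<^sup>2 - w = r\<^sup>2 * (1 - t\<^sup>2)" using r(2) by (simp add: algebra_simps)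
          then have "?X (1 - r\<^sup>2 * t\<^sup>2) = r ^ (j + 4) * sqrt (1 - t\<^sup>2) ^ (j + 4)"
            using r0 t by (simp add: truncated_power_def max_def real_sqrt_mult power_mult_distrib zero_le_mult_iff)
          then have "c * ?X (1 - r\<^sup>2 * t\<^sup>2) = r * sqrt (1 - t\<^sup>2) ^ (j + 4)"
            using r0 by (simp add: c_def)
          then have keq: "c * (K (1 - r\<^sup>2 * t\<^sup>2) * ?X (1 - r\<^sup>2 * t\<^sup>2)) = K (1 - r\<^sup>2 * t\<^sup>2) * (r * sqrt (1 - t\<^sup>2) ^ (j + 4))"
            by (metis mult.left_commute)
          show ?thesis unfolding keq using True r0 by (simp add: f_def abs_mult power_mult_distrib mult_ac)
        qed simp
      qed
      also have "\<dots> = 1 / r\<^sup>2 * (LINT v|lborel. c * (K v * ?X v) * indicator {1 - r\<^sup>2..1} v)"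
        by (rule integral_square_substitution[OF _ r0]) (intro continuous_intros K_cont X)
      also have "(LINT v|lborel. c * (K v * ?X v) * indicator {1 - r\<^sup>2..1} v) = (LINT v|lborel. c * (K v * ?X v))"
      proof (rule Bochner_Integration.integral_cong[OF refl])
        fix v
        have "1 - r\<^sup>2 = w" using r(2) by simp
        moreover have "?X v = 0" if "v < w" using that by (simp add: truncated_power_def)
        moreover have "K v = 0" if "v > 1" using that by (intro K_supp) auto
        ultimately show "c * (K v * ?X v) * indicator {1 - r\<^sup>2..1} v = c * (K v * ?X v)"
          by (cases "v < w"; cases "v > 1") (auto simp: indicator_def)
      qed
      also have "\<dots> = c * (LINT v|lborel. tent v0 \<delta> v * third_difference h ?X v)"
        using integral_tent_difference(1)[OF X, of h v0 \<delta>] by (simp add: K_def)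
      also have "1 / r\<^sup>2 * \<dots> \<ge> 0"
        using c third_difference_truncated_power_nonneg[OF h(1), of j w]
        by (intro mult_nonneg_nonneg Bochner_Integration.integral_nonneg) (auto simp: tent_def)
      finally show ?thesis .
    qed
    moreover have "zonal_const TYPE(real^'n) > 0" using n by (intro zonal_const) simp
    ultimately show ?thesis unfolding eq by simp
  qed
  have "(LINT \<xi>|sphere_measure UNIV. radial_fun (ball_sum k) \<xi> * g \<xi>) \<ge> 0"
    by (rule intersection_body_pairing_nonneg[OF IB g_cont radon_g])
  also have "(LINT \<xi>|sphere_measure UNIV. radial_fun (ball_sum k) \<xi> * g \<xi>)
      = (LINT \<xi>|sphere_measure UNIV. Z_radius (\<xi> \<bullet> ?e) * f (\<xi> \<bullet> ?e))"
    by (rule Bochner_Integration.integral_cong)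
      (auto simp: space_sphere_measure radial_fun_ball_sum g_def inner_axis_one)
  finally have ge0: "(LINT \<xi>|sphere_measure UNIV. Z_radius (\<xi> \<bullet> ?e) * f (\<xi> \<bullet> ?e)) \<ge> 0" .
  obtain c where c: "c > 0" "\<And>f. f \<in> borel_measurable borel \<Longrightarrow> (LINT \<theta>|sphere_measure UNIV. f (\<theta> \<bullet> ?e))
    = c * (LINT t|lborel. sqrt (1 - t\<^sup>2) ^ (j + 5) * indicator {-1<..<1} t * f t)"
    using integral_surface_zonal[OF _ dims(2), of ?e, unfolded dims(4)] by auto
  have "(LINT t|lborel. sqrt (1 - t\<^sup>2) ^ (j + 5) * indicator {-1<..<1} t * (Z_radius t * f t)) \<ge> 0"
    using ge0 c(1) by (subst (asm) c(2)[of "\<lambda>u. Z_radius u * f u"]) (auto simp: zero_le_mult_iff)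
  also have "(LINT t|lborel. sqrt (1 - t\<^sup>2) ^ (j + 5) * indicator {-1<..<1} t * (Z_radius t * f t))
    = (LINT t|lborel. indicator {-1<..<1} t * (\<bar>t\<bar> * (K (1 - 1\<^sup>2 * t\<^sup>2) * ?G (1 - 1\<^sup>2 * t\<^sup>2))))"
  proof (rule Bochner_Integration.integral_cong[OF refl])
    fix t :: real
    have "Z_radius \<bar>t\<bar> = Z_radius t" by (simp add: Z_radius_def)
    then show "sqrt (1 - t\<^sup>2) ^ (j + 5) * indicator {-1<..<1} t * (Z_radius t * f t)
      = indicator {-1<..<1} t * (\<bar>t\<bar> * (K (1 - 1\<^sup>2 * t\<^sup>2) * ?G (1 - 1\<^sup>2 * t\<^sup>2)))"
      by (simp add: Z_profile_def f_def mult_ac)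
  qed
  also have "\<dots> = 1 / 1\<^sup>2 * (LINT v|lborel. K v * ?G v * indicator {1 - 1\<^sup>2..1} v)"
    by (rule integral_square_substitution) (auto intro!: continuous_intros K_cont continuous_on_Z_profile)
  also have "\<dots> = (LINT v|lborel. K v * ?G v)"
  proof -
    have "(LINT v|lborel. K v * ?G v * indicator {1 - 1\<^sup>2..1} v) = (LINT v|lborel. K v * ?G v)"
      by (rule Bochner_Integration.integral_cong[OF refl]) (use K_supp in \<open>auto simp: indicator_def\<close>)
    then show ?thesis by simp
  qed
  also have "\<dots> = (LINT v|lborel. tent v0 \<delta> v * third_difference h ?G v)"
    unfolding K_def by (rule integral_tent_difference(1)[OF continuous_on_Z_profile])
  finally have ge: "(LINT v|lborel. tent v0 \<delta> v * third_difference h ?G v) \<ge> 0" .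
  \<comment> \<open>The negated integrand is nonnegative and, by \<open>ge\<close>, has integral at
    most 0, so it vanishes almost everywhere. Yet it is positive on the whole interval where the
    tent is.\<close>
  let ?q = "\<lambda>v. - (tent v0 \<delta> v * third_difference h ?G v)"
  have q0: "?q v \<ge> 0" for v
    using \<delta>(3)[of v] by (cases "\<bar>v - v0\<bar> < \<delta>") (auto simp: tent_def mult_nonneg_nonpos)
  have int: "integrable lborel ?q"
    by (intro integrable_minus integral_tent_difference(2)[OF continuous_on_Z_profile])
  have "(LINT v|lborel. ?q v) = 0"
    using ge Bochner_Integration.integral_nonneg[of lborel ?q] q0 by (simp add: order_antisym)
  then have "AE v in lborel. ?q v = 0"
    using integral_nonneg_eq_0_iff_AE[OF int] q0 by simp
  then have "AE v in lborel. v \<notin> {v0 - \<delta><..<v0 + \<delta>}"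
  proof eventually_elim
    case (elim v)
    show ?case
    proof
      assume "v \<in> {v0 - \<delta><..<v0 + \<delta>}"
      then have "\<bar>v - v0\<bar> < \<delta>" by (auto simp: abs_less_iff)
      then show False using \<delta>(3)[of v] elim by (auto simp: tent_def max_def split: if_splits)
    qed
  qed
  then have "{v0 - \<delta><..<v0 + \<delta>} \<in> null_sets lborel" by (subst AE_iff_null_sets) auto
  then show False using \<delta>(1) by (simp add: null_sets_def)
qed

theorem mainTheorem6:
  fixes k :: "'n::finite"
  assumes "CARD('n) \<ge> 2"
  shows "(CARD('n) = 5 \<or> CARD('n) = 6 \<longrightarrow> intersection_body (ball_sum k)) \<and>
         (CARD('n) \<ge> 8 \<longrightarrow> \<not> intersection_body (ball_sum k))"
  using intersection_body_ball_sum_5[of k] intersection_body_ball_sum_6[of k]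
    not_intersection_body_ball_sum[of k] by blast

end
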